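(* Let $n\ge 1$ be an integer, $\sigma\ge 1$ and $0\le \sigma_1<\sigma/2<\sigma_2\le\sigma$ be real numbers. Assume that the real number $m$ satisfies $$1<m\le 2\ \text{ if }\sigma_1=0,\qquad 1<m<\frac{2n}{n+4\sigma_1}\ \text{ if }\sigma_1>0,$$ and that the exponent $p>1$ satisfies one of the following: (i) $n\le 2\sigma$ and $\frac{2}{m}<p<\infty$; or (ii) $2\sigma<n<\frac{4\sigma}{2-m}$ and $\frac{2}{m}<p\le \frac{n}{n-2\sigma}$. Let $(u_0,u_1)\in \mathcal{D}_\sigma^m$. Then there exist $T>0$ and a constant $\varepsilon_0>0$ such that for any $\varepsilon\in(0,\varepsilon_0]$ the Cauchy problem $$\begin{cases} u_{tt}+(-\Delta)^\sigma u+(-\Delta)^{\sigma_1}u_t+(-\Delta)^{\sigma_2}u_t=|u|^p, & x\in\mathbb{R}^n,\ t>0,\\ u(0,x)=\varepsilon u_0(x),\quad u_t(0,x)=\varepsilon u_1(x), & x\in\mathbb{R}^n,\end{cases}$$ admits a unique local (in time) solution $u\in \mathcal{C}([0,T),H^\sigma)$.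
   Context: All functions are on $\mathbb{R}^n$; $H^a$ ($a\ge0$) is the $L^2$-based Bessel potential space on $\mathbb{R}^n$. The fractional Laplacian is $(-\Delta)^{a}\psi=\mathfrak{F}^{-1}(|\xi|^{2a}\mathfrak{F}(\psi)(\xi))$, with $\mathfrak{F}$ the Fourier transform in $x$. If $m=2$, the quantity $\frac{4\sigma}{2-m}$ is read as $+\infty$. The data space is $\mathcal{D}_\sigma^m=(H^\sigma\cap L^m)\times(L^2\cap L^m)$ with norm $\|(\phi_0,\phi_1)\|_{\mathcal{D}_\sigma^m}=\|\phi_0\|_{H^\sigma}+\|\phi_0\|_{L^m}+\|\phi_1\|_{L^2}+\|\phi_1\|_{L^m}$. Solutions are understood via Duhamel's formula: $$u(t,x)=\varepsilon K_0(t,x)*_x u_0(x)+\varepsilon K_1(t,x)*_x u_1(x)+\int_0^t K_1(t-\tau,x)*_x|u(\tau,x)|^p\,d\tau,$$ where the kernels are defined by their Fourier transforms in $x$, $$\widehat{K_0}(t,\xi)=\frac{\lambda_1e^{\lambda_2t}-\lambda_2e^{\lambda_1t}}{\lambda_1-\lambda_2},\qquad \widehat{K_1}(t,\xi)=\frac{e^{\lambda_1t}-e^{\lambda_2t}}{\lambda_1-\lambda_2},$$ and $\lambda_{1,2}=\lambda_{1,2}(|\xi|)$ are the two (real or complex conjugate) roots $\lambda_{1,2}=\frac12\big(-|\xi|^{2\sigma_1}-|\xi|^{2\sigma_2}\pm\sqrt{(|\xi|^{2\sigma_1}+|\xi|^{2\sigma_2})^2-4|\xi|^{2\sigma}}\big)$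 (the quotients being understood as limits where $\lambda_1=\lambda_2$). *)

theory Defs
  imports "HOL-Analysis.Analysis"
begin

definition Lp :: "real \<Rightarrow> (real ^ 'n \<Rightarrow> complex) set" where
  "Lp q = {f \<in> borel_measurable lebesgue. integrable lebesgue (\<lambda>x. cmod (f x) powr q)}"

definition Lp_norm :: "real \<Rightarrow> (real ^ 'n \<Rightarrow> complex) \<Rightarrow> real" where
  "Lp_norm q f = (\<integral>x. cmod (f x) powr q \<partial>lebesgue) powr (1 / q)"

text \<open>The Fourier transform is unnormalised, so that it turns convolutions into products.
  On \<open>L\<^sup>2\<close> it is the \<open>L\<^sup>2\<close>-limit of the transforms of truncations; by Plancherel's theorem
  the limit exists, and it is unique up to null sets, so only almost-everywhere statements
  about \<open>fourier\<close> are meaningful.\<close>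

definition fourier_L1 :: "(real ^ 'n \<Rightarrow> complex) \<Rightarrow> real ^ 'n \<Rightarrow> complex" where
  "fourier_L1 f \<xi> = (\<integral>x. exp (- \<i> * of_real (x \<bullet> \<xi>)) * f x \<partial>lebesgue)"

definition is_fourier :: "(real ^ 'n \<Rightarrow> complex) \<Rightarrow> (real ^ 'n \<Rightarrow> complex) \<Rightarrow> bool" where
  "is_fourier f g \<longleftrightarrow> f \<in> Lp 2 \<and> g \<in> Lp 2 \<and>
     ((\<lambda>R. \<integral>\<^sup>+ \<xi>. ennreal ((cmod (fourier_L1 (\<lambda>x. indicator (ball 0 R) x * f x) \<xi> - g \<xi>))\<^sup>2) \<partial>lebesgue)
        \<longlongrightarrow> 0) at_top"

definition fourier :: "(real ^ 'n \<Rightarrow> complex) \<Rightarrow> real ^ 'n \<Rightarrow> complex" where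
  "fourier f = (SOME g. is_fourier f g)"

definition bessel_weight :: "real \<Rightarrow> (real ^ 'n \<Rightarrow> complex) \<Rightarrow> real ^ 'n \<Rightarrow> complex" where
  "bessel_weight a f \<xi> = of_real ((1 + (norm \<xi>)\<^sup>2) powr (a / 2)) * fourier f \<xi>"

definition Hs :: "real \<Rightarrow> (real ^ 'n \<Rightarrow> complex) set" where
  "Hs a = {f \<in> Lp 2. bessel_weight a f \<in> Lp 2}"

text \<open>The factor compensates for the unnormalised transform: \<open>Hs_norm a f\<close> is the
  \<open>L\<^sup>2\<close>-norm of \<open>(1 - \<Delta>)\<^bsup>a/2\<^esup> f\<close>.\<close>

definition Hs_norm :: "real \<Rightarrow> (real ^ 'n \<Rightarrow> complex) \<Rightarrow> real" where
  "Hs_norm a f = (2 * pi) powr (- real CARD('n) / 2) * Lp_norm 2 (bessel_weight a f)"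

definition data_space ::
    "real \<Rightarrow> real \<Rightarrow> ((real ^ 'n \<Rightarrow> complex) \<times> (real ^ 'n \<Rightarrow> complex)) set" where
  "data_space \<sigma> m = (Hs \<sigma> \<inter> Lp m) \<times> (Lp 2 \<inter> Lp m)"

definition continuous_into_Hs ::
    "real \<Rightarrow> real set \<Rightarrow> (real \<Rightarrow> real ^ 'n \<Rightarrow> complex) \<Rightarrow> bool" where
  "continuous_into_Hs a S u \<longleftrightarrow> (\<forall>t\<in>S. u t \<in> Hs a) \<and>
     (\<forall>t\<in>S. ((\<lambda>s. Hs_norm a (\<lambda>x. u s x - u t x)) \<longlongrightarrow> 0) (at t within S))"

text \<open>Since \<open>0 powr 0 = 0\<close>, the case \<open>\<sigma>\<^sub>1 = 0\<close> differs from \<open>\<bar>\<xi>\<bar>\<^sup>0 = 1\<close> at \<open>\<xi> = 0\<close>; this affects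
  the symbols below on a null set only.\<close>

definition damping :: "real \<Rightarrow> real \<Rightarrow> real ^ 'n \<Rightarrow> real" where
  "damping \<sigma>1 \<sigma>2 \<xi> = norm \<xi> powr (2 * \<sigma>1) + norm \<xi> powr (2 * \<sigma>2)"

definition disc_root :: "real \<Rightarrow> real \<Rightarrow> real \<Rightarrow> real ^ 'n \<Rightarrow> complex" where
  "disc_root \<sigma> \<sigma>1 \<sigma>2 \<xi> = csqrt (of_real ((damping \<sigma>1 \<sigma>2 \<xi>)\<^sup>2 - 4 * norm \<xi> powr (2 * \<sigma>)))"

definition lam1 :: "real \<Rightarrow> real \<Rightarrow> real \<Rightarrow> real ^ 'n \<Rightarrow> complex" where
  "lam1 \<sigma> \<sigma>1 \<sigma>2 \<xi> = (- of_real (damping \<sigma>1 \<sigma>2 \<xi>) + disc_root \<sigma> \<sigma>1 \<sigma>2 \<xi>) / 2"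

definition lam2 :: "real \<Rightarrow> real \<Rightarrow> real \<Rightarrow> real ^ 'n \<Rightarrow> complex" where
  "lam2 \<sigma> \<sigma>1 \<sigma>2 \<xi> = (- of_real (damping \<sigma>1 \<sigma>2 \<xi>) - disc_root \<sigma> \<sigma>1 \<sigma>2 \<xi>) / 2"

text \<open>The values for a double root are the limits of the quotients as the two roots merge.\<close>

definition K0_hat :: "real \<Rightarrow> real \<Rightarrow> real \<Rightarrow> real \<Rightarrow> real ^ 'n \<Rightarrow> complex" where
  "K0_hat \<sigma> \<sigma>1 \<sigma>2 t \<xi> =
     (let l1 = lam1 \<sigma> \<sigma>1 \<sigma>2 \<xi>; l2 = lam2 \<sigma> \<sigma>1 \<sigma>2 \<xi> in
      if l1 = l2 then (1 - l1 * of_real t) * exp (l1 * of_real t)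
      else (l1 * exp (l2 * of_real t) - l2 * exp (l1 * of_real t)) / (l1 - l2))"

definition K1_hat :: "real \<Rightarrow> real \<Rightarrow> real \<Rightarrow> real \<Rightarrow> real ^ 'n \<Rightarrow> complex" where
  "K1_hat \<sigma> \<sigma>1 \<sigma>2 t \<xi> =
     (let l1 = lam1 \<sigma> \<sigma>1 \<sigma>2 \<xi>; l2 = lam2 \<sigma> \<sigma>1 \<sigma>2 \<xi> in
      if l1 = l2 then of_real t * exp (l1 * of_real t)
      else (exp (l1 * of_real t) - exp (l2 * of_real t)) / (l1 - l2))"

text \<open>\<open>kernel_conv Kh f\<close> is the convolution \<open>K * f\<close> with the (distributional) kernel \<open>K\<close> whose
  Fourier transform is \<open>Kh\<close>; it is determined up to null sets when \<open>f\<close> and \<open>Kh * fourier f\<close>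
  are in \<open>L\<^sup>2\<close>.\<close>

definition kernel_conv ::
    "(real ^ 'n \<Rightarrow> complex) \<Rightarrow> (real ^ 'n \<Rightarrow> complex) \<Rightarrow> real ^ 'n \<Rightarrow> complex" where
  "kernel_conv Kh f =
     (SOME g. g \<in> Lp 2 \<and> (AE \<xi> in lebesgue. fourier g \<xi> = Kh \<xi> * fourier f \<xi>))"

text \<open>The Bochner integral over \<open>S\<close> of an \<open>L\<^sup>2\<close>-valued function: \<open>F\<close> is approximated in
  \<open>L\<^sup>1(S; L\<^sup>2)\<close> by the simple functions with value \<open>f k i\<close> on \<open>A k i\<close> (for \<open>i < N k\<close>), whose
  integrals converge to \<open>I\<close> in \<open>L\<^sup>2\<close>. The library version needs a normed type and does not apply
  to \<open>L\<^sup>2\<close> as a space of functions modulo null sets.\<close>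

definition has_L2_bochner_integral ::
    "(real \<Rightarrow> real ^ 'n \<Rightarrow> complex) \<Rightarrow> real set \<Rightarrow> (real ^ 'n \<Rightarrow> complex) \<Rightarrow> bool" where
  "has_L2_bochner_integral F S I \<longleftrightarrow>
     (\<forall>\<tau>\<in>S. F \<tau> \<in> Lp 2) \<and> I \<in> Lp 2 \<and>
     (\<exists>(N :: nat \<Rightarrow> nat) (A :: nat \<Rightarrow> nat \<Rightarrow> real set) (f :: nat \<Rightarrow> nat \<Rightarrow> real ^ 'n \<Rightarrow> complex).
        let dist_simple = (\<lambda>k \<tau>. Lp_norm 2 (\<lambda>x. F \<tau> x - (\<Sum>i<N k. indicator (A k i) \<tau> * f k i x)))
        in
          (\<forall>k. \<forall>i<N k. A k i \<in> sets lebesgue \<and> A k i \<subseteq> S \<and> emeasure lebesgue (A k i) < \<infinity>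
                        \<and> f k i \<in> Lp 2) \<and>
          (\<forall>k. dist_simple k \<in> borel_measurable (lebesgue_on S)) \<and>
          (\<lambda>k. \<integral>\<^sup>+ \<tau>. ennreal (dist_simple k \<tau>) \<partial>lebesgue_on S) \<longlonglongrightarrow> 0 \<and>
          (\<lambda>k. Lp_norm 2 (\<lambda>x. (\<Sum>i<N k. of_real (measure lebesgue (A k i)) * f k i x) - I x))
             \<longlonglongrightarrow> 0)"

text \<open>Solutions in \<open>C([0,T), H\<^sup>\<sigma>)\<close> in the sense of Duhamel's formula. Membership of \<open>\<bar>u\<bar>\<^sup>p\<close> in
  \<open>L\<^sup>2\<close> is what gives the convolution under the integral a meaning.\<close>

definition duhamel_solution ::
    "real \<Rightarrow> real \<Rightarrow> real \<Rightarrow> real \<Rightarrow> real \<Rightarrow> real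
      \<Rightarrow> (real ^ 'n \<Rightarrow> complex) \<Rightarrow> (real ^ 'n \<Rightarrow> complex)
      \<Rightarrow> (real \<Rightarrow> real ^ 'n \<Rightarrow> complex) \<Rightarrow> bool" where
  "duhamel_solution \<sigma> \<sigma>1 \<sigma>2 p T \<epsilon> u0 u1 u \<longleftrightarrow>
     continuous_into_Hs \<sigma> {0..<T} u \<and>
     (\<forall>t\<in>{0..<T}. (\<lambda>x. of_real (cmod (u t x) powr p)) \<in> Lp 2) \<and>
     (\<forall>t\<in>{0..<T}. \<exists>I.
        has_L2_bochner_integral
          (\<lambda>\<tau>. kernel_conv (K1_hat \<sigma> \<sigma>1 \<sigma>2 (t - \<tau>)) (\<lambda>x. of_real (cmod (u \<tau> x) powr p)))
          {0..t} I \<and>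
        (AE x in lebesgue.
           u t x = of_real \<epsilon> * kernel_conv (K0_hat \<sigma> \<sigma>1 \<sigma>2 t) u0 x
                 + of_real \<epsilon> * kernel_conv (K1_hat \<sigma> \<sigma>1 \<sigma>2 t) u1 x + I x))"

end

theory Submission
  imports Defs "HOL-Probability.Characteristic_Functions"
begin

text \<open>Apply \<open>(1 - \<Delta>)\<^bsup>\<sigma>/2\<^esup>\<close> and the Fourier transform to the unknown: \<open>C([0,T), H\<^sup>\<sigma>)\<close> becomes
  \<open>C([0,T), L\<^sup>2)\<close> and Duhamel's formula becomes a Volterra equation
  \<open>w(t) = a(t) + \<integral>\<^sub>0\<^sup>t B(t-s) g(w(s)) ds\<close> in the Banach space \<open>L\<^sup>2\<close>. The operators \<open>B(t)\<close> are bounded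
  uniformly for \<open>t \<le> 1\<close>, because the energy \<open>|v'|\<^sup>2 + |\<xi>|\<^sup>2\<^sup>\<sigma> |v|\<^sup>2\<close> of the damped oscillator solved by
  the kernels decreases. The map \<open>g\<close> is locally Lipschitz by the Sobolev embedding of \<open>H\<^sup>\<sigma>\<close> into
  \<open>L\<^sup>2\<^sup>p\<close>, whose exponent is at most critical under either hypothesis on \<open>p\<close>. Banach's fixed point theorem
  gives existence for a small \<open>T\<close>, and iterating the integral inequality for the difference of two
  solutions gives uniqueness.\<close>

section \<open>The Hilbert space \<open>L\<^sup>2\<close>\<close>

text \<open>The definitions concern functions fixed only up to null sets and chosen by
  \<open>SOME\<close>, while a fixed point theorem needs a Banach space. Hence \<open>L^2\<close>
  becomes a type \<open>l2\<close> of classes, and every notion is shown to depend on the class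
  alone. \<open>H^\<sigma>\<close> gets no type of its own: the unknown is the weighted transform
  \<open>w\<close>, an arbitrary element of \<open>L^2\<close>. The weight costs \<sigma>
  derivatives, and the kernel of \<open>K1\<close> pays them back, since it is at most
  \<open>t\<close> at low and at most |\<xi>|^(-\<sigma>) at high frequencies; the first bound is
  why times stay below 1. Both hypotheses on \<open>p\<close> enter as n (1 - 1/p) \<le> 2 \<sigma>,
  which puts |u|^p in \<open>L^2\<close>. The existence time depends only on a bound for the linear
  part valid for all \<epsilon> \<le> 1; hence one \<open>T\<close> serves every \<epsilon>, with
  \<epsilon>0 = 1. The contraction yields uniqueness only within one ball, whereas a solution on
  [0,T) may leave that ball and grow without bound near \<open>T\<close>. Uniqueness therefore has
  its own argument, on compact subintervals and with constants depending on the two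
  solutions.\<close>

lemma Lp_2_iff:
  "f \<in> Lp 2 \<longleftrightarrow> f \<in> borel_measurable lebesgue \<and> integrable lebesgue (\<lambda>x. (cmod (f x))\<^sup>2)"
  by (simp add: Lp_def)

lemma Lp_2_D:
  assumes "f \<in> Lp 2"
  shows "f \<in> borel_measurable lebesgue" "integrable lebesgue (\<lambda>x. (cmod (f x))\<^sup>2)"
  using assms by (auto simp: Lp_2_iff)

lemma Lp_2_bound:
  assumes "f \<in> Lp 2" "g \<in> borel_measurable lebesgue"
    and "AE x in lebesgue. cmod (g x) \<le> C * cmod (f x)"
  shows "g \<in> Lp 2"
proof -
  have "integrable lebesgue (\<lambda>x. (cmod (g x))\<^sup>2)"
  proof (rule Bochner_Integration.integrable_bound)
    show "integrable lebesgue (\<lambda>x. C\<^sup>2 * (cmod (f x))\<^sup>2)"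
      using Lp_2_D(2)[OF assms(1)] by simp
    show "AE x in lebesgue. norm ((cmod (g x))\<^sup>2) \<le> norm (C\<^sup>2 * (cmod (f x))\<^sup>2)"
      using assms(3)
    proof eventually_elim
      case (elim x)
      have "(cmod (g x))\<^sup>2 \<le> (C * cmod (f x))\<^sup>2"
        using elim by (intro power_mono) auto
      then show ?case by (simp add: power_mult_distrib)
    qed
  qed (use assms(2) in measurable)
  then show ?thesis using assms(2) by (simp add: Lp_2_iff)
qed

lemma Lp_2_add:
  assumes "f \<in> Lp 2" "g \<in> Lp 2"
  shows "(\<lambda>x. f x + g x) \<in> Lp 2"
proof -
  note [measurable] = Lp_2_D(1)[OF assms(1)] Lp_2_D(1)[OF assms(2)]
  have "integrable lebesgue (\<lambda>x. (cmod (f x + g x))\<^sup>2)"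
  proof (rule Bochner_Integration.integrable_bound)
    show "integrable lebesgue (\<lambda>x. 2 * (cmod (f x))\<^sup>2 + 2 * (cmod (g x))\<^sup>2)"
      using Lp_2_D(2)[OF assms(1)] Lp_2_D(2)[OF assms(2)] by simp
    have "(cmod (a + b))\<^sup>2 \<le> 2 * (cmod a)\<^sup>2 + 2 * (cmod b)\<^sup>2" for a b
    proof -
      have "(cmod (a + b))\<^sup>2 \<le> (cmod a + cmod b)\<^sup>2"
        by (intro power_mono norm_triangle_ineq) auto
      also have "\<dots> \<le> 2 * (cmod a)\<^sup>2 + 2 * (cmod b)\<^sup>2"
        using sum_squares_bound[of "cmod a" "cmod b"] by (simp add: power2_sum)
      finally show ?thesis .
    qed
    then show "AE x in lebesgue. norm ((cmod (f x + g x))\<^sup>2) \<le> norm (2 * (cmod (f x))\<^sup>2 + 2 * (cmod (g x))\<^sup>2)"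
      by simp
  qed measurable
  then show ?thesis by (simp add: Lp_2_iff)
qed

lemma Lp_2_mult_const: "f \<in> Lp 2 \<Longrightarrow> (\<lambda>x. c * f x) \<in> Lp 2"
  by (rule Lp_2_bound[of f _ "cmod c"])
     (auto simp: norm_mult dest: Lp_2_D(1))

lemma Lp_2_scaleR: "f \<in> Lp 2 \<Longrightarrow> (\<lambda>x. c *\<^sub>R f x) \<in> Lp 2"
  by (rule Lp_2_bound[of f _ "\<bar>c\<bar>"]) (auto dest: Lp_2_D(1))

lemma Lp_2_zero: "(\<lambda>x. 0) \<in> Lp 2"
  by (simp add: Lp_2_iff)

lemma Lp_2_uminus: "f \<in> Lp 2 \<Longrightarrow> (\<lambda>x. - f x) \<in> Lp 2"
  using Lp_2_scaleR[of f "-1"] by simp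

lemma Lp_2_diff: "f \<in> Lp 2 \<Longrightarrow> g \<in> Lp 2 \<Longrightarrow> (\<lambda>x. f x - g x) \<in> Lp 2"
  using Lp_2_add[of f "\<lambda>x. - g x"] Lp_2_uminus[of g] by simp

lemma Lp_2_cnj: "f \<in> Lp 2 \<Longrightarrow> (\<lambda>x. cnj (f x)) \<in> Lp 2"
  using measurable_compose[OF _ borel_measurable_continuous_onI[OF continuous_on_cnj[OF continuous_on_id]]]
  by (auto simp: Lp_2_iff)

lemma Lp_2_sum: "(\<And>i. i \<in> I \<Longrightarrow> f i \<in> Lp 2) \<Longrightarrow> (\<lambda>x. \<Sum>i\<in>I. f i x) \<in> Lp 2"
  by (induction I rule: infinite_finite_induct) (auto simp: Lp_2_zero intro: Lp_2_add)

lemma Lp_2_mult_bounded: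
  assumes "f \<in> Lp 2" "k \<in> borel_measurable lebesgue" "\<And>x. cmod (k x) \<le> C"
  shows "(\<lambda>x. k x * f x) \<in> Lp 2"
proof (rule Lp_2_bound[OF assms(1)])
  show "(\<lambda>x. k x * f x) \<in> borel_measurable lebesgue"
    using Lp_2_D(1)[OF assms(1)] assms(2) by (rule borel_measurable_times[rotated])
  show "AE x in lebesgue. cmod (k x * f x) \<le> C * cmod (f x)"
    by (intro AE_I2) (simp add: norm_mult mult_right_mono assms(3))
qed

text \<open>Completeness of Lebesgue measure. The detour through \<open>measurable_on\<close> makes
  it usable, because \<open>measurable_on_spike\<close> permits changes on a negligible set.\<close>

lemma borel_measurable_lebesgue_cong_AE:
  fixes f g :: "'a::euclidean_space \<Rightarrow> 'b::euclidean_space"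
  assumes "f \<in> borel_measurable lebesgue" "AE x in lebesgue. f x = g x"
  shows "g \<in> borel_measurable lebesgue"
proof -
  obtain N where N: "N \<in> null_sets lebesgue" "{x. f x \<noteq> g x} \<subseteq> N"
    using assms(2) unfolding eventually_ae_filter by auto
  have "f measurable_on UNIV"
    using assms(1) by (rule lebesgue_measurable_imp_measurable_on) simp
  moreover have "negligible N" using N(1) by (simp add: negligible_iff_null_sets)
  moreover have "g x = f x" if "x \<in> UNIV - N" for x
  proof (rule ccontr)
    assume "g x \<noteq> f x"
    then have "x \<in> {x. f x \<noteq> g x}" by simp
    then have "x \<in> N" using N(2) by blast
    then show False using that by blast
  qed
  ultimately have "g measurable_on UNIV"
    by (rule measurable_on_spike)
  then show ?thesis by (simp add: measurable_on_iff_borel_measurable)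
qed

lemma Lp_2_cong_AE:
  assumes "f \<in> Lp 2" "AE x in lebesgue. f x = g x"
  shows "g \<in> Lp 2"
proof (rule Lp_2_bound[OF assms(1)])
  show "g \<in> borel_measurable lebesgue"
    using Lp_2_D(1)[OF assms(1)] assms(2)
    by (rule borel_measurable_lebesgue_cong_AE)
  show "AE x in lebesgue. cmod (g x) \<le> 1 * cmod (f x)"
    using assms(2) by eventually_elim simp
qed

text \<open>Only integrability is wanted, so the crude bound |f g| \<le> |f|^2 + |g|^2 replaces
  Cauchy-Schwarz.\<close>

lemma Lp_2_mult_integrable:
  assumes "f \<in> Lp 2" "g \<in> Lp 2"
  shows "integrable lebesgue (\<lambda>x. f x * g x)"
proof (rule Bochner_Integration.integrable_bound)
  note [measurable] = Lp_2_D(1)[OF assms(1)] Lp_2_D(1)[OF assms(2)]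
  show "integrable lebesgue (\<lambda>x. (cmod (f x))\<^sup>2 + (cmod (g x))\<^sup>2)"
    using Lp_2_D(2)[OF assms(1)] Lp_2_D(2)[OF assms(2)] by simp
  show "AE x in lebesgue. norm (f x * g x) \<le> norm ((cmod (f x))\<^sup>2 + (cmod (g x))\<^sup>2)"
  proof (rule AE_I2)
    fix x
    have "0 \<le> cmod (f x) * cmod (g x)" by simp
    then have "cmod (f x) * cmod (g x) \<le> (cmod (f x))\<^sup>2 + (cmod (g x))\<^sup>2"
      using sum_squares_bound[of "cmod (f x)" "cmod (g x)"] by linarith
    then show "norm (f x * g x) \<le> norm ((cmod (f x))\<^sup>2 + (cmod (g x))\<^sup>2)"
      by (simp add: norm_mult)
  qed
  show "(\<lambda>x. f x * g x) \<in> borel_measurable lebesgue" by measurable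
qed

lemma nn_integral_Lp_2:
  assumes "f \<in> Lp 2"
  shows "(\<integral>\<^sup>+x. ennreal ((cmod (f x))\<^sup>2) \<partial>lebesgue) = ennreal (\<integral>x. (cmod (f x))\<^sup>2 \<partial>lebesgue)"
  by (rule nn_integral_eq_integral) (use Lp_2_D(2)[OF assms] in auto)

lemma Lp_2_I_nn:
  assumes "f \<in> borel_measurable lebesgue" "(\<integral>\<^sup>+x. ennreal ((cmod (f x))\<^sup>2) \<partial>lebesgue) < \<infinity>"
  shows "f \<in> Lp 2"
  using assms by (auto simp: Lp_2_iff intro!: integrableI_bounded)

\<comment> \<open>The relation is partial: it is reflexive exactly on \<open>Lp 2\<close>. Outside
  \<open>Lp 2\<close> the value of \<open>abs_l2\<close> carries no information, whence the
  membership conditions on nearly every lemma about it.\<close>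
quotient_type 'n l2 =
    "real ^ 'n \<Rightarrow> complex" / partial: "\<lambda>f g. f \<in> Lp 2 \<and> g \<in> Lp 2 \<and> (AE x in lebesgue. f x = g x)"
proof (rule part_equivpI)
  show "\<exists>f::real ^ 'n \<Rightarrow> complex. f \<in> Lp 2 \<and> f \<in> Lp 2 \<and> (AE x in lebesgue. f x = f x)"
    using Lp_2_zero by blast
  show "symp (\<lambda>f g::real ^ 'n \<Rightarrow> complex. f \<in> Lp 2 \<and> g \<in> Lp 2 \<and> (AE x in lebesgue. f x = g x))"
    by (rule sympI) (auto elim: AE_mp)
  show "transp (\<lambda>f g::real ^ 'n \<Rightarrow> complex. f \<in> Lp 2 \<and> g \<in> Lp 2 \<and> (AE x in lebesgue. f x = g x))"
    by (rule transpI) (auto elim: AE_mp)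
qed

lemma rep_l2_Lp [simp, intro]: "rep_l2 a \<in> Lp 2"
  using Quotient3_rel_rep[OF Quotient3_l2, of a a] by auto

lemma abs_rep_l2 [simp]: "abs_l2 (rep_l2 a) = a"
  by (rule Quotient3_abs_rep[OF Quotient3_l2])

lemma abs_l2_eq_iff:
  assumes "f \<in> Lp 2" "g \<in> Lp 2"
  shows "abs_l2 f = abs_l2 g \<longleftrightarrow> (AE x in lebesgue. f x = g x)"
  using Quotient3_rel[OF Quotient3_l2, of f g] assms by auto

lemma rep_abs_l2:
  assumes "f \<in> Lp 2"
  shows "AE x in lebesgue. rep_l2 (abs_l2 f) x = f x"
  using abs_l2_eq_iff[of "rep_l2 (abs_l2 f)" f] assms by simp

lemma abs_l2_eqI:
  assumes "f \<in> Lp 2" "AE x in lebesgue. f x = g x"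
  shows "abs_l2 f = abs_l2 g"
  using abs_l2_eq_iff[OF assms(1) Lp_2_cong_AE[OF assms]] assms(2) by simp

instantiation l2 :: (finite) real_inner
begin

lift_definition zero_l2 :: "'a l2" is "\<lambda>x. 0"
  by (simp add: Lp_2_zero)

lift_definition plus_l2 :: "'a l2 \<Rightarrow> 'a l2 \<Rightarrow> 'a l2" is "\<lambda>f g x. f x + g x"
  by (auto intro: Lp_2_add elim: AE_mp)

lift_definition minus_l2 :: "'a l2 \<Rightarrow> 'a l2 \<Rightarrow> 'a l2" is "\<lambda>f g x. f x - g x"
  by (auto intro: Lp_2_diff elim: AE_mp)

lift_definition uminus_l2 :: "'a l2 \<Rightarrow> 'a l2" is "\<lambda>f x. - f x"
  by (auto intro: Lp_2_uminus elim: AE_mp)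

lift_definition scaleR_l2 :: "real \<Rightarrow> 'a l2 \<Rightarrow> 'a l2" is "\<lambda>c f x. c *\<^sub>R f x"
  by (auto intro: Lp_2_scaleR elim: AE_mp)

lift_definition inner_l2 :: "'a l2 \<Rightarrow> 'a l2 \<Rightarrow> real" is
  "\<lambda>f g. Re (\<integral>x. f x * cnj (g x) \<partial>lebesgue)"
proof -
  fix f f' g g' :: "real ^ 'a \<Rightarrow> complex"
  assume *: "f \<in> Lp 2 \<and> f' \<in> Lp 2 \<and> (AE x in lebesgue. f x = f' x)"
    "g \<in> Lp 2 \<and> g' \<in> Lp 2 \<and> (AE x in lebesgue. g x = g' x)"
  then have "AE x in lebesgue. f x * cnj (g x) = f' x * cnj (g' x)" by auto
  moreover have "f \<in> borel_measurable lebesgue" "f' \<in> borel_measurable lebesgue"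
    "(\<lambda>x. cnj (g x)) \<in> borel_measurable lebesgue" "(\<lambda>x. cnj (g' x)) \<in> borel_measurable lebesgue"
    using * by (auto intro: Lp_2_D(1) Lp_2_cnj)
  ultimately have "(\<integral>x. f x * cnj (g x) \<partial>lebesgue) = (\<integral>x. f' x * cnj (g' x) \<partial>lebesgue)"
    by (intro integral_cong_AE borel_measurable_times)
  then show "Re (\<integral>x. f x * cnj (g x) \<partial>lebesgue) = Re (\<integral>x. f' x * cnj (g' x) \<partial>lebesgue)" by simp
qed

definition norm_l2 :: "'a l2 \<Rightarrow> real" where "norm_l2 a = sqrt (a \<bullet> a)"
definition dist_l2 :: "'a l2 \<Rightarrow> 'a l2 \<Rightarrow> real" where "dist_l2 a b = norm (a - b)"
definition sgn_l2 :: "'a l2 \<Rightarrow> 'a l2" where "sgn_l2 a = inverse (norm a) *\<^sub>R a"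
definition uniformity_l2 :: "('a l2 \<times> 'a l2) filter" where
  "uniformity_l2 = (INF e\<in>{0<..}. principal {(x, y). dist x y < e})"
definition open_l2 :: "'a l2 set \<Rightarrow> bool" where
  "open_l2 U = (\<forall>x\<in>U. eventually (\<lambda>(x', y). x' = x \<longrightarrow> y \<in> U) uniformity)"

instance
proof
  fix a b c :: "'a l2" and r s :: real
  show "dist a b = norm (a - b)" by (rule dist_l2_def)
  show "sgn a = inverse (norm a) *\<^sub>R a" by (rule sgn_l2_def)
  show "(uniformity :: ('a l2 \<times> 'a l2) filter) = (INF e\<in>{0<..}. principal {(x, y). dist x y < e})"
    by (rule uniformity_l2_def)
  show "open U = (\<forall>x\<in>U. eventually (\<lambda>(x', y). x' = x \<longrightarrow> y \<in> U) uniformity)" for U :: "'a l2 set"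
    by (rule open_l2_def)
  show "norm a = sqrt (a \<bullet> a)" by (rule norm_l2_def)
  show "a + b + c = a + (b + c)" by transfer (auto simp: add_ac intro!: Lp_2_add)
  show "a + b = b + a" by transfer (auto simp: add_ac intro!: Lp_2_add)
  show "0 + a = a" by transfer auto
  show "- a + a = 0" by transfer (auto simp: Lp_2_zero)
  show "a - b = a + - b" by transfer (auto intro!: Lp_2_diff)
  show "r *\<^sub>R (a + b) = r *\<^sub>R a + r *\<^sub>R b"
    by transfer (auto simp: scaleR_add_right intro!: Lp_2_add Lp_2_scaleR)
  show "(r + s) *\<^sub>R a = r *\<^sub>R a + s *\<^sub>R a"
    by transfer (auto simp: scaleR_add_left intro!: Lp_2_add Lp_2_scaleR)
  show "r *\<^sub>R s *\<^sub>R a = (r * s) *\<^sub>R a" by transfer (auto intro!: Lp_2_scaleR)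
  show "1 *\<^sub>R a = a" by transfer auto
  show "a \<bullet> b = b \<bullet> a"
  proof transfer
    fix f g :: "real ^ 'a \<Rightarrow> complex"
    have "(\<integral>x. f x * cnj (g x) \<partial>lebesgue) = (\<integral>x. cnj (g x * cnj (f x)) \<partial>lebesgue)"
      by (simp add: mult.commute)
    also have "\<dots> = cnj (\<integral>x. g x * cnj (f x) \<partial>lebesgue)"
      by (rule Bochner_Integration.integral_cnj)
    finally show "Re (\<integral>x. f x * cnj (g x) \<partial>lebesgue) = Re (\<integral>x. g x * cnj (f x) \<partial>lebesgue)" by simp
  qed
  show "(a + b) \<bullet> c = a \<bullet> c + b \<bullet> c"
    by transfer (simp add: distrib_right Lp_2_mult_integrable Lp_2_cnj)
  show "(r *\<^sub>R a) \<bullet> b = r * (a \<bullet> b)"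
    by transfer (simp add: Lp_2_mult_integrable Lp_2_cnj)
  have sq: "Re (\<integral>x. f x * cnj (f x) \<partial>lebesgue) = (\<integral>x. (cmod (f x))\<^sup>2 \<partial>lebesgue)"
    for f :: "real ^ 'a \<Rightarrow> complex"
    by (simp add: complex_norm_square[symmetric] del: of_real_power)
  show "0 \<le> a \<bullet> a" by transfer (simp add: sq)
  show "a \<bullet> a = 0 \<longleftrightarrow> a = 0"
  proof transfer
    fix f :: "real ^ 'a \<Rightarrow> complex"
    assume "f \<in> Lp 2 \<and> f \<in> Lp 2 \<and> (AE x in lebesgue. f x = f x)"
    then show "(Re (\<integral>x. f x * cnj (f x) \<partial>lebesgue) = 0) \<longleftrightarrow>
      (f \<in> Lp 2 \<and> (\<lambda>x. 0) \<in> Lp 2 \<and> (AE x in lebesgue. f x = 0))"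
      unfolding sq
      by (subst integral_nonneg_eq_0_iff_AE) (auto simp: Lp_2_zero dest: Lp_2_D)
  qed
qed

end

section \<open>Operations and norms of classes in terms of representatives\<close>

lemma abs_l2_add:
  assumes "f \<in> Lp 2" "g \<in> Lp 2"
  shows "abs_l2 f + abs_l2 g = abs_l2 (\<lambda>x. f x + g x)"
  using assms by (intro plus_l2.abs_eq) auto

lemma abs_l2_diff:
  assumes "f \<in> Lp 2" "g \<in> Lp 2"
  shows "abs_l2 f - abs_l2 g = abs_l2 (\<lambda>x. f x - g x)"
  using assms by (intro minus_l2.abs_eq) auto

lemma abs_l2_scaleR:
  assumes "f \<in> Lp 2"
  shows "c *\<^sub>R abs_l2 f = abs_l2 (\<lambda>x. c *\<^sub>R f x)"
  using assms by (intro scaleR_l2.abs_eq) auto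

lemma abs_l2_zero: "abs_l2 (\<lambda>x. 0) = 0"
  by (simp add: zero_l2.abs_eq)

lemma abs_l2_sum:
  assumes "\<And>i. i \<in> I \<Longrightarrow> f i \<in> Lp 2"
  shows "(\<Sum>i\<in>I. abs_l2 (f i)) = abs_l2 (\<lambda>x. \<Sum>i\<in>I. f i x)"
  using assms
  by (induction I rule: infinite_finite_induct) (auto simp: abs_l2_zero abs_l2_add Lp_2_sum)

lemma abs_l2_inner:
  assumes "f \<in> Lp 2" "g \<in> Lp 2"
  shows "abs_l2 f \<bullet> abs_l2 g = Re (\<integral>x. f x * cnj (g x) \<partial>lebesgue)"
  using assms by (intro inner_l2.abs_eq) auto

lemma norm_abs_l2_power2:
  assumes "f \<in> Lp 2"
  shows "(norm (abs_l2 f))\<^sup>2 = (\<integral>x. (cmod (f x))\<^sup>2 \<partial>lebesgue)"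
proof -
  have "(norm (abs_l2 f))\<^sup>2 = Re (\<integral>x. f x * cnj (f x) \<partial>lebesgue)"
    by (simp add: power2_norm_eq_inner abs_l2_inner assms)
  then show ?thesis by (simp add: complex_norm_square[symmetric] del: of_real_power)
qed

lemma norm_abs_l2:
  assumes "f \<in> Lp 2"
  shows "norm (abs_l2 f) = Lp_norm 2 f"
proof -
  have "0 \<le> (\<integral>x. (cmod (f x))\<^sup>2 \<partial>lebesgue)" by (rule integral_nonneg_AE) simp
  then have "Lp_norm 2 f = sqrt (\<integral>x. (cmod (f x))\<^sup>2 \<partial>lebesgue)"
    by (simp add: Lp_norm_def powr_half_sqrt)
  then show ?thesis
    by (simp add: norm_abs_l2_power2[OF assms, symmetric])
qed

lemma nn_integral_abs_l2:
  assumes "f \<in> Lp 2"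
  shows "(\<integral>\<^sup>+x. ennreal ((cmod (f x))\<^sup>2) \<partial>lebesgue) = ennreal ((norm (abs_l2 f))\<^sup>2)"
  by (simp add: nn_integral_Lp_2 norm_abs_l2_power2 assms)

lemma nn_integral_dist_l2:
  assumes "f \<in> Lp 2" "g \<in> Lp 2"
  shows "(\<integral>\<^sup>+x. ennreal ((cmod (f x - g x))\<^sup>2) \<partial>lebesgue) = ennreal ((dist (abs_l2 f) (abs_l2 g))\<^sup>2)"
  by (simp add: nn_integral_abs_l2 Lp_2_diff assms dist_norm abs_l2_diff)

lemma norm_abs_l2_le:
  assumes "f \<in> Lp 2" "g \<in> borel_measurable lebesgue" "0 \<le> C"
    and "AE x in lebesgue. cmod (g x) \<le> C * cmod (f x)"
  shows "norm (abs_l2 g) \<le> C * norm (abs_l2 f)"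
proof -
  have g: "g \<in> Lp 2" using assms(1,2,4) by (rule Lp_2_bound)
  have "(norm (abs_l2 g))\<^sup>2 \<le> (\<integral>x. C\<^sup>2 * (cmod (f x))\<^sup>2 \<partial>lebesgue)"
    unfolding norm_abs_l2_power2[OF g]
  proof (rule integral_mono_AE)
    show "AE x in lebesgue. (cmod (g x))\<^sup>2 \<le> C\<^sup>2 * (cmod (f x))\<^sup>2"
      using assms(4)
    proof eventually_elim
      case (elim x)
      then show ?case using power_mono[of "cmod (g x)" "C * cmod (f x)" 2]
        by (simp add: power_mult_distrib)
    qed
  qed (use Lp_2_D(2)[OF g] Lp_2_D(2)[OF assms(1)] in auto)
  also have "\<dots> = (C * norm (abs_l2 f))\<^sup>2"
    by (simp add: norm_abs_l2_power2[OF assms(1)] power_mult_distrib)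
  finally show ?thesis
    by (rule power2_le_imp_le) (simp add: assms(3))
qed

text \<open>A sequence with \<open>\<parallel>f (k+1) - f k\<parallel>\<^sup>2 \<le> 4\<^sup>-\<^sup>k\<close> converges almost everywhere: the sum of
  \<open>2\<^sup>k |f (k+1) - f k|\<^sup>2\<close> is integrable, hence finite almost everywhere. Fatou's lemma then
  turns this into convergence in \<open>L\<^sup>2\<close>.\<close>

lemma l2_rapidly_Cauchy_convergent:
  fixes X :: "nat \<Rightarrow> 'n::finite l2"
  assumes fast: "\<And>k j. k \<le> j \<Longrightarrow> dist (X j) (X k) \<le> (1/2) ^ k"
  shows "convergent X"
proof -
  define f where "f k = rep_l2 (X k)" for k
  have f: "f k \<in> Lp 2" for k by (simp add: f_def)
  have X: "X k = abs_l2 (f k)" for k by (simp add: f_def)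
  have f_meas [measurable]: "f k \<in> borel_measurable lebesgue" for k
    using f by (rule Lp_2_D(1))
  have nnd: "(\<integral>\<^sup>+x. ennreal ((cmod (f j x - f k x))\<^sup>2) \<partial>lebesgue) \<le> ennreal ((1/4) ^ k)" if "k \<le> j" for j k
  proof -
    have "(dist (X j) (X k))\<^sup>2 \<le> ((1/2) ^ k)\<^sup>2"
      using fast[OF that] by (intro power_mono) auto
    also have "\<dots> = (1/4::real) ^ k"
      by (simp add: power2_eq_square flip: power_mult_distrib)
    finally show ?thesis
      using nn_integral_dist_l2[OF f f, of j k] by (simp add: X ennreal_leI)
  qed
  define S where "S x = (\<Sum>k. ennreal (2 ^ k * (cmod (f (Suc k) x - f k x))\<^sup>2))" for x
  have "(\<integral>\<^sup>+x. S x \<partial>lebesgue) = (\<Sum>k. \<integral>\<^sup>+x. ennreal (2 ^ k * (cmod (f (Suc k) x - f k x))\<^sup>2) \<partial>lebesgue)"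
    unfolding S_def by (rule nn_integral_suminf) measurable
  also have "\<dots> \<le> (\<Sum>k. ennreal ((1/2) ^ k))"
  proof (rule suminf_le)
    fix k
    have "(\<integral>\<^sup>+x. ennreal (2 ^ k * (cmod (f (Suc k) x - f k x))\<^sup>2) \<partial>lebesgue)
        = ennreal (2 ^ k) * (\<integral>\<^sup>+x. ennreal ((cmod (f (Suc k) x - f k x))\<^sup>2) \<partial>lebesgue)"
      by (subst nn_integral_cmult[symmetric]) (auto simp: ennreal_mult intro!: nn_integral_cong)
    also have "\<dots> \<le> ennreal (2 ^ k) * ennreal ((1/4) ^ k)"
      by (intro mult_left_mono nnd) auto
    also have "\<dots> = ennreal ((1/2) ^ k)"
      by (simp add: ennreal_mult[symmetric] power_mult_distrib[symmetric])
    finally show "(\<integral>\<^sup>+x. ennreal (2 ^ k * (cmod (f (Suc k) x - f k x))\<^sup>2) \<partial>lebesgue) \<le> ennreal ((1/2) ^ k)" .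
  qed auto
  also have "\<dots> = ennreal (\<Sum>k. (1/2) ^ k)"
    by (rule suminf_ennreal2) (auto intro: summable_geometric)
  also have "\<dots> < \<infinity>" by simp
  finally have "(\<integral>\<^sup>+x. S x \<partial>lebesgue) \<noteq> \<infinity>" by simp
  moreover have "S \<in> borel_measurable lebesgue" unfolding S_def by measurable
  ultimately have "AE x in lebesgue. S x \<noteq> \<infinity>"
    by (intro nn_integral_PInf_AE)
  then have AE_conv: "AE x in lebesgue. convergent (\<lambda>k. f k x)"
  proof eventually_elim
    case (elim x)
    define a where "a k = cmod (f (Suc k) x - f k x)" for k
    obtain C where C: "C \<ge> 0" "S x = ennreal C"
      using elim by (cases "S x") auto
    \<comment> \<open>A finite weighted sum of squares forces geometric decay of \<open>a k\<close>
      with ratio \<open>sqrt (1/2)\<close>, so the telescoping series converges absolutely.\<close>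
    have a_le: "a k \<le> sqrt C * sqrt (1/2) ^ k" for k
    proof -
      have "ennreal (2 ^ k * (a k)\<^sup>2) \<le> (\<Sum>i\<in>{k}. ennreal (2 ^ i * (a i)\<^sup>2))" by simp
      also have "\<dots> \<le> S x"
        unfolding S_def a_def by (rule sum_le_suminf) auto
      finally have "2 ^ k * (a k)\<^sup>2 \<le> C" using C by simp
      then have "(a k)\<^sup>2 \<le> C * (1/2) ^ k" by (simp add: field_simps power_one_over)
      then have "a k \<le> sqrt (C * (1/2) ^ k)" by (rule real_le_rsqrt)
      then show ?thesis by (simp add: real_sqrt_mult real_sqrt_power)
    qed
    have "summable (\<lambda>k. sqrt C * sqrt (1/2) ^ k)"
      by (intro summable_mult summable_geometric) simp
    then have "summable a"
      by (rule summable_comparison_test'[where N=0]) (use a_le in \<open>auto simp: a_def\<close>)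
    then have "summable (\<lambda>k. f (Suc k) x - f k x)"
      unfolding a_def by (rule summable_norm_cancel)
    then have "convergent (\<lambda>n. \<Sum>k<n. f (Suc k) x - f k x)"
      by (simp add: summable_iff_convergent)
    then have "convergent (\<lambda>n. f n x - f 0 x)"
      by (simp only: sum_lessThan_telescope[of "\<lambda>n. f n x"])
    then have "convergent (\<lambda>n. (f n x - f 0 x) + f 0 x)"
      by (intro convergent_add convergent_const)
    then show ?case by simp
  qed
  \<comment> \<open>The value 0 on the null set of divergence is arbitrary. Measurability is read
    off \<open>lim\<close>, which agrees with \<open>g\<close> almost everywhere.\<close>
  define g where "g x = (if convergent (\<lambda>k. f k x) then lim (\<lambda>k. f k x) else 0)" for x
  have g_lim: "AE x in lebesgue. (\<lambda>k. f k x) \<longlonglongrightarrow> g x"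
    using AE_conv by eventually_elim (simp add: g_def convergent_LIMSEQ_iff)
  have g_meas: "g \<in> borel_measurable lebesgue"
  proof (rule borel_measurable_lebesgue_cong_AE)
    show "(\<lambda>x. lim (\<lambda>k. f k x)) \<in> borel_measurable lebesgue"
      by (rule borel_measurable_lim_metric) measurable
    show "AE x in lebesgue. lim (\<lambda>k. f k x) = g x"
      using AE_conv by eventually_elim (simp add: g_def)
  qed
  have fatou: "(\<integral>\<^sup>+x. ennreal ((cmod (g x - f k x))\<^sup>2) \<partial>lebesgue) \<le> ennreal ((1/4) ^ k)" for k
  proof -
    have "(\<integral>\<^sup>+x. ennreal ((cmod (g x - f k x))\<^sup>2) \<partial>lebesgue)
        = (\<integral>\<^sup>+x. liminf (\<lambda>j. ennreal ((cmod (f j x - f k x))\<^sup>2)) \<partial>lebesgue)"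
    proof (rule nn_integral_cong_AE)
      show "AE x in lebesgue. ennreal ((cmod (g x - f k x))\<^sup>2)
          = liminf (\<lambda>j. ennreal ((cmod (f j x - f k x))\<^sup>2))"
        using g_lim
      proof eventually_elim
        case (elim x)
        then have "(\<lambda>j. ennreal ((cmod (f j x - f k x))\<^sup>2)) \<longlonglongrightarrow> ennreal ((cmod (g x - f k x))\<^sup>2)"
          by (intro tendsto_intros)
        then show ?case by (intro lim_imp_Liminf[symmetric]) auto
      qed
    qed
    also have "\<dots> \<le> liminf (\<lambda>j. \<integral>\<^sup>+x. ennreal ((cmod (f j x - f k x))\<^sup>2) \<partial>lebesgue)"
      by (rule nn_integral_liminf) measurable
    also have "\<dots> \<le> ennreal ((1/4) ^ k)"
    proof (rule Liminf_le)
      show "\<forall>\<^sub>F j in sequentially. (\<integral>\<^sup>+x. ennreal ((cmod (f j x - f k x))\<^sup>2) \<partial>lebesgue) \<le> ennreal ((1/4) ^ k)"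
        using nnd by (auto simp: eventually_sequentially)
    qed simp
    finally show ?thesis .
  qed
  \<comment> \<open>The Fatou bound for \<open>k = 0\<close> is what places the limit in
    \<open>L^2\<close>.\<close>
  have "(\<lambda>x. g x - f 0 x) \<in> Lp 2"
    using fatou[of 0] g_meas by (intro Lp_2_I_nn) (auto simp: le_less_trans)
  from Lp_2_add[OF this f[of 0]] have g: "g \<in> Lp 2" by simp
  have "dist (X k) (abs_l2 g) \<le> (1/2) ^ k" for k
  proof -
    have "ennreal ((dist (abs_l2 g) (X k))\<^sup>2) \<le> ennreal ((1/4) ^ k)"
      using fatou[of k] nn_integral_dist_l2[OF g f, of k] by (simp add: X)
    then have "(dist (abs_l2 g) (X k))\<^sup>2 \<le> (1/4) ^ k" by simp
    also have "(1/4::real) ^ k = ((1/2) ^ k)\<^sup>2"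
      by (simp add: power2_eq_square flip: power_mult_distrib)
    finally show ?thesis
      by (subst dist_commute, rule power2_le_imp_le) simp
  qed
  then have le: "norm (dist (X k) (abs_l2 g)) \<le> (1/2) ^ k" for k by simp
  have "(\<lambda>k. dist (X k) (abs_l2 g)) \<longlonglongrightarrow> 0"
  proof (rule Lim_null_comparison)
    show "\<forall>\<^sub>F k in sequentially. norm (dist (X k) (abs_l2 g)) \<le> (1/2) ^ k"
      by (rule always_eventually) (rule allI, rule le)
    show "(\<lambda>k. (1/2::real) ^ k) \<longlonglongrightarrow> 0" by (rule LIMSEQ_power_zero) simp
  qed
  then have "X \<longlonglongrightarrow> abs_l2 g" by (rule tendsto_dist_iff[THEN iffD2])
  then show ?thesis by (rule convergentI)
qed

instance l2 :: (finite) banach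
proof
  fix X :: "nat \<Rightarrow> 'a l2"
  assume X: "Cauchy X"
  then have "\<forall>k. \<exists>N. \<forall>m\<ge>N. \<forall>n\<ge>N. dist (X m) (X n) < (1/2) ^ k"
    by (simp add: Cauchy_def)
  then obtain N where N: "\<And>k m n. N k \<le> m \<Longrightarrow> N k \<le> n \<Longrightarrow> dist (X m) (X n) < (1/2) ^ k"
    by metis
  \<comment> \<open>Taking the maximum with the next threshold keeps \<open>r k\<close> beyond
    \<open>N k\<close>; the \<open>Suc\<close> makes \<open>r\<close> strictly increasing.\<close>
  define r where "r = rec_nat (N 0) (\<lambda>k n. Suc (max n (N (Suc k))))"
  have r: "r 0 = N 0" "r (Suc k) = Suc (max (r k) (N (Suc k)))" for k by (simp_all add: r_def)
  have mono: "strict_mono r" by (rule strict_mono_Suc_iff[THEN iffD2]) (auto simp: r intro: le_imp_less_Suc)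
  have rN: "N k \<le> r k" for k by (cases k) (auto simp: r)
  have "convergent (X \<circ> r)"
  proof (rule l2_rapidly_Cauchy_convergent)
    fix k j :: nat
    assume "k \<le> j"
    then have "N k \<le> r j" using rN[of k] mono strict_mono_less_eq[of r k j] by linarith
    then show "dist ((X \<circ> r) j) ((X \<circ> r) k) \<le> (1/2) ^ k"
      using N[of k "r j" "r k"] rN[of k] by simp
  qed
  then obtain l where "(X \<circ> r) \<longlonglongrightarrow> l" by (auto simp: convergent_def)
  with X mono have "X \<longlonglongrightarrow> l" by (rule Cauchy_converges_subseq)
  then show "convergent X" by (rule convergentI)
qed

section \<open>Plancherel's identity\<close>

lemma measurable_lebesgue_continuous:
  fixes f :: "'a::euclidean_space \<Rightarrow> 'b::topological_space"
  assumes "continuous_on UNIV f"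
  shows "f \<in> borel_measurable lebesgue"
  using assms by (intro measurable_completion) (simp add: borel_measurable_continuous_onI)

lemma borel_measurable_cnj [measurable]:
  "f \<in> borel_measurable M \<Longrightarrow> (\<lambda>x. cnj (f x)) \<in> borel_measurable M"
  using measurable_compose[OF _ borel_measurable_continuous_onI[OF continuous_on_cnj[OF continuous_on_id]]] .

lemma integrable_char_mult:
  fixes f :: "'a::euclidean_space \<Rightarrow> complex"
  assumes "integrable lebesgue f"
  shows "integrable lebesgue (\<lambda>x. exp (- \<i> * of_real (x \<bullet> \<xi>)) * f x)"
proof (rule Bochner_Integration.integrable_bound[OF assms])
  have "(\<lambda>x::'a. exp (- \<i> * of_real (x \<bullet> \<xi>))) \<in> borel_measurable lebesgue"
    by (intro measurable_lebesgue_continuous continuous_intros)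
  then show "(\<lambda>x. exp (- \<i> * of_real (x \<bullet> \<xi>)) * f x) \<in> borel_measurable lebesgue"
    using assms by (intro borel_measurable_times) auto
qed (simp add: norm_mult)

lemma fourier_L1_cong_AE:
  assumes "AE x in lebesgue. f x = g x" "f \<in> borel_measurable lebesgue" "g \<in> borel_measurable lebesgue"
  shows "fourier_L1 f \<xi> = fourier_L1 g \<xi>"
proof -
  have "(\<lambda>x::real^'a. exp (- \<i> * of_real (x \<bullet> \<xi>))) \<in> borel_measurable lebesgue"
    by (intro measurable_lebesgue_continuous continuous_intros)
  then show ?thesis
    unfolding fourier_L1_def using assms
    by (intro integral_cong_AE borel_measurable_times) auto
qed

lemma fourier_L1_diff:
  assumes "integrable lebesgue f" "integrable lebesgue g"
  shows "fourier_L1 (\<lambda>x. f x - g x) \<xi> = fourier_L1 f \<xi> - fourier_L1 g \<xi>"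
  unfolding fourier_L1_def right_diff_distrib
  by (intro Bochner_Integration.integral_diff integrable_char_mult assms)

lemma fourier_L1_add:
  assumes "integrable lebesgue f" "integrable lebesgue g"
  shows "fourier_L1 (\<lambda>x. f x + g x) \<xi> = fourier_L1 f \<xi> + fourier_L1 g \<xi>"
  unfolding fourier_L1_def distrib_left
  by (intro Bochner_Integration.integral_add integrable_char_mult assms)

lemma fourier_L1_scaleR: "fourier_L1 (\<lambda>x. c *\<^sub>R f x) \<xi> = c *\<^sub>R fourier_L1 f \<xi>"
  unfolding fourier_L1_def by simp

lemma norm_fourier_L1_le:
  "cmod (fourier_L1 f \<xi>) \<le> (\<integral>x. cmod (f x) \<partial>lebesgue)"
proof -
  have "cmod (fourier_L1 f \<xi>) \<le> (\<integral>x. norm (exp (- \<i> * of_real (x \<bullet> \<xi>)) * f x) \<partial>lebesgue)"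
    unfolding fourier_L1_def by (rule integral_norm_bound)
  then show ?thesis by (simp add: norm_mult)
qed

lemma continuous_fourier_L1:
  assumes "integrable lebesgue f"
  shows "continuous_on UNIV (fourier_L1 f)"
proof (rule continuous_at_imp_continuous_on, rule ballI)
  fix \<xi> :: "real ^ 'a"
  show "isCont (fourier_L1 f) \<xi>"
    unfolding continuous_at_sequentially
  proof (intro allI impI)
    fix X :: "nat \<Rightarrow> real ^ 'a"
    assume X: "X \<longlonglongrightarrow> \<xi>"
    show "(fourier_L1 f \<circ> X) \<longlonglongrightarrow> fourier_L1 f \<xi>"
      unfolding fourier_L1_def o_def
    proof (rule integral_dominated_convergence[where w="\<lambda>x. cmod (f x)"])
      show "AE x in lebesgue. (\<lambda>i. exp (- \<i> * of_real (x \<bullet> X i)) * f x) \<longlonglongrightarrow> exp (- \<i> * of_real (x \<bullet> \<xi>)) * f x"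
        by (intro AE_I2 tendsto_intros X)
    qed (use integrable_char_mult[OF assms] assms in \<open>auto simp: norm_mult\<close>)
  qed
qed

lemma measurable_fourier_L1:
  assumes "integrable lebesgue f"
  shows "fourier_L1 f \<in> borel_measurable borel" "fourier_L1 f \<in> borel_measurable lebesgue"
  using continuous_fourier_L1[OF assms]
  by (auto intro: borel_measurable_continuous_onI measurable_lebesgue_continuous)

section \<open>Gaussians, dilations and the multiplication formula\<close>

lemma lborel_integral_prod:
  fixes f :: "'a::euclidean_space \<Rightarrow> real \<Rightarrow> complex"
  assumes "\<And>b. b \<in> Basis \<Longrightarrow> integrable lborel (f b)"
  shows "integrable lborel (\<lambda>x. \<Prod>b\<in>Basis. f b (x \<bullet> b))"
    and "(\<integral>x. (\<Prod>b\<in>Basis. f b (x \<bullet> b)) \<partial>lborel) = (\<Prod>b\<in>Basis. \<integral>x. f b x \<partial>lborel)"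
proof -
  interpret product_sigma_finite "\<lambda>_::'a. lborel :: real measure" ..
  have meas: "(\<lambda>x::'a. \<Prod>b\<in>Basis. f b (x \<bullet> b)) \<in> borel_measurable borel"
  proof (rule borel_measurable_prod)
    fix b :: 'a assume "b \<in> Basis"
    then have [measurable]: "f b \<in> borel_measurable borel" using assms[of b] by auto
    show "(\<lambda>x. f b (x \<bullet> b)) \<in> borel_measurable borel" by measurable
  qed
  have inner: "(\<Prod>b\<in>Basis. f b ((\<Sum>b\<in>Basis. y b *\<^sub>R b) \<bullet> b)) = (\<Prod>b\<in>Basis. f b (y b))" for y :: "'a \<Rightarrow> real"
    by (intro prod.cong refl) simp
  \<comment> \<open>\<open>lborel\<close> is the image of the product measure under this coordinate
    map, so both claims reduce to Fubini for finite products.\<close>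
  have map: "(\<lambda>y. \<Sum>b\<in>Basis. y b *\<^sub>R b :: 'a) \<in> (\<Pi>\<^sub>M b\<in>Basis. lborel) \<rightarrow>\<^sub>M borel"
    by measurable
  show "integrable lborel (\<lambda>x. \<Prod>b\<in>Basis. f b (x \<bullet> b))"
    by (subst lborel_eq, subst integrable_distr_eq[OF map meas], unfold inner)
       (intro product_integrable_prod assms finite_Basis)
  show "(\<integral>x. (\<Prod>b\<in>Basis. f b (x \<bullet> b)) \<partial>lborel) = (\<Prod>b\<in>Basis. \<integral>x. f b x \<partial>lborel)"
    by (subst lborel_eq, subst integral_distr[OF map meas], unfold inner)
       (intro product_integral_prod assms finite_Basis)
qed

text \<open>Up to the factor \<open>sqrt (2 * pi)\<close> this is the characteristic function of the
  standard normal distribution, evaluated at \<open>- t\<close> because of the sign in the exponent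
  of the transform.\<close>

lemma gauss_char_real:
  fixes t :: real
  shows "integrable lborel (\<lambda>x. exp (- \<i> * of_real (x * t)) * of_real (exp (- x\<^sup>2 / 2)))"
    and "(\<integral>x. exp (- \<i> * of_real (x * t)) * of_real (exp (- x\<^sup>2 / 2)) \<partial>lborel)
      = of_real (sqrt (2 * pi) * exp (- t\<^sup>2 / 2))"
proof -
  have dens: "exp (- x\<^sup>2 / 2) = sqrt (2 * pi) * std_normal_density x" for x :: real
    by (simp add: std_normal_density_def)
  have "integrable lborel (\<lambda>x. std_normal_density x)"
    using integrable_std_normal_moment[of 0] by simp
  then have int: "integrable lborel (\<lambda>x. exp (- x\<^sup>2 / 2) :: real)"
    unfolding dens by simp
  show "integrable lborel (\<lambda>x. exp (- \<i> * of_real (x * t)) * of_real (exp (- x\<^sup>2 / 2)))"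
    by (rule Bochner_Integration.integrable_bound[OF int]) (auto simp: norm_mult)
  have "of_real (sqrt (2 * pi)) * complex_of_real (exp (- t\<^sup>2 / 2))
      = of_real (sqrt (2 * pi)) * char std_normal_distribution (- t)"
    by (simp add: char_std_normal_distribution)
  also have "char std_normal_distribution (- t) = (\<integral>x. std_normal_density x *\<^sub>R iexp (- t * x) \<partial>lborel)"
    unfolding char_def by (subst integral_density) (auto simp: normal_density_nonneg)
  also have "of_real (sqrt (2 * pi)) * \<dots>
      = (\<integral>x. of_real (sqrt (2 * pi)) * (std_normal_density x *\<^sub>R iexp (- t * x)) \<partial>lborel)"
    by (rule integral_mult_right_zero[symmetric])
  also have "\<dots> = (\<integral>x. exp (- \<i> * of_real (x * t)) * of_real (sqrt (2 * pi) * std_normal_density x) \<partial>lborel)"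
    by (intro Bochner_Integration.integral_cong refl) (simp add: scaleR_conv_of_real mult_ac)
  also have "\<dots> = (\<integral>x. exp (- \<i> * of_real (x * t)) * of_real (exp (- x\<^sup>2 / 2)) \<partial>lborel)"
    unfolding dens ..
  finally show "(\<integral>x. exp (- \<i> * of_real (x * t)) * of_real (exp (- x\<^sup>2 / 2)) \<partial>lborel)
      = of_real (sqrt (2 * pi) * exp (- t\<^sup>2 / 2))" by simp
qed

definition gauss :: "'a::euclidean_space \<Rightarrow> real" where
  "gauss x = exp (- (norm x)\<^sup>2 / 2)"

lemma gauss_props: "0 \<le> gauss x" "gauss x \<le> 1" "gauss 0 = 1" "continuous_on UNIV gauss"
  unfolding gauss_def by (auto intro!: continuous_intros)

lemma measurable_gauss [measurable]: "gauss \<in> borel_measurable borel"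
  using gauss_props(4) by (rule borel_measurable_continuous_onI)

text \<open>Both the Gaussian and the character are products over the coordinates, which reduces the
  computation to one dimension.\<close>

lemma gauss_fourier:
  fixes \<xi> :: "'a::euclidean_space"
  shows "integrable lborel (\<lambda>x. exp (- \<i> * of_real (x \<bullet> \<xi>)) * of_real (gauss x))"
    and "(\<integral>x. exp (- \<i> * of_real (x \<bullet> \<xi>)) * of_real (gauss x) \<partial>lborel)
      = of_real (sqrt (2 * pi) ^ DIM('a) * gauss \<xi>)"
proof -
  define f where "f b t = exp (- \<i> * of_real (t * (\<xi> \<bullet> b))) * complex_of_real (exp (- t\<^sup>2 / 2))"
    for b :: 'a and t :: real
  have nsq: "(norm x)\<^sup>2 = (\<Sum>b\<in>Basis. (x \<bullet> b)\<^sup>2)" for x :: 'a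
    by (simp add: norm_eq_sqrt_inner euclidean_inner[of x x] sum_nonneg power2_eq_square)
  have eq: "exp (- \<i> * of_real (x \<bullet> \<xi>)) * complex_of_real (gauss x) = (\<Prod>b\<in>Basis. f b (x \<bullet> b))" for x
    unfolding f_def prod.distrib gauss_def nsq euclidean_inner[of x \<xi>]
    by (simp add: exp_sum[symmetric] sum_distrib_left sum_negf sum_divide_distrib flip: exp_of_real)
  have int: "integrable lborel (f b)" for b
    unfolding f_def by (rule gauss_char_real)
  show "integrable lborel (\<lambda>x. exp (- \<i> * of_real (x \<bullet> \<xi>)) * complex_of_real (gauss x))"
    unfolding eq by (rule lborel_integral_prod(1)[OF int])
  have "(\<integral>x. exp (- \<i> * of_real (x \<bullet> \<xi>)) * of_real (gauss x) \<partial>lborel)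
      = (\<Prod>b\<in>Basis. \<integral>x. f b x \<partial>lborel)"
    unfolding eq by (rule lborel_integral_prod(2)[OF int])
  also have "\<dots> = (\<Prod>b\<in>Basis. of_real (sqrt (2 * pi) * exp (- (\<xi> \<bullet> b)\<^sup>2 / 2)))"
    unfolding f_def by (intro prod.cong refl gauss_char_real(2))
  also have "\<dots> = of_real (sqrt (2 * pi) ^ DIM('a) * gauss \<xi>)"
    by (simp add: prod.distrib gauss_def nsq exp_sum[symmetric] sum_negf sum_divide_distrib
        del: real_sqrt_mult flip: of_real_prod)
  finally show "(\<integral>x. exp (- \<i> * of_real (x \<bullet> \<xi>)) * of_real (gauss x) \<partial>lborel)
      = of_real (sqrt (2 * pi) ^ DIM('a) * gauss \<xi>)" .
qed

lemma gauss_integral: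
  shows "integrable lborel (gauss :: 'a::euclidean_space \<Rightarrow> real)"
    and "(\<integral>x. gauss (x::'a) \<partial>lborel) = sqrt (2 * pi) ^ DIM('a)"
proof -
  have "integrable lborel (\<lambda>x::'a. complex_of_real (gauss x))"
    and i: "(\<integral>x. complex_of_real (gauss (x::'a)) \<partial>lborel) = of_real (sqrt (2 * pi) ^ DIM('a))"
    using gauss_fourier[of "0::'a"] by (simp_all add: gauss_props(3))
  then show "integrable lborel (gauss :: 'a \<Rightarrow> real)"
    by (simp only: complex_of_real_integrable_eq)
  have "complex_of_real (\<integral>x. gauss (x::'a) \<partial>lborel) = complex_of_real (sqrt (2 * pi) ^ DIM('a))"
    unfolding i[symmetric] by (rule integral_complex_of_real[symmetric])
  then show "(\<integral>x. gauss (x::'a) \<partial>lborel) = sqrt (2 * pi) ^ DIM('a)"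
    by (simp only: of_real_eq_iff)
qed

text \<open>Negative \<open>c\<close> is allowed: \<open>c = - 1\<close> serves for reflections,
  \<epsilon> and its inverse for dilations.\<close>

lemma lborel_affine_integral:
  fixes f :: "'a::euclidean_space \<Rightarrow> complex"
  assumes [measurable]: "f \<in> borel_measurable borel" and "c \<noteq> 0"
  shows "(\<integral>x. f x \<partial>lborel) = \<bar>c\<bar> ^ DIM('a) *\<^sub>R (\<integral>x. f (t + c *\<^sub>R x) \<partial>lborel)"
    and "integrable lborel f \<longleftrightarrow> integrable lborel (\<lambda>x. f (t + c *\<^sub>R x))"
proof -
  show "(\<integral>x. f x \<partial>lborel) = \<bar>c\<bar> ^ DIM('a) *\<^sub>R (\<integral>x. f (t + c *\<^sub>R x) \<partial>lborel)"
    by (subst lborel_affine[OF assms(2), of t], subst integral_density)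
       (auto simp: integral_distr)
  have "integrable lborel f \<longleftrightarrow> integrable lborel (\<lambda>x. \<bar>c\<bar> ^ DIM('a) *\<^sub>R f (t + c *\<^sub>R x))"
    by (subst lborel_affine[OF assms(2), of t], subst integrable_density)
       (auto simp: integrable_distr_eq)
  moreover have "integrable lborel (\<lambda>x. \<bar>c\<bar> ^ DIM('a) *\<^sub>R h x) \<longleftrightarrow> integrable lborel h" for h :: "'a \<Rightarrow> complex"
    using integrable_scaleR_right[of "\<bar>c\<bar> ^ DIM('a)" lborel h] assms(2)
      integrable_scaleR_right[of "inverse (\<bar>c\<bar> ^ DIM('a))" lborel "\<lambda>x. \<bar>c\<bar> ^ DIM('a) *\<^sub>R h x"]
    by auto
  ultimately show "integrable lborel f \<longleftrightarrow> integrable lborel (\<lambda>x. f (t + c *\<^sub>R x))"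
    by simp
qed

lemma fourier_L1_lborel:
  assumes "f \<in> borel_measurable borel"
  shows "fourier_L1 f \<xi> = (\<integral>x. exp (- \<i> * of_real (x \<bullet> \<xi>)) * f x \<partial>lborel)"
  unfolding fourier_L1_def using assms by (intro integral_completion) measurable

lemma integrable_lebesgue_lborel:
  fixes f :: "'a::euclidean_space \<Rightarrow> 'b::{banach,second_countable_topology}"
  assumes "f \<in> borel_measurable borel"
  shows "integrable lebesgue f \<longleftrightarrow> integrable lborel f"
  using assms by (intro integrable_completion) simp

text \<open>The kernel of the transform is symmetric in its two variables and has modulus 1, so
  \<open>f x * g \<xi>\<close> dominates the double integral and Fubini applies.\<close>

lemma fourier_L1_multiplication:
  assumes f: "integrable lborel f" and g: "integrable lborel g"
  shows "(\<integral>\<xi>. g \<xi> * fourier_L1 f \<xi> \<partial>lborel) = (\<integral>x. f x * fourier_L1 g x \<partial>lborel)"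
proof -
  have [measurable]: "f \<in> borel_measurable borel" "g \<in> borel_measurable borel"
    using f g by auto
  have "integrable (lborel \<Otimes>\<^sub>M lborel) (\<lambda>(x, \<xi>). f x * g \<xi>)"
  proof (rule lborel_pair.Fubini_integrable)
    show "integrable lborel (\<lambda>x. \<integral>y. norm (case (x, y) of (x, \<xi>) \<Rightarrow> f x * g \<xi>) \<partial>lborel)"
      using f by (simp add: norm_mult)
    show "AE x in lborel. integrable lborel (\<lambda>y. case (x, y) of (x, \<xi>) \<Rightarrow> f x * g \<xi>)"
      using g by simp
  qed measurable
  then have int: "integrable (lborel \<Otimes>\<^sub>M lborel) (\<lambda>(x, \<xi>). exp (- \<i> * of_real (x \<bullet> \<xi>)) * (f x * g \<xi>))"
    by (rule Bochner_Integration.integrable_bound) (auto simp: norm_mult)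
  have "(\<integral>\<xi>. g \<xi> * fourier_L1 f \<xi> \<partial>lborel)
      = (\<integral>\<xi>. \<integral>x. exp (- \<i> * of_real (x \<bullet> \<xi>)) * (f x * g \<xi>) \<partial>lborel \<partial>lborel)"
    unfolding fourier_L1_lborel[OF \<open>f \<in> borel_measurable borel\<close>]
    by (subst integral_mult_right_zero[symmetric]) (simp add: mult_ac)
  also have "\<dots> = (\<integral>x. \<integral>\<xi>. exp (- \<i> * of_real (x \<bullet> \<xi>)) * (f x * g \<xi>) \<partial>lborel \<partial>lborel)"
    by (rule lborel_pair.Fubini_integral[OF int])
  also have "\<dots> = (\<integral>x. f x * fourier_L1 g x \<partial>lborel)"
    unfolding fourier_L1_lborel[OF \<open>g \<in> borel_measurable borel\<close>]
    by (subst integral_mult_right_zero[symmetric]) (simp add: mult_ac inner_commute)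
  finally show ?thesis .
qed

section \<open>Continuous functions of compact support\<close>

definition Cc :: "('a::euclidean_space \<Rightarrow> complex) \<Rightarrow> bool" where
  "Cc f \<longleftrightarrow> continuous_on UNIV f \<and> (\<exists>R. \<forall>x. R < norm x \<longrightarrow> f x = 0)"

lemma Cc_diff:
  assumes "Cc f" "Cc g"
  shows "Cc (\<lambda>x. f x - g x)"
proof -
  obtain R S where R: "\<forall>x. R < norm x \<longrightarrow> f x = 0" and S: "\<forall>x. S < norm x \<longrightarrow> g x = 0"
    using assms unfolding Cc_def by blast
  then have "\<forall>x. max R S < norm x \<longrightarrow> f x - g x = 0" by simp
  then show ?thesis
    using assms continuous_on_diff unfolding Cc_def by blast
qed

lemma Cc_bounded:
  assumes "Cc f"
  obtains B where "0 \<le> B" "\<And>x. cmod (f x) \<le> B"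
proof -
  obtain R where R: "\<And>x. R < norm x \<Longrightarrow> f x = 0" and "continuous_on UNIV f"
    using assms unfolding Cc_def by auto
  then have "compact (f ` cball 0 R)"
    by (intro compact_continuous_image) (auto intro: continuous_on_subset)
  then have "bounded (f ` cball 0 R)" by (rule compact_imp_bounded)
  then obtain B where "\<forall>z\<in>f ` cball 0 R. cmod z \<le> B" unfolding bounded_iff ..
  then have B: "cmod (f x) \<le> B" if "x \<in> cball 0 R" for x
    using that by (rule bspec[OF _ imageI])
  show ?thesis
  proof (rule that[of "max B 0"])
    fix x show "cmod (f x) \<le> max B 0"
      using B[of x] R[of x] by (cases "norm x \<le> R") (simp_all add: max.coboundedI1)
  qed simp
qed

lemma Cc_measurable: "Cc f \<Longrightarrow> f \<in> borel_measurable borel"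
  unfolding Cc_def by (auto intro: borel_measurable_continuous_onI)

lemma Cc_integrable:
  assumes "Cc f"
  shows "integrable lborel f" "integrable lebesgue f"
proof -
  obtain R where R: "\<And>x. R < norm x \<Longrightarrow> f x = 0" and "continuous_on UNIV f"
    using assms unfolding Cc_def by auto
  then have "integrable lborel (\<lambda>x. indicator (cball 0 R) x *\<^sub>R f x)"
    by (intro borel_integrable_compact) (auto intro: continuous_on_subset)
  also have "(\<lambda>x. indicator (cball 0 R) x *\<^sub>R f x) = f"
    by (rule ext) (use R in \<open>simp add: indicator_def\<close>)
  finally show "integrable lborel f" .
  then show "integrable lebesgue f"
    by (simp add: integrable_lebesgue_lborel Cc_measurable[OF assms])
qed

lemma Cc_Lp_2:
  assumes "Cc (f :: real ^ 'n \<Rightarrow> complex)"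
  shows "f \<in> Lp 2"
proof -
  have "Cc (\<lambda>x. f x * cnj (f x))"
    using assms unfolding Cc_def by (auto intro!: continuous_intros)
  from Cc_integrable(2)[OF this]
  have "integrable lebesgue (\<lambda>x. complex_of_real ((cmod (f x))\<^sup>2))"
    by (simp add: complex_norm_square del: of_real_power)
  then show ?thesis
    using assms unfolding Lp_2_iff complex_of_real_integrable_eq Cc_def
    by (auto intro: measurable_lebesgue_continuous)
qed


text \<open>Inserting the factor \<open>gauss (\<epsilon> \<xi>)\<close> makes the double integral behind Plancherel's identity absolutely
  convergent; the Gaussian becomes an approximate identity after two uses of the multiplication formula.\<close>

lemma gauss_regularized_plancherel:
  fixes f :: "real ^ 'n \<Rightarrow> complex"
  assumes f: "integrable lborel f" and "\<epsilon> > 0"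
  shows "(\<integral>\<xi>. of_real (gauss (\<epsilon> *\<^sub>R \<xi>)) * (fourier_L1 f \<xi> * cnj (fourier_L1 f \<xi>)) \<partial>lborel)
    = of_real (sqrt (2 * pi) ^ CARD('n)) *
      (\<integral>y. cnj (f y) * (\<integral>z. f (y + \<epsilon> *\<^sub>R z) * of_real (gauss z) \<partial>lborel) \<partial>lborel)"
proof -
  have f_meas [measurable]: "f \<in> borel_measurable borel" using f by auto
  note affine = lborel_affine_integral
  have int_f: "integrable lebesgue f" using f by (simp add: integrable_lebesgue_lborel)
  note [measurable] = measurable_fourier_L1(1)[OF int_f]
  \<comment> \<open>The reflected conjugate of \<open>f\<close> has the conjugate transform. Hence
    the squared modulus of the transform is a product of two transforms, the form needed for the
    multiplication formula.\<close>
  define h where "h y = cnj (f (- y))" for y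
  have h_meas [measurable]: "h \<in> borel_measurable borel" unfolding h_def by measurable
  have h: "integrable lborel h"
  proof -
    have "integrable lborel (\<lambda>y. cnj (f y))" using f by simp
    then show ?thesis
      using affine(2)[of "\<lambda>y. cnj (f y)" "-1" 0] by (simp add: h_def[abs_def])
  qed
  have h_hat: "fourier_L1 h \<xi> = cnj (fourier_L1 f \<xi>)" for \<xi>
  proof -
    have "cnj (fourier_L1 f \<xi>) = (\<integral>y. exp (\<i> * of_real (y \<bullet> \<xi>)) * cnj (f y) \<partial>lborel)"
      unfolding fourier_L1_lborel[OF f_meas] Bochner_Integration.integral_cnj[symmetric]
      by (simp add: exp_cnj)
    also have "\<dots> = (\<integral>y. exp (- \<i> * of_real (y \<bullet> \<xi>)) * h y \<partial>lborel)"
      by (subst affine(1)[of _ "-1" 0]) (simp_all add: h_def)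
    finally show ?thesis unfolding fourier_L1_lborel[OF h_meas] by simp
  qed
  define \<phi> where "\<phi> \<xi> = complex_of_real (gauss (\<epsilon> *\<^sub>R \<xi>))" for \<xi> :: "real ^ 'n"
  have \<phi>_meas [measurable]: "\<phi> \<in> borel_measurable borel" unfolding \<phi>_def by measurable
  have \<phi>: "integrable lborel \<phi>"
  proof -
    have "integrable lborel (\<lambda>x. complex_of_real (gauss (x :: real ^ 'n)))"
      by (simp add: complex_of_real_integrable_eq gauss_integral(1))
    then show ?thesis
      using affine(2)[of "\<lambda>x. complex_of_real (gauss (x :: real ^ 'n))" \<epsilon> 0] \<open>\<epsilon> > 0\<close>
      by (simp add: \<phi>_def[abs_def])
  qed
  define C where "C = (\<integral>x. cmod (f x) \<partial>lebesgue)"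
  have \<phi>f: "integrable lborel (\<lambda>\<xi>. \<phi> \<xi> * fourier_L1 f \<xi>)"
  proof (rule Bochner_Integration.integrable_bound)
    show "integrable lborel (\<lambda>\<xi>. C *\<^sub>R \<phi> \<xi>)" using \<phi> by simp
    show "AE \<xi> in lborel. cmod (\<phi> \<xi> * fourier_L1 f \<xi>) \<le> cmod (C *\<^sub>R \<phi> \<xi>)"
    proof (rule AE_I2)
      fix \<xi>
      have "cmod (fourier_L1 f \<xi>) \<le> \<bar>C\<bar>"
        using norm_fourier_L1_le[of f \<xi>] by (simp add: C_def)
      then show "cmod (\<phi> \<xi> * fourier_L1 f \<xi>) \<le> cmod (C *\<^sub>R \<phi> \<xi>)"
        using mult_right_mono[of "cmod (fourier_L1 f \<xi>)" "\<bar>C\<bar>" "cmod (\<phi> \<xi>)"]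
        by (simp add: norm_mult mult.commute)
    qed
  qed measurable
  \<comment> \<open>The modulated Gaussian absorbs the character at \<open>y\<close>. A second use
    of the multiplication formula then moves the transform from \<open>f\<close> to
    \<open>e y\<close>, where it is explicit.\<close>
  define e where "e y \<xi> = exp (- \<i> * of_real (\<xi> \<bullet> y)) * \<phi> \<xi>" for y \<xi> :: "real ^ 'n"
  have e_meas [measurable]: "e y \<in> borel_measurable borel" for y unfolding e_def by measurable
  have e: "integrable lborel (e y)" for y
    by (rule Bochner_Integration.integrable_bound[OF \<phi>]) (auto simp: e_def norm_mult)
  have e_hat: "fourier_L1 (e y) x
      = of_real (sqrt (2 * pi) ^ CARD('n)) * (inverse \<epsilon> ^ CARD('n) *\<^sub>R of_real (gauss (inverse \<epsilon> *\<^sub>R (x + y))))" for x y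
  proof -
    have "fourier_L1 (e y) x = (\<integral>\<xi>. exp (- \<i> * of_real (\<xi> \<bullet> (x + y))) * \<phi> \<xi> \<partial>lborel)"
      unfolding fourier_L1_lborel[OF e_meas] e_def
      by (intro Bochner_Integration.integral_cong refl)
         (simp add: inner_add_right mult_exp_exp mult.assoc[symmetric] distrib_left)
    also have "\<dots> = inverse \<epsilon> ^ CARD('n) *\<^sub>R
        (\<integral>\<xi>. exp (- \<i> * of_real (\<xi> \<bullet> (inverse \<epsilon> *\<^sub>R (x + y)))) * of_real (gauss \<xi>) \<partial>lborel)"
      using \<open>\<epsilon> > 0\<close> by (subst affine(1)[of _ "inverse \<epsilon>" 0]) (simp_all add: \<phi>_def)
    also have "\<dots> = inverse \<epsilon> ^ CARD('n) *\<^sub>R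
        of_real (sqrt (2 * pi) ^ CARD('n) * gauss (inverse \<epsilon> *\<^sub>R (x + y)))"
      unfolding gauss_fourier(2) by simp
    finally show ?thesis by simp
  qed
  have inner: "fourier_L1 (\<lambda>\<xi>. \<phi> \<xi> * fourier_L1 f \<xi>) y
      = of_real (sqrt (2 * pi) ^ CARD('n)) * (\<integral>z. f (- y + \<epsilon> *\<^sub>R z) * of_real (gauss z) \<partial>lborel)" for y
  proof -
    have "fourier_L1 (\<lambda>\<xi>. \<phi> \<xi> * fourier_L1 f \<xi>) y = (\<integral>\<xi>. e y \<xi> * fourier_L1 f \<xi> \<partial>lborel)"
      by (subst fourier_L1_lborel) (simp_all add: e_def mult_ac)
    also have "\<dots> = (\<integral>x. f x * fourier_L1 (e y) x \<partial>lborel)"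
      by (rule fourier_L1_multiplication[OF f e])
    also have "\<dots> = of_real (sqrt (2 * pi) ^ CARD('n)) * (inverse \<epsilon> ^ CARD('n) *\<^sub>R
        (\<integral>x. f x * of_real (gauss (inverse \<epsilon> *\<^sub>R (x + y))) \<partial>lborel))"
      unfolding e_hat
      by (simp add: mult.left_commute[of "f _"] flip: integral_mult_right_zero integral_scaleR_right)
    also have "(\<integral>x. f x * of_real (gauss (inverse \<epsilon> *\<^sub>R (x + y))) \<partial>lborel)
        = \<epsilon> ^ CARD('n) *\<^sub>R (\<integral>z. f (- y + \<epsilon> *\<^sub>R z) * of_real (gauss z) \<partial>lborel)"
      using \<open>\<epsilon> > 0\<close> by (subst affine(1)[of _ \<epsilon> "- y"]) simp_all
    finally show ?thesis using \<open>\<epsilon> > 0\<close> by (simp add: power_mult_distrib[symmetric])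
  qed
  have "(\<integral>\<xi>. of_real (gauss (\<epsilon> *\<^sub>R \<xi>)) * (fourier_L1 f \<xi> * cnj (fourier_L1 f \<xi>)) \<partial>lborel)
      = (\<integral>\<xi>. (\<phi> \<xi> * fourier_L1 f \<xi>) * fourier_L1 h \<xi> \<partial>lborel)"
    unfolding h_hat \<phi>_def by (simp add: mult_ac)
  also have "\<dots> = (\<integral>y. h y * fourier_L1 (\<lambda>\<xi>. \<phi> \<xi> * fourier_L1 f \<xi>) y \<partial>lborel)"
    by (rule fourier_L1_multiplication[OF h \<phi>f])
  also have "\<dots> = of_real (sqrt (2 * pi) ^ CARD('n)) *
      (\<integral>y. h y * (\<integral>z. f (- y + \<epsilon> *\<^sub>R z) * of_real (gauss z) \<partial>lborel) \<partial>lborel)"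
    unfolding inner by (simp add: mult.left_commute[of "h _"] flip: integral_mult_right_zero)
  also have "(\<integral>y. h y * (\<integral>z. f (- y + \<epsilon> *\<^sub>R z) * of_real (gauss z) \<partial>lborel) \<partial>lborel)
      = (\<integral>y. cnj (f y) * (\<integral>z. f (y + \<epsilon> *\<^sub>R z) * of_real (gauss z) \<partial>lborel) \<partial>lborel)"
    by (subst affine(1)[of _ "-1" 0]) (simp_all add: h_def)
  finally show ?thesis .
qed

text \<open>Let \<epsilon> tend to 0 in the regularized identity. The frequency side converges
  monotonically; the space side converges by domination, since \<open>f\<close> is bounded and
  integrable. One factor \<open>s\<close> is the constant of that identity, the other the integral
  of the Gaussian, and \<open>s * s\<close> is (2 pi)^n.\<close>

lemma plancherel_Cc:
  fixes f :: "real ^ 'n \<Rightarrow> complex"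
  assumes "Cc f"
  shows "(\<integral>\<^sup>+\<xi>. ennreal ((cmod (fourier_L1 f \<xi>))\<^sup>2) \<partial>lborel)
    = ennreal ((2 * pi) ^ CARD('n) * (\<integral>x. (cmod (f x))\<^sup>2 \<partial>lborel))"
proof -
  define s where "s = sqrt (2 * pi) ^ CARD('n)"
  have s2: "s * s = (2 * pi) ^ CARD('n)" unfolding s_def power_mult_distrib[symmetric] by simp
  obtain B where B: "0 \<le> B" "\<And>x. cmod (f x) \<le> B" using Cc_bounded[OF assms] by blast
  have [measurable]: "f \<in> borel_measurable borel" using Cc_measurable[OF assms] .
  have f: "integrable lborel f" using Cc_integrable(1)[OF assms] .
  have cont: "continuous_on UNIV f" using assms unfolding Cc_def by simp
  note [measurable] = measurable_fourier_L1(1)[OF Cc_integrable(2)[OF assms]]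
  define \<epsilon> where "\<epsilon> k = inverse (real (Suc k))" for k
  have \<epsilon>: "\<epsilon> k > 0" for k by (simp add: \<epsilon>_def)
  have \<epsilon>_lim: "\<epsilon> \<longlonglongrightarrow> 0" unfolding \<epsilon>_def by (rule LIMSEQ_inverse_real_of_nat)
  define g where "g k \<xi> = gauss (\<epsilon> k *\<^sub>R \<xi>) * (cmod (fourier_L1 f \<xi>))\<^sup>2" for k \<xi>
  have g_nonneg: "0 \<le> g k \<xi>" for k \<xi> by (simp add: g_def gauss_props)
  have g_meas [measurable]: "g k \<in> borel_measurable borel" for k unfolding g_def by measurable
  define J where "J k = (\<integral>y. cnj (f y) * (\<integral>z. f (y + \<epsilon> k *\<^sub>R z) * of_real (gauss z) \<partial>lborel) \<partial>lborel)" for k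
  have gJ: "complex_of_real (\<integral>\<xi>. g k \<xi> \<partial>lborel) = of_real s * J k" for k
  proof -
    have "complex_of_real (\<integral>\<xi>. g k \<xi> \<partial>lborel) = (\<integral>\<xi>. complex_of_real (g k \<xi>) \<partial>lborel)"
      by (rule integral_complex_of_real[symmetric])
    also have "\<dots> = (\<integral>\<xi>. of_real (gauss (\<epsilon> k *\<^sub>R \<xi>)) * (fourier_L1 f \<xi> * cnj (fourier_L1 f \<xi>)) \<partial>lborel)"
      by (simp add: g_def complex_norm_square del: of_real_power)
    also have "\<dots> = of_real s * J k"
      unfolding s_def J_def by (rule gauss_regularized_plancherel[OF f \<epsilon>])
    finally show ?thesis .
  qed
  have g_int: "integrable lborel (g k)" for k
  proof (rule Bochner_Integration.integrable_bound)
    define C where "C = (\<integral>x. cmod (f x) \<partial>lebesgue)"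
    have "integrable lborel (\<lambda>\<xi>. complex_of_real (gauss (\<epsilon> k *\<^sub>R \<xi> :: real ^ 'n)))"
      using lborel_affine_integral(2)[of "\<lambda>x. complex_of_real (gauss (x :: real ^ 'n))" "\<epsilon> k" 0] \<epsilon>[of k]
      by (simp add: complex_of_real_integrable_eq gauss_integral(1))
    then show "integrable lborel (\<lambda>\<xi>. C\<^sup>2 * gauss (\<epsilon> k *\<^sub>R \<xi> :: real ^ 'n))"
      by (simp add: complex_of_real_integrable_eq)
    show "AE \<xi> in lborel. norm (g k \<xi>) \<le> norm (C\<^sup>2 * gauss (\<epsilon> k *\<^sub>R \<xi>))"
    proof (rule AE_I2)
      fix \<xi>
      have "(cmod (fourier_L1 f \<xi>))\<^sup>2 \<le> C\<^sup>2"
        using norm_fourier_L1_le[of f \<xi>] by (intro power_mono) (simp_all add: C_def)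
      then have "gauss (\<epsilon> k *\<^sub>R \<xi>) * (cmod (fourier_L1 f \<xi>))\<^sup>2 \<le> gauss (\<epsilon> k *\<^sub>R \<xi>) * C\<^sup>2"
        by (rule mult_left_mono) (rule gauss_props)
      then show "norm (g k \<xi>) \<le> norm (C\<^sup>2 * gauss (\<epsilon> k *\<^sub>R \<xi>))"
        by (simp add: g_def gauss_props abs_mult mult.commute[of "C\<^sup>2"])
    qed
  qed measurable
  have gauss_int: "integrable lborel (\<lambda>z. complex_of_real (gauss (z :: real ^ 'n)))"
    by (simp add: complex_of_real_integrable_eq gauss_integral(1))
  have inner_meas: "(\<lambda>z. f (y + \<epsilon> k *\<^sub>R z) * of_real (gauss z)) \<in> borel_measurable lborel" for y k
    by measurable
  have inner_lim: "(\<lambda>k. \<integral>z. f (y + \<epsilon> k *\<^sub>R z) * of_real (gauss z) \<partial>lborel) \<longlonglongrightarrow> f y * of_real s" for y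
  proof -
    have "(\<lambda>k. \<integral>z. f (y + \<epsilon> k *\<^sub>R z) * of_real (gauss z) \<partial>lborel) \<longlonglongrightarrow> (\<integral>z. f y * of_real (gauss (z :: real ^ 'n)) \<partial>lborel)"
    proof (rule integral_dominated_convergence[where w="\<lambda>z. B * gauss z"])
      show "AE z in lborel. (\<lambda>k. f (y + \<epsilon> k *\<^sub>R z) * of_real (gauss z)) \<longlonglongrightarrow> f y * of_real (gauss z)"
      proof (rule AE_I2)
        fix z
        have "(\<lambda>k. y + \<epsilon> k *\<^sub>R z) \<longlonglongrightarrow> y + 0 *\<^sub>R z" by (intro tendsto_intros \<epsilon>_lim)
        then have "(\<lambda>k. f (y + \<epsilon> k *\<^sub>R z)) \<longlonglongrightarrow> f y"
          using continuous_on_tendsto_compose[OF cont, of "\<lambda>k. y + \<epsilon> k *\<^sub>R z" y sequentially] by simp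
        then show "(\<lambda>k. f (y + \<epsilon> k *\<^sub>R z) * of_real (gauss z)) \<longlonglongrightarrow> f y * of_real (gauss z)"
          by (rule tendsto_mult_right)
      qed
      show "AE z in lborel. cmod (f (y + \<epsilon> k *\<^sub>R z) * of_real (gauss z)) \<le> B * gauss z" for k
        by (intro AE_I2) (simp add: norm_mult gauss_props B mult_right_mono)
    qed (use gauss_integral(1) in \<open>auto\<close>)
    moreover have "(\<integral>z. f y * of_real (gauss (z :: real ^ 'n)) \<partial>lborel) = f y * of_real s"
      using gauss_integral(2)[where 'a="real ^ 'n"] by (simp add: s_def)
    ultimately show ?thesis by (simp only:)
  qed
  \<comment> \<open>A bound uniform in \<open>y\<close> and \<open>k\<close>, so that a multiple of
    |f| dominates the outer integral.\<close>
  have inner_bound: "cmod (\<integral>z. f (y + \<epsilon> k *\<^sub>R z) * of_real (gauss z) \<partial>lborel) \<le> B * s" for y k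
  proof -
    have "cmod (\<integral>z. f (y + \<epsilon> k *\<^sub>R z) * of_real (gauss z) \<partial>lborel)
        \<le> (\<integral>z. B * gauss (z :: real ^ 'n) \<partial>lborel)"
    proof (rule order_trans[OF integral_norm_bound Bochner_Integration.integral_mono])
      have "integrable lborel (\<lambda>z. f (y + \<epsilon> k *\<^sub>R z) * of_real (gauss z))"
        by (rule Bochner_Integration.integrable_bound[of _ "\<lambda>z. B * gauss (z :: real ^ 'n)"])
           (use gauss_integral(1) inner_meas B in \<open>auto simp: norm_mult gauss_props intro!: mult_right_mono\<close>)
      then show "integrable lborel (\<lambda>z. cmod (f (y + \<epsilon> k *\<^sub>R z) * of_real (gauss z)))" by simp
    qed (use gauss_integral(1) B in \<open>auto simp: norm_mult gauss_props intro!: mult_right_mono\<close>)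
    then show ?thesis using gauss_integral(2)[where 'a="real ^ 'n"] by (simp add: s_def)
  qed
  have "J \<longlonglongrightarrow> (\<integral>y. cnj (f y) * (f y * of_real s) \<partial>lborel)"
    unfolding J_def
  proof (rule integral_dominated_convergence[where w="\<lambda>y. cmod (f y) * (B * s)"])
    show "AE y in lborel. (\<lambda>k. cnj (f y) * (\<integral>z. f (y + \<epsilon> k *\<^sub>R z) * of_real (gauss z) \<partial>lborel))
        \<longlonglongrightarrow> cnj (f y) * (f y * of_real s)"
      by (intro AE_I2 tendsto_mult_left inner_lim)
    show "AE y in lborel. cmod (cnj (f y) * (\<integral>z. f (y + \<epsilon> k *\<^sub>R z) * of_real (gauss z) \<partial>lborel))
        \<le> cmod (f y) * (B * s)" for k
      by (intro AE_I2) (simp add: norm_mult mult_left_mono inner_bound)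
  qed (use f in \<open>auto\<close>)
  also have "(\<integral>y. cnj (f y) * (f y * of_real s) \<partial>lborel) = of_real (s * (\<integral>y. (cmod (f y))\<^sup>2 \<partial>lborel))"
  proof -
    have "(\<integral>y. cnj (f y) * (f y * of_real s) \<partial>lborel) = (\<integral>y. complex_of_real (s * (cmod (f y))\<^sup>2) \<partial>lborel)"
      by (intro Bochner_Integration.integral_cong refl)
         (simp add: complex_norm_square mult_ac del: of_real_power)
    also have "\<dots> = of_real (\<integral>y. s * (cmod (f y))\<^sup>2 \<partial>lborel)" by (rule integral_complex_of_real)
    finally show ?thesis by simp
  qed
  finally have "(\<lambda>k. Re (of_real s * J k)) \<longlonglongrightarrow> Re (of_real s * of_real (s * (\<integral>y. (cmod (f y))\<^sup>2 \<partial>lborel)))"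
    by (intro tendsto_intros)
  then have lim1: "(\<lambda>k. \<integral>\<xi>. g k \<xi> \<partial>lborel) \<longlonglongrightarrow> (2 * pi) ^ CARD('n) * (\<integral>y. (cmod (f y))\<^sup>2 \<partial>lborel)"
    unfolding gJ[symmetric]
    by (simp only: of_real_mult[symmetric] Re_complex_of_real mult.assoc[symmetric] s2)
  \<comment> \<open>Monotone convergence applies before the transform is known to be square
    integrable; its square integrability is a conclusion.\<close>
  have "(\<lambda>k. \<integral>\<^sup>+\<xi>. ennreal (g k \<xi>) \<partial>lborel) \<longlonglongrightarrow> (\<integral>\<^sup>+\<xi>. ennreal ((cmod (fourier_L1 f \<xi>))\<^sup>2) \<partial>lborel)"
  proof (rule nn_integral_LIMSEQ)
    show "incseq (\<lambda>k \<xi>. ennreal (g k \<xi>))"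
    proof (intro incseq_SucI le_funI ennreal_leI)
      fix k and \<xi> :: "real ^ 'n"
      have "norm (\<epsilon> (Suc k) *\<^sub>R \<xi>) \<le> norm (\<epsilon> k *\<^sub>R \<xi>)"
        by (simp add: \<epsilon>_def mult_right_mono le_imp_inverse_le)
      then have "(norm (\<epsilon> (Suc k) *\<^sub>R \<xi>))\<^sup>2 \<le> (norm (\<epsilon> k *\<^sub>R \<xi>))\<^sup>2"
        by (rule power_mono) simp
      then have "gauss (\<epsilon> k *\<^sub>R \<xi>) \<le> gauss (\<epsilon> (Suc k) *\<^sub>R \<xi>)"
        unfolding gauss_def by simp
      then show "g k \<xi> \<le> g (Suc k) \<xi>"
        unfolding g_def by (rule mult_right_mono) simp
    qed
    show "(\<lambda>k. ennreal (g k \<xi>)) \<longlonglongrightarrow> ennreal ((cmod (fourier_L1 f \<xi>))\<^sup>2)" for \<xi>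
    proof -
      have "(\<lambda>k. \<epsilon> k *\<^sub>R \<xi>) \<longlonglongrightarrow> 0 *\<^sub>R \<xi>" by (intro tendsto_intros \<epsilon>_lim)
      then have "(\<lambda>k. gauss (\<epsilon> k *\<^sub>R \<xi>)) \<longlonglongrightarrow> 1"
        using continuous_on_tendsto_compose[OF gauss_props(4), of "\<lambda>k. \<epsilon> k *\<^sub>R \<xi>" 0 sequentially]
        by (simp add: gauss_props(3))
      then have "(\<lambda>k. g k \<xi>) \<longlonglongrightarrow> 1 * (cmod (fourier_L1 f \<xi>))\<^sup>2"
        unfolding g_def by (rule tendsto_mult_right)
      then show ?thesis by (intro tendsto_ennrealI) simp
    qed
  qed measurable
  moreover have "(\<integral>\<^sup>+\<xi>. ennreal (g k \<xi>) \<partial>lborel) = ennreal (\<integral>\<xi>. g k \<xi> \<partial>lborel)" for k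
    by (rule nn_integral_eq_integral[OF g_int]) (simp add: g_nonneg)
  ultimately have "(\<lambda>k. ennreal (\<integral>\<xi>. g k \<xi> \<partial>lborel)) \<longlonglongrightarrow> (\<integral>\<^sup>+\<xi>. ennreal ((cmod (fourier_L1 f \<xi>))\<^sup>2) \<partial>lborel)"
    by simp
  from LIMSEQ_unique[OF this tendsto_ennrealI[OF lim1]] show ?thesis .
qed

text \<open>\<open>measurable_on\<close> supplies continuous functions converging almost everywhere,
  but with no control of size or support. Projecting their values to the disc of radius
  \<open>B\<close> and multiplying by the cutoff \<kappa> gives a common integrable majorant without
  changing the limit. The integrand adds the first and second powers in order to treat
  \<open>L^1\<close> and \<open>L^2\<close> at once.\<close>

lemma Cc_approximation_bounded:
  fixes f :: "real ^ 'n \<Rightarrow> complex"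
  assumes f: "f \<in> borel_measurable lebesgue" and B: "\<And>x. cmod (f x) \<le> B" "0 \<le> B"
    and R: "\<And>x. R < norm x \<Longrightarrow> f x = 0"
  obtains g where "\<And>k. Cc (g k)"
    "(\<lambda>k. \<integral>x. cmod (f x - g k x) + (cmod (f x - g k x))\<^sup>2 \<partial>lebesgue) \<longlonglongrightarrow> 0"
proof -
  have "f measurable_on UNIV"
    using f by (rule lebesgue_measurable_imp_measurable_on) simp
  then obtain N F where N: "negligible N" and F: "\<And>k. continuous_on UNIV (F k)"
    and lim: "\<And>x. x \<notin> N \<Longrightarrow> (\<lambda>k. F k x) \<longlonglongrightarrow> f x"
    unfolding measurable_on_def by auto
  define \<kappa> where "\<kappa> x = max 0 (min 1 (R + 1 - norm x))" for x :: "real ^ 'n"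
  \<comment> \<open>The nearest-point projection onto the disc is continuous and fixes the values of
    \<open>f\<close>.\<close>
  define c where "c z = closest_point (cball 0 B) z" for z :: complex
  define g where "g k x = of_real (\<kappa> x) * c (F k x)" for k x
  have c_cont: "continuous_on UNIV c"
    unfolding c_def using B(2) by (intro continuous_on_closest_point) auto
  have c_norm: "cmod (c z) \<le> B" for z
    using closest_point_in_set[of "cball 0 B" z] B(2) by (simp add: c_def)
  have c_id: "c z = z" if "cmod z \<le> B" for z
    using that by (simp add: c_def closest_point_self)
  have \<kappa>_cont: "continuous_on UNIV \<kappa>" unfolding \<kappa>_def by (intro continuous_intros)
  have \<kappa>_bd: "0 \<le> \<kappa> x" "\<kappa> x \<le> 1" for x by (simp_all add: \<kappa>_def)
  have \<kappa>_0: "\<kappa> x = 0" if "R + 1 < norm x" for x using that by (simp add: \<kappa>_def)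
  have \<kappa>_1: "\<kappa> x = 1" if "norm x \<le> R" for x using that by (simp add: \<kappa>_def)
  have g_cont: "continuous_on UNIV (g k)" for k
    unfolding g_def
    by (intro continuous_on_mult continuous_on_of_real \<kappa>_cont continuous_on_compose2[OF c_cont F]) auto
  have Cc: "Cc (g k)" for k
    unfolding Cc_def using g_cont \<kappa>_0 by (metis (no_types, lifting) g_def mult_zero_left of_real_0)
  have g_norm: "cmod (g k x) \<le> B" for k x
    using mult_mono[OF \<kappa>_bd(2)[of x] c_norm[of "F k x"]] \<kappa>_bd[of x]
    by (simp add: g_def norm_mult)
  have g_lim: "(\<lambda>k. g k x) \<longlonglongrightarrow> f x" if "x \<notin> N" for x
  proof -
    have "(\<lambda>k. c (F k x)) \<longlonglongrightarrow> c (f x)"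
      by (rule continuous_on_tendsto_compose[OF c_cont lim[OF that]]) auto
    then have "(\<lambda>k. g k x) \<longlonglongrightarrow> of_real (\<kappa> x) * f x"
      unfolding g_def using c_id[OF B(1)[of x]] by (intro tendsto_mult_left) simp
    also have "of_real (\<kappa> x) * f x = f x"
      using R[of x] \<kappa>_1[of x] by (cases "norm x \<le> R") auto
    finally show ?thesis .
  qed
  define M where "M = cball (0 :: real ^ 'n) (R + 1)"
  show ?thesis
  proof (rule that[OF Cc])
    have "(\<lambda>k. \<integral>x. cmod (f x - g k x) + (cmod (f x - g k x))\<^sup>2 \<partial>lebesgue) \<longlonglongrightarrow> (\<integral>x. 0 \<partial>(lebesgue :: (real ^ 'n) measure))"
    proof (rule integral_dominated_convergence[where w="\<lambda>x. (2 * B + (2 * B)\<^sup>2) * indicator M x"])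
      have [measurable]: "g k \<in> borel_measurable lebesgue" for k
        using g_cont by (rule measurable_lebesgue_continuous)
      show "(\<lambda>x. cmod (f x - g k x) + (cmod (f x - g k x))\<^sup>2) \<in> borel_measurable lebesgue" for k
        using f by measurable
      have "M \<in> lmeasurable" unfolding M_def by simp
      then show "integrable lebesgue (\<lambda>x. (2 * B + (2 * B)\<^sup>2) * indicator M x :: real)"
        by (intro integrable_mult_right integrable_real_indicator) (auto simp: fmeasurable_def)
      have "AE x in lebesgue. x \<notin> N"
        using N by (intro AE_not_in) (simp add: negligible_iff_null_sets)
      then show "AE x in lebesgue. (\<lambda>k. cmod (f x - g k x) + (cmod (f x - g k x))\<^sup>2) \<longlonglongrightarrow> 0"
      proof eventually_elim
        case (elim x)
        have "(\<lambda>k. cmod (f x - g k x)) \<longlonglongrightarrow> cmod (f x - f x)"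
          by (intro tendsto_intros g_lim elim)
        then have z: "(\<lambda>k. cmod (f x - g k x)) \<longlonglongrightarrow> 0" by simp
        from tendsto_add[OF z tendsto_power[OF z, of 2]] show ?case by simp
      qed
      show "AE x in lebesgue. norm (cmod (f x - g k x) + (cmod (f x - g k x))\<^sup>2)
          \<le> (2 * B + (2 * B)\<^sup>2) * indicator M x" for k
      proof (rule AE_I2)
        fix x
        show "norm (cmod (f x - g k x) + (cmod (f x - g k x))\<^sup>2) \<le> (2 * B + (2 * B)\<^sup>2) * indicator M x"
        proof (cases "x \<in> M")
          case True
          have le: "cmod (f x - g k x) \<le> 2 * B"
            using norm_triangle_ineq4[of "f x" "g k x"] B(1)[of x] g_norm[of k x] by linarith
          then have "(cmod (f x - g k x))\<^sup>2 \<le> (2 * B)\<^sup>2" by (rule power_mono) simp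
          with le True show ?thesis by simp
        next
          case False
          then have "f x = 0" "g k x = 0"
            using R[of x] \<kappa>_0[of x] by (auto simp: M_def g_def)
          then show ?thesis using False by simp
        qed
      qed
    qed simp
    then show "(\<lambda>k. \<integral>x. cmod (f x - g k x) + (cmod (f x - g k x))\<^sup>2 \<partial>lebesgue) \<longlonglongrightarrow> 0" by simp
  qed
qed

text \<open>The same sequence has to converge in both norms: \<open>L^1\<close> convergence makes
  the transforms converge pointwise, and \<open>L^2\<close> convergence carries over Plancherel's
  identity. Truncating domain and values reduces to the bounded case.\<close>

lemma Cc_approximation:
  fixes f :: "real ^ 'n \<Rightarrow> complex"
  assumes f1: "integrable lebesgue f" and f2: "f \<in> Lp 2"
  obtains g where "\<And>k. Cc (g k)"
    "(\<lambda>k. \<integral>x. cmod (f x - g k x) \<partial>lebesgue) \<longlonglongrightarrow> 0"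
    "(\<lambda>k. dist (abs_l2 f) (abs_l2 (g k))) \<longlonglongrightarrow> 0"
proof -
  have [measurable]: "f \<in> borel_measurable lebesgue" using f2 by (rule Lp_2_D)
  define \<Phi> where "\<Phi> u v = (\<lambda>x. cmod (u x - v x) + (cmod (u x - v x))\<^sup>2)" for u v :: "real ^ 'n \<Rightarrow> complex"
  have \<Phi>_int: "integrable lebesgue (\<Phi> u v)"
    if "integrable lebesgue u" "u \<in> Lp 2" "integrable lebesgue v" "v \<in> Lp 2" for u v
    unfolding \<Phi>_def using that Lp_2_D(2)[OF Lp_2_diff[OF that(2,4)]]
    by (intro Bochner_Integration.integrable_add) auto
  have \<Phi>_tri: "\<Phi> u w x \<le> 2 * \<Phi> u v x + 2 * \<Phi> v w x" for u v w x
  proof -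
    have "cmod (u x - w x) \<le> cmod (u x - v x) + cmod (v x - w x)"
      using norm_triangle_ineq[of "u x - v x" "v x - w x"] by simp
    moreover from this have "(cmod (u x - w x))\<^sup>2 \<le> (cmod (u x - v x) + cmod (v x - w x))\<^sup>2"
      by (rule power_mono) simp
    moreover have "(a + b)\<^sup>2 \<le> 2 * a\<^sup>2 + 2 * b\<^sup>2" for a b :: real
      using sum_squares_bound[of a b] by (simp add: power2_sum)
    ultimately show ?thesis
      unfolding \<Phi>_def by (smt (verit) norm_ge_zero)
  qed
  define A where "A N = {x. norm x \<le> real N \<and> cmod (f x) \<le> real N}" for N
  have A_meas [measurable]: "A N \<in> sets lebesgue" for N
  proof -
    have [measurable]: "(norm :: real ^ 'n \<Rightarrow> real) \<in> borel_measurable lebesgue"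
      by (intro measurable_lebesgue_continuous continuous_intros)
    have "{x \<in> space lebesgue. norm x \<le> real N \<and> cmod (f x) \<le> real N} \<in> sets lebesgue" by measurable
    then show ?thesis by (simp add: A_def)
  qed
  define h where "h N x = indicator (A N) x * f x" for N x
  have h_meas: "h N \<in> borel_measurable lebesgue" for N unfolding h_def by measurable
  have h_le: "cmod (h N x) \<le> cmod (f x)" for N x by (simp add: h_def indicator_def)
  have h1: "integrable lebesgue (h N)" for N
    using f1 h_meas by (rule Bochner_Integration.integrable_bound) (simp add: h_le)
  have h2: "h N \<in> Lp 2" for N
    using f2 h_meas by (rule Lp_2_bound[where C=1]) (simp add: h_le)
  have h_lim: "(\<lambda>N. \<integral>x. \<Phi> f (h N) x \<partial>lebesgue) \<longlonglongrightarrow> (\<integral>x. 0 \<partial>(lebesgue :: (real ^ 'n) measure))"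
  proof (rule integral_dominated_convergence[where w="\<Phi> f (\<lambda>x. 0)"])
    show "integrable lebesgue (\<Phi> f (\<lambda>x. 0))" by (intro \<Phi>_int f1 f2) (auto simp: Lp_2_zero)
    show "\<Phi> f (h N) \<in> borel_measurable lebesgue" for N
      by (intro borel_measurable_integrable \<Phi>_int f1 f2 h1 h2)
    show "AE x in lebesgue. norm (\<Phi> f (h N) x) \<le> \<Phi> f (\<lambda>x. 0) x" for N
      by (intro AE_I2) (simp add: \<Phi>_def h_def indicator_def)
    show "AE x in lebesgue. (\<lambda>N. \<Phi> f (h N) x) \<longlonglongrightarrow> 0"
    proof (intro AE_I2 tendsto_eventually)
      fix x
      obtain N0 where "max (norm x) (cmod (f x)) \<le> real N0" using real_arch_simple by blast
      then show "\<forall>\<^sub>F N in sequentially. \<Phi> f (h N) x = 0"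
        by (intro eventually_sequentiallyI[of N0]) (simp add: \<Phi>_def h_def A_def)
    qed
  qed simp
  have ex: "\<exists>g. Cc g \<and> (\<integral>x. \<Phi> f g x \<partial>lebesgue) < inverse (real (Suc k))" for k
  proof -
    \<comment> \<open>A quarter, because \<Phi> obeys the triangle inequality only with a factor 2
      on each of the two errors.\<close>
    define e where "e = inverse (real (Suc k)) / 4"
    have "e > 0" by (simp add: e_def)
    from order_tendstoD(2)[OF h_lim, of e] \<open>e > 0\<close>
    obtain N where N: "(\<integral>x. \<Phi> f (h N) x \<partial>lebesgue) < e"
      by (auto simp: eventually_sequentially)
    have hN_B: "cmod (h N x) \<le> real N" for x by (simp add: h_def A_def indicator_def)
    have hN_R: "h N x = 0" if "real N < norm x" for x using that by (simp add: h_def A_def)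
    obtain g where g: "\<And>k. Cc (g k)"
      and lim: "(\<lambda>k. \<integral>x. cmod (h N x - g k x) + (cmod (h N x - g k x))\<^sup>2 \<partial>lebesgue) \<longlonglongrightarrow> 0"
      using Cc_approximation_bounded[OF h_meas hN_B _ hN_R] by auto
    from order_tendstoD(2)[OF lim, of e] \<open>e > 0\<close>
    obtain j where j: "(\<integral>x. \<Phi> (h N) (g j) x \<partial>lebesgue) < e"
      unfolding \<Phi>_def by (auto simp: eventually_sequentially)
    note gj = Cc_integrable(2)[OF g[of j]] Cc_Lp_2[OF g[of j]]
    have "(\<integral>x. \<Phi> f (g j) x \<partial>lebesgue) \<le> (\<integral>x. 2 * \<Phi> f (h N) x + 2 * \<Phi> (h N) (g j) x \<partial>lebesgue)"
      by (intro Bochner_Integration.integral_mono Bochner_Integration.integrable_add integrable_mult_right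
          \<Phi>_int f1 f2 h1 h2 gj \<Phi>_tri)
    also have "\<dots> = 2 * (\<integral>x. \<Phi> f (h N) x \<partial>lebesgue) + 2 * (\<integral>x. \<Phi> (h N) (g j) x \<partial>lebesgue)"
      using \<Phi>_int[OF f1 f2 h1 h2] \<Phi>_int[OF h1 h2 gj] by simp
    also have "\<dots> < inverse (real (Suc k))" using N j by (simp add: e_def)
    finally show ?thesis using g by blast
  qed
  then obtain g where g: "\<And>k. Cc (g k)" and gE: "\<And>k. (\<integral>x. \<Phi> f (g k) x \<partial>lebesgue) < inverse (real (Suc k))"
    by metis
  note g1 = Cc_integrable(2)[OF g] and g2 = Cc_Lp_2[OF g]
  have a: "(\<integral>x. cmod (f x - g k x) \<partial>lebesgue) \<le> inverse (real (Suc k))" for k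
  proof -
    have "(\<integral>x. cmod (f x - g k x) \<partial>lebesgue) \<le> (\<integral>x. \<Phi> f (g k) x \<partial>lebesgue)"
      by (intro Bochner_Integration.integral_mono \<Phi>_int f1 f2 g1 g2) (use f1 g1 in \<open>auto simp: \<Phi>_def\<close>)
    then show ?thesis using gE[of k] by linarith
  qed
  have b: "(dist (abs_l2 f) (abs_l2 (g k)))\<^sup>2 \<le> inverse (real (Suc k))" for k
  proof -
    have "(dist (abs_l2 f) (abs_l2 (g k)))\<^sup>2 = (\<integral>x. (cmod (f x - g k x))\<^sup>2 \<partial>lebesgue)"
      by (simp add: dist_norm abs_l2_diff f2 g2 norm_abs_l2_power2 Lp_2_diff)
    also have "\<dots> \<le> (\<integral>x. \<Phi> f (g k) x \<partial>lebesgue)"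
      by (intro Bochner_Integration.integral_mono \<Phi>_int f1 f2 g1 g2 Lp_2_D(2) Lp_2_diff) (simp add: \<Phi>_def)
    finally show ?thesis using gE[of k] by linarith
  qed
  note lim0 = LIMSEQ_inverse_real_of_nat
  show ?thesis
  proof (rule that[OF g])
    show "(\<lambda>k. \<integral>x. cmod (f x - g k x) \<partial>lebesgue) \<longlonglongrightarrow> 0"
    proof (rule Lim_null_comparison[OF always_eventually lim0], rule allI)
      show "norm (\<integral>x. cmod (f x - g k x) \<partial>lebesgue) \<le> inverse (real (Suc k))" for k
        using a[of k] by simp
    qed
    have "(\<lambda>k. (dist (abs_l2 f) (abs_l2 (g k)))\<^sup>2) \<longlonglongrightarrow> 0"
    proof (rule Lim_null_comparison[OF always_eventually lim0], rule allI)
      show "norm ((dist (abs_l2 f) (abs_l2 (g k)))\<^sup>2) \<le> inverse (real (Suc k))" for k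
        using b[of k] by simp
    qed
    from tendsto_real_sqrt[OF this] show "(\<lambda>k. dist (abs_l2 f) (abs_l2 (g k))) \<longlonglongrightarrow> 0"
      by simp
  qed
qed

lemma fourier_const_power2: "((sqrt (2 * pi)) ^ n)\<^sup>2 = (2 * pi) ^ n"
  by (simp add: power_mult[symmetric] mult.commute[of n 2] power_mult del: real_sqrt_mult)

lemma plancherel_Cc_l2:
  fixes f :: "real ^ 'n \<Rightarrow> complex"
  assumes "Cc f"
  shows "fourier_L1 f \<in> Lp 2"
    and "norm (abs_l2 (fourier_L1 f)) = sqrt (2 * pi) ^ CARD('n) * norm (abs_l2 f)"
proof -
  note f = Cc_integrable(2)[OF assms] Cc_Lp_2[OF assms] Cc_measurable[OF assms]
  have "(\<integral>x. (cmod (f x))\<^sup>2 \<partial>lborel) = (\<integral>x. (cmod (f x))\<^sup>2 \<partial>lebesgue)"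
    using f(3) by (intro integral_completion[symmetric]) measurable
  then have eq: "(\<integral>\<^sup>+\<xi>. ennreal ((cmod (fourier_L1 f \<xi>))\<^sup>2) \<partial>lebesgue)
      = ennreal ((sqrt (2 * pi) ^ CARD('n) * norm (abs_l2 f))\<^sup>2)"
    unfolding nn_integral_completion plancherel_Cc[OF assms]
    by (simp only: power_mult_distrib[of "sqrt _ ^ _"] fourier_const_power2 norm_abs_l2_power2[OF f(2)])
  then show L: "fourier_L1 f \<in> Lp 2"
    by (intro Lp_2_I_nn measurable_fourier_L1 f) simp
  have "ennreal ((norm (abs_l2 (fourier_L1 f)))\<^sup>2) = ennreal ((sqrt (2 * pi) ^ CARD('n) * norm (abs_l2 f))\<^sup>2)"
    using eq unfolding nn_integral_abs_l2[OF L] .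
  then have "(norm (abs_l2 (fourier_L1 f)))\<^sup>2 = (sqrt (2 * pi) ^ CARD('n) * norm (abs_l2 f))\<^sup>2"
    by (subst (asm) ennreal_inj) auto
  then show "norm (abs_l2 (fourier_L1 f)) = sqrt (2 * pi) ^ CARD('n) * norm (abs_l2 f)"
    by (rule power2_eq_imp_eq) auto
qed

text \<open>Approximate by \<open>Cc\<close> functions in both norms. The transforms converge
  pointwise to \<open>fourier_L1 f\<close>, and Fatou's lemma identifies this pointwise limit with
  the \<open>L^2\<close> limit.\<close>

lemma plancherel_L1_L2:
  fixes f :: "real ^ 'n \<Rightarrow> complex"
  assumes f1: "integrable lebesgue f" and f2: "f \<in> Lp 2"
  shows "fourier_L1 f \<in> Lp 2"
    and "norm (abs_l2 (fourier_L1 f)) = sqrt (2 * pi) ^ CARD('n) * norm (abs_l2 f)"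
proof -
  define s where "s = sqrt (2 * pi) ^ CARD('n)"
  have s: "s > 0" by (simp add: s_def)
  obtain g where g: "\<And>k. Cc (g k)"
    and L1: "(\<lambda>k. \<integral>x. cmod (f x - g k x) \<partial>lebesgue) \<longlonglongrightarrow> 0"
    and L2: "(\<lambda>k. dist (abs_l2 f) (abs_l2 (g k))) \<longlonglongrightarrow> 0"
    using Cc_approximation[OF f1 f2] by blast
  note g1 = Cc_integrable(2)[OF g] and g2 = Cc_Lp_2[OF g]
  note [measurable] = measurable_fourier_L1(2)[OF g1] measurable_fourier_L1(2)[OF f1]
  have pointwise: "(\<lambda>k. fourier_L1 (g k) \<xi>) \<longlonglongrightarrow> fourier_L1 f \<xi>" for \<xi>
  proof (rule LIMSEQ_I)
    have diff0: "(\<lambda>k. fourier_L1 f \<xi> - fourier_L1 (g k) \<xi>) \<longlonglongrightarrow> 0"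
    proof (rule Lim_null_comparison[OF always_eventually L1], rule allI)
      show "cmod (fourier_L1 f \<xi> - fourier_L1 (g k) \<xi>) \<le> (\<integral>x. cmod (f x - g k x) \<partial>lebesgue)" for k
        using norm_fourier_L1_le[of "\<lambda>x. f x - g k x" \<xi>] by (simp add: fourier_L1_diff f1 g1)
    qed
    fix r :: real assume "0 < r"
    from LIMSEQ_D[OF diff0 this]
    show "\<exists>no. \<forall>n\<ge>no. cmod (fourier_L1 (g n) \<xi> - fourier_L1 f \<xi>) < r"
      by (simp add: norm_minus_commute)
  qed
  have gg: "dist (abs_l2 (fourier_L1 (g k))) (abs_l2 (fourier_L1 (g j))) = s * dist (abs_l2 (g k)) (abs_l2 (g j))" for k j
  proof -
    have "dist (abs_l2 (fourier_L1 (g k))) (abs_l2 (fourier_L1 (g j)))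
        = norm (abs_l2 (fourier_L1 (\<lambda>x. g k x - g j x)))"
      by (simp add: dist_norm abs_l2_diff plancherel_Cc_l2(1) g flip: fourier_L1_diff[OF g1 g1])
    also have "\<dots> = s * dist (abs_l2 (g k)) (abs_l2 (g j))"
      by (simp add: plancherel_Cc_l2 Cc_diff g s_def dist_norm abs_l2_diff g2)
    finally show ?thesis .
  qed
  \<comment> \<open>Fatou is applied in the index \<open>k\<close> with \<open>j\<close> fixed. The
    distances on the right are already known from the identity on \<open>Cc\<close>.\<close>
  have bound: "(\<integral>\<^sup>+\<xi>. ennreal ((cmod (fourier_L1 f \<xi> - fourier_L1 (g j) \<xi>))\<^sup>2) \<partial>lebesgue)
      \<le> ennreal ((s * dist (abs_l2 f) (abs_l2 (g j)))\<^sup>2)" for j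
  proof -
    have "(\<integral>\<^sup>+\<xi>. ennreal ((cmod (fourier_L1 f \<xi> - fourier_L1 (g j) \<xi>))\<^sup>2) \<partial>lebesgue)
        = (\<integral>\<^sup>+\<xi>. liminf (\<lambda>k. ennreal ((cmod (fourier_L1 (g k) \<xi> - fourier_L1 (g j) \<xi>))\<^sup>2)) \<partial>lebesgue)"
    proof (rule nn_integral_cong)
      fix \<xi>
      have "(\<lambda>k. ennreal ((cmod (fourier_L1 (g k) \<xi> - fourier_L1 (g j) \<xi>))\<^sup>2))
          \<longlonglongrightarrow> ennreal ((cmod (fourier_L1 f \<xi> - fourier_L1 (g j) \<xi>))\<^sup>2)"
        by (intro tendsto_intros pointwise)
      then show "ennreal ((cmod (fourier_L1 f \<xi> - fourier_L1 (g j) \<xi>))\<^sup>2)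
          = liminf (\<lambda>k. ennreal ((cmod (fourier_L1 (g k) \<xi> - fourier_L1 (g j) \<xi>))\<^sup>2))"
        by (intro lim_imp_Liminf[symmetric]) auto
    qed
    also have "\<dots> \<le> liminf (\<lambda>k. \<integral>\<^sup>+\<xi>. ennreal ((cmod (fourier_L1 (g k) \<xi> - fourier_L1 (g j) \<xi>))\<^sup>2) \<partial>lebesgue)"
      by (rule nn_integral_liminf) measurable
    also have "\<dots> = liminf (\<lambda>k. ennreal ((s * dist (abs_l2 (g k)) (abs_l2 (g j)))\<^sup>2))"
      by (simp add: nn_integral_dist_l2 plancherel_Cc_l2(1) g gg)
    also have "\<dots> = ennreal ((s * dist (abs_l2 f) (abs_l2 (g j)))\<^sup>2)"
    proof (rule lim_imp_Liminf)
      have "(\<lambda>k. abs_l2 (g k)) \<longlonglongrightarrow> abs_l2 f"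
        using L2 by (subst tendsto_dist_iff) (simp add: dist_commute)
      then show "(\<lambda>k. ennreal ((s * dist (abs_l2 (g k)) (abs_l2 (g j)))\<^sup>2))
          \<longlonglongrightarrow> ennreal ((s * dist (abs_l2 f) (abs_l2 (g j)))\<^sup>2)"
        by (intro tendsto_intros)
    qed simp
    finally show ?thesis .
  qed
  have "(\<lambda>\<xi>. fourier_L1 f \<xi> - fourier_L1 (g 0) \<xi>) \<in> Lp 2"
    using bound[of 0] by (intro Lp_2_I_nn) (auto simp: le_less_trans)
  from Lp_2_add[OF this plancherel_Cc_l2(1)[OF g[of 0]]]
  show L: "fourier_L1 f \<in> Lp 2" by simp
  have "dist (abs_l2 (fourier_L1 f)) (abs_l2 (fourier_L1 (g j))) \<le> s * dist (abs_l2 f) (abs_l2 (g j))" for j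
  proof -
    have "ennreal ((dist (abs_l2 (fourier_L1 f)) (abs_l2 (fourier_L1 (g j))))\<^sup>2)
        \<le> ennreal ((s * dist (abs_l2 f) (abs_l2 (g j)))\<^sup>2)"
      using bound[of j] by (simp add: nn_integral_dist_l2 L plancherel_Cc_l2(1) g)
    then have "(dist (abs_l2 (fourier_L1 f)) (abs_l2 (fourier_L1 (g j))))\<^sup>2
        \<le> (s * dist (abs_l2 f) (abs_l2 (g j)))\<^sup>2" by (subst (asm) ennreal_le_iff) auto
    then show ?thesis by (rule power2_le_imp_le) (use s in simp)
  qed
  then have le: "norm (dist (abs_l2 (fourier_L1 (g j))) (abs_l2 (fourier_L1 f))) \<le> s * dist (abs_l2 f) (abs_l2 (g j))" for j
    by (simp add: dist_commute)
  have "(\<lambda>j. s * dist (abs_l2 f) (abs_l2 (g j))) \<longlonglongrightarrow> s * 0"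
    by (rule tendsto_mult_left[OF L2])
  then have s0: "(\<lambda>j. s * dist (abs_l2 f) (abs_l2 (g j))) \<longlonglongrightarrow> 0" by simp
  have "(\<lambda>j. dist (abs_l2 (fourier_L1 (g j))) (abs_l2 (fourier_L1 f))) \<longlonglongrightarrow> 0"
    by (rule Lim_null_comparison[OF always_eventually s0]) (rule allI, rule le)
  then have "(\<lambda>j. abs_l2 (fourier_L1 (g j))) \<longlonglongrightarrow> abs_l2 (fourier_L1 f)"
    by (rule tendsto_dist_iff[THEN iffD2])
  then have lim_a: "(\<lambda>j. norm (abs_l2 (fourier_L1 (g j)))) \<longlonglongrightarrow> norm (abs_l2 (fourier_L1 f))"
    by (rule tendsto_norm)
  have "(\<lambda>k. abs_l2 (g k)) \<longlonglongrightarrow> abs_l2 f"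
    using L2 by (subst tendsto_dist_iff) (simp add: dist_commute)
  then have "(\<lambda>j. s * norm (abs_l2 (g j))) \<longlonglongrightarrow> s * norm (abs_l2 f)"
    by (intro tendsto_intros)
  then have "(\<lambda>j. norm (abs_l2 (fourier_L1 (g j)))) \<longlonglongrightarrow> s * norm (abs_l2 f)"
    by (simp add: plancherel_Cc_l2(2) g s_def)
  from LIMSEQ_unique[OF lim_a this]
  show "norm (abs_l2 (fourier_L1 f)) = sqrt (2 * pi) ^ CARD('n) * norm (abs_l2 f)"
    by (simp only: s_def)
qed

section \<open>The Fourier transform on \<open>L\<^sup>2\<close>\<close>

lemma plancherel_dist:
  fixes f g :: "real ^ 'n \<Rightarrow> complex"
  assumes "integrable lebesgue f" "f \<in> Lp 2" "integrable lebesgue g" "g \<in> Lp 2"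
  shows "dist (abs_l2 (fourier_L1 f)) (abs_l2 (fourier_L1 g)) = sqrt (2 * pi) ^ CARD('n) * dist (abs_l2 f) (abs_l2 g)"
proof -
  have "dist (abs_l2 (fourier_L1 f)) (abs_l2 (fourier_L1 g)) = norm (abs_l2 (fourier_L1 (\<lambda>x. f x - g x)))"
    by (simp add: dist_norm abs_l2_diff plancherel_L1_L2(1) assms flip: fourier_L1_diff)
  also have "\<dots> = sqrt (2 * pi) ^ CARD('n) * dist (abs_l2 f) (abs_l2 g)"
    by (subst plancherel_L1_L2(2)) (simp_all add: dist_norm abs_l2_diff Lp_2_diff assms)
  finally show ?thesis .
qed

section \<open>Extension of the transform to all of \<open>L^2\<close> by truncation\<close>

definition truncation :: "real \<Rightarrow> (real ^ 'n \<Rightarrow> complex) \<Rightarrow> real ^ 'n \<Rightarrow> complex" where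
  "truncation R f = (\<lambda>x. indicator (ball 0 R) x * f x)"

lemma indicator_Lp_2:
  assumes "A \<in> lmeasurable"
  shows "(indicator A :: real ^ 'n \<Rightarrow> complex) \<in> Lp 2"
proof -
  have "A \<in> sets lebesgue" "integrable lebesgue (indicator A :: real ^ 'n \<Rightarrow> real)"
    using assms by (auto simp: fmeasurable_def)
  moreover have "(\<lambda>x. (cmod (indicator A x))\<^sup>2) = (indicator A :: real ^ 'n \<Rightarrow> real)"
    by (auto simp: indicator_def)
  ultimately show ?thesis by (simp add: Lp_2_iff)
qed

lemma truncation_Lp_2:
  assumes "f \<in> Lp 2"
  shows "truncation R f \<in> Lp 2" "integrable lebesgue (truncation R f)"
proof -
  have "(indicator (ball 0 R) :: real ^ 'a \<Rightarrow> complex) \<in> borel_measurable lebesgue"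
    by (rule Lp_2_D(1)[OF indicator_Lp_2]) simp
  from Lp_2_mult_bounded[OF assms this, of 1] show "truncation R f \<in> Lp 2"
    unfolding truncation_def by (simp add: indicator_def)
  show "integrable lebesgue (truncation R f)"
    unfolding truncation_def by (intro Lp_2_mult_integrable assms indicator_Lp_2) simp
qed

lemma truncation_tendsto:
  assumes f: "f \<in> Lp 2"
  shows "((\<lambda>R. abs_l2 (truncation R f)) \<longlongrightarrow> abs_l2 f) at_top"
proof -
  have [measurable]: "f \<in> borel_measurable lebesgue" using f by (rule Lp_2_D)
  note [measurable] = Lp_2_D(1)[OF truncation_Lp_2(1)[OF f]]
  have "((\<lambda>R. \<integral>x. (cmod (truncation R f x - f x))\<^sup>2 \<partial>lebesgue) \<longlongrightarrow> (\<integral>x. 0 \<partial>(lebesgue :: (real ^ 'a) measure))) at_top"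
  proof (rule integral_dominated_convergence_at_top[where w="\<lambda>x. (cmod (f x))\<^sup>2"])
    show "integrable lebesgue (\<lambda>x. (cmod (f x))\<^sup>2)" using f by (rule Lp_2_D)
    show "\<forall>\<^sub>F R in at_top. AE x in lebesgue. norm ((cmod (truncation R f x - f x))\<^sup>2) \<le> (cmod (f x))\<^sup>2"
      by (intro always_eventually allI AE_I2) (simp add: truncation_def indicator_def)
    show "AE x in lebesgue. ((\<lambda>R. (cmod (truncation R f x - f x))\<^sup>2) \<longlongrightarrow> 0) at_top"
    proof (intro AE_I2 tendsto_eventually)
      fix x :: "real ^ 'a"
      show "\<forall>\<^sub>F R in at_top. (cmod (truncation R f x - f x))\<^sup>2 = 0"
        using eventually_gt_at_top[of "norm x"] by eventually_elim (simp add: truncation_def)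
    qed
  qed measurable
  then have "((\<lambda>R. (dist (abs_l2 (truncation R f)) (abs_l2 f))\<^sup>2) \<longlongrightarrow> 0) at_top"
    by (simp add: dist_norm abs_l2_diff f truncation_Lp_2 norm_abs_l2_power2 Lp_2_diff)
  from tendsto_real_sqrt[OF this] have "((\<lambda>R. dist (abs_l2 (truncation R f)) (abs_l2 f)) \<longlongrightarrow> 0) at_top"
    by simp
  then show ?thesis by (rule tendsto_dist_iff[THEN iffD2])
qed

lemma tendsto_ennreal_power2_0_iff:
  fixes d :: "'a \<Rightarrow> real"
  assumes "\<And>x. 0 \<le> d x"
  shows "((\<lambda>x. ennreal ((d x)\<^sup>2)) \<longlongrightarrow> 0) F \<longleftrightarrow> (d \<longlongrightarrow> 0) F"
proof -
  have "((\<lambda>x. ennreal ((d x)\<^sup>2)) \<longlongrightarrow> ennreal 0) F \<longleftrightarrow> ((\<lambda>x. (d x)\<^sup>2) \<longlongrightarrow> 0) F"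
    by (rule tendsto_ennreal_iff) (auto intro: always_eventually)
  moreover have "((\<lambda>x. (d x)\<^sup>2) \<longlongrightarrow> 0) F \<longleftrightarrow> (d \<longlongrightarrow> 0) F"
  proof
    assume "((\<lambda>x. (d x)\<^sup>2) \<longlongrightarrow> 0) F"
    from tendsto_real_sqrt[OF this] show "(d \<longlongrightarrow> 0) F" using assms by simp
  next
    assume "(d \<longlongrightarrow> 0) F"
    from tendsto_power[OF this, of 2] show "((\<lambda>x. (d x)\<^sup>2) \<longlongrightarrow> 0) F" by simp
  qed
  ultimately show ?thesis by simp
qed

text \<open>The integral in the definition is a squared distance in \<open>l2\<close>. Hence
  \<open>is_fourier\<close> sees \<open>g\<close> only through its class and can be handled by
  limits in a Banach space.\<close>

lemma is_fourier_iff: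
  assumes "f \<in> Lp 2"
  shows "is_fourier f g \<longleftrightarrow> g \<in> Lp 2 \<and>
    ((\<lambda>R. abs_l2 (fourier_L1 (truncation R f))) \<longlongrightarrow> abs_l2 g) at_top"
proof (cases "g \<in> Lp 2")
  case True
  have "(\<integral>\<^sup>+\<xi>. ennreal ((cmod (fourier_L1 (truncation R f) \<xi> - g \<xi>))\<^sup>2) \<partial>lebesgue)
      = ennreal ((dist (abs_l2 (fourier_L1 (truncation R f))) (abs_l2 g))\<^sup>2)" for R
    by (intro nn_integral_dist_l2 plancherel_L1_L2 truncation_Lp_2 assms True)
  then show ?thesis
    using assms True
    unfolding is_fourier_def truncation_def[symmetric]
    by (simp add: tendsto_ennreal_power2_0_iff tendsto_dist_iff[symmetric])
qed (simp add: is_fourier_def)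

text \<open>By Plancherel the distances between transforms of truncations are \<open>s\<close> times
  the distances between the truncations, so they form a Cauchy sequence along the integers.\<close>

lemma is_fourier_exists:
  fixes f :: "real ^ 'n \<Rightarrow> complex"
  assumes f: "f \<in> Lp 2"
  shows "\<exists>g. is_fourier f g"
proof -
  define s where "s = sqrt (2 * pi) ^ CARD('n)"
  have s: "s > 0" by (simp add: s_def)
  define Y where "Y R = abs_l2 (fourier_L1 (truncation R f))" for R
  define a where "a R = abs_l2 (truncation R f)" for R
  have dist_Y: "dist (Y R) (Y S) = s * dist (a R) (a S)" for R S
    unfolding Y_def a_def s_def by (intro plancherel_dist truncation_Lp_2 f)
  have a_lim: "(a \<longlongrightarrow> abs_l2 f) at_top"
    unfolding a_def by (rule truncation_tendsto[OF f])
  then have a_seq: "(\<lambda>n. a (real n)) \<longlonglongrightarrow> abs_l2 f"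
    by (rule filterlim_compose) (rule filterlim_real_sequentially)
  have "Cauchy (\<lambda>n. Y (real n))"
  proof (rule metric_CauchyI)
    fix e :: real assume "0 < e"
    from LIMSEQ_imp_Cauchy[OF a_seq] have "Cauchy (\<lambda>n. a (real n))" .
    from metric_CauchyD[OF this, of "e / s"] \<open>0 < e\<close> s
    obtain M where M: "\<forall>m\<ge>M. \<forall>n\<ge>M. dist (a (real m)) (a (real n)) < e / s" by auto
    show "\<exists>M. \<forall>m\<ge>M. \<forall>n\<ge>M. dist (Y (real m)) (Y (real n)) < e"
      using M s by (intro exI[of _ M]) (simp add: dist_Y field_simps)
  qed
  then obtain b where b: "(\<lambda>n. Y (real n)) \<longlonglongrightarrow> b"
    using Cauchy_convergent convergent_def by blast
  \<comment> \<open>Passing to the limit keeps an equality, and this upgrades convergence along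
    integers to convergence along all real radii.\<close>
  have dist_b: "dist (Y R) b = s * dist (a R) (abs_l2 f)" for R
  proof (rule LIMSEQ_unique)
    show "(\<lambda>n. dist (Y R) (Y (real n))) \<longlonglongrightarrow> dist (Y R) b" by (intro tendsto_intros b)
    show "(\<lambda>n. dist (Y R) (Y (real n))) \<longlonglongrightarrow> s * dist (a R) (abs_l2 f)"
      unfolding dist_Y by (intro tendsto_intros a_seq)
  qed
  have "((\<lambda>R. s * dist (a R) (abs_l2 f)) \<longlongrightarrow> s * dist (abs_l2 f) (abs_l2 f)) at_top"
    by (intro tendsto_intros a_lim)
  then have "((\<lambda>R. dist (Y R) b) \<longlongrightarrow> 0) at_top" by (simp add: dist_b)
  then have "(Y \<longlongrightarrow> abs_l2 (rep_l2 b)) at_top"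
    unfolding abs_rep_l2 by (rule tendsto_dist_iff[THEN iffD2])
  then have "is_fourier f (rep_l2 b)"
    unfolding is_fourier_iff[OF f] Y_def by simp
  then show ?thesis by (rule exI[where x="rep_l2 b"])
qed

lemma is_fourier_fourier: "f \<in> Lp 2 \<Longrightarrow> is_fourier f (fourier f)"
  unfolding fourier_def by (rule someI_ex[OF is_fourier_exists])

lemma fourier_Lp_2 [intro]: "f \<in> Lp 2 \<Longrightarrow> fourier f \<in> Lp 2"
  using is_fourier_fourier unfolding is_fourier_def by blast

lemma fourier_tendsto:
  "f \<in> Lp 2 \<Longrightarrow> ((\<lambda>R. abs_l2 (fourier_L1 (truncation R f))) \<longlongrightarrow> abs_l2 (fourier f)) at_top"
  using is_fourier_fourier is_fourier_iff by blast

definition FT :: "'n::finite l2 \<Rightarrow> 'n l2" where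
  "FT a = abs_l2 (fourier (rep_l2 a))"

text \<open>Changing a representative on a null set leaves the transforms of its truncations
  unchanged at every point. The limit defining the class of \<open>fourier\<close> is therefore the
  same, whichever function \<open>SOME\<close> picks.\<close>

lemma FT_abs_l2:
  assumes f: "f \<in> Lp 2"
  shows "FT (abs_l2 f) = abs_l2 (fourier f)"
proof -
  let ?g = "rep_l2 (abs_l2 f)"
  have "truncation R ?g \<in> borel_measurable lebesgue" "truncation R f \<in> borel_measurable lebesgue" for R
    by (auto intro!: Lp_2_D(1) truncation_Lp_2 f)
  moreover have "AE x in lebesgue. truncation R ?g x = truncation R f x" for R
    using rep_abs_l2[OF f] by eventually_elim (simp add: truncation_def)
  ultimately have "fourier_L1 (truncation R ?g) = fourier_L1 (truncation R f)" for R
    by (intro ext fourier_L1_cong_AE)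
  then show ?thesis
    unfolding FT_def using fourier_tendsto[OF f] fourier_tendsto[of ?g]
    by (intro tendsto_unique[OF trivial_limit_at_top_linorder]) auto
qed

lemma FT_tendsto:
  "((\<lambda>R. abs_l2 (fourier_L1 (truncation R (rep_l2 a)))) \<longlongrightarrow> FT a) at_top"
  unfolding FT_def by (rule fourier_tendsto) simp

lemma FT_L1:
  fixes f :: "real ^ 'n \<Rightarrow> complex"
  assumes f: "integrable lebesgue f" "f \<in> Lp 2"
  shows "FT (abs_l2 f) = abs_l2 (fourier_L1 f)"
proof -
  have "((\<lambda>R. sqrt (2 * pi) ^ CARD('n) * dist (abs_l2 (truncation R f)) (abs_l2 f))
      \<longlongrightarrow> sqrt (2 * pi) ^ CARD('n) * dist (abs_l2 f) (abs_l2 f)) at_top"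
    by (intro tendsto_intros truncation_tendsto f)
  then have "((\<lambda>R. dist (abs_l2 (fourier_L1 (truncation R f))) (abs_l2 (fourier_L1 f))) \<longlongrightarrow> 0) at_top"
    by (subst plancherel_dist) (simp_all add: truncation_Lp_2 f)
  then have "((\<lambda>R. abs_l2 (fourier_L1 (truncation R f))) \<longlongrightarrow> abs_l2 (fourier_L1 f)) at_top"
    by (rule tendsto_dist_iff[THEN iffD2])
  from tendsto_unique[OF trivial_limit_at_top_linorder this fourier_tendsto[OF f(2)]]
  show ?thesis by (simp add: FT_abs_l2 f)
qed

lemma norm_FT: "norm (FT (a :: 'n::finite l2)) = sqrt (2 * pi) ^ CARD('n) * norm a"
proof (rule tendsto_unique[OF trivial_limit_at_top_linorder])
  let ?Y = "\<lambda>R. norm (abs_l2 (fourier_L1 (truncation R (rep_l2 a))))"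
  show "(?Y \<longlongrightarrow> norm (FT a)) at_top"
    by (intro tendsto_norm FT_tendsto)
  have "((\<lambda>R. sqrt (2 * pi) ^ CARD('n) * norm (abs_l2 (truncation R (rep_l2 a))))
    \<longlongrightarrow> sqrt (2 * pi) ^ CARD('n) * norm (abs_l2 (rep_l2 a))) at_top"
    by (intro tendsto_intros truncation_tendsto) simp
  then show "(?Y \<longlongrightarrow> sqrt (2 * pi) ^ CARD('n) * norm a) at_top"
    by (simp add: plancherel_L1_L2(2) truncation_Lp_2)
qed

lemma FT_add: "FT (a + b) = FT a + FT b"
proof -
  let ?f = "rep_l2 a" and ?g = "rep_l2 b"
  have ab: "a + b = abs_l2 (\<lambda>x. ?f x + ?g x)"
    using abs_l2_add[of ?f ?g] by simp
  have L: "(\<lambda>x. ?f x + ?g x) \<in> Lp 2" by (intro Lp_2_add) auto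
  have tr: "truncation R (\<lambda>x. ?f x + ?g x) = (\<lambda>x. truncation R ?f x + truncation R ?g x)" for R
    by (simp add: truncation_def distrib_left)
  have lim: "((\<lambda>R. abs_l2 (fourier_L1 (truncation R ?f)) + abs_l2 (fourier_L1 (truncation R ?g))) \<longlongrightarrow> FT a + FT b) at_top"
    by (intro tendsto_add FT_tendsto)
  have eq: "abs_l2 (fourier_L1 (truncation R ?f)) + abs_l2 (fourier_L1 (truncation R ?g))
      = abs_l2 (fourier_L1 (truncation R (\<lambda>x. ?f x + ?g x)))" for R
    unfolding tr
    by (simp add: abs_l2_add plancherel_L1_L2(1) truncation_Lp_2 flip: fourier_L1_add)
  show ?thesis
    unfolding ab FT_abs_l2[OF L]
    by (rule tendsto_unique[OF trivial_limit_at_top_linorder fourier_tendsto[OF L] lim[unfolded eq]])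
qed

lemma FT_scaleR: "FT (c *\<^sub>R a) = c *\<^sub>R FT a"
proof -
  let ?f = "rep_l2 a"
  have ab: "c *\<^sub>R a = abs_l2 (\<lambda>x. c *\<^sub>R ?f x)"
    using abs_l2_scaleR[of ?f c] by simp
  have L: "(\<lambda>x. c *\<^sub>R ?f x) \<in> Lp 2" by (intro Lp_2_scaleR) auto
  have tr: "truncation R (\<lambda>x. c *\<^sub>R ?f x) = (\<lambda>x. c *\<^sub>R truncation R ?f x)" for R
    by (simp add: truncation_def)
  have lim: "((\<lambda>R. c *\<^sub>R abs_l2 (fourier_L1 (truncation R ?f))) \<longlongrightarrow> c *\<^sub>R FT a) at_top"
    by (intro tendsto_intros FT_tendsto)
  have eq: "c *\<^sub>R abs_l2 (fourier_L1 (truncation R ?f)) = abs_l2 (fourier_L1 (truncation R (\<lambda>x. c *\<^sub>R ?f x)))" for R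
    unfolding tr
    by (simp add: abs_l2_scaleR plancherel_L1_L2(1) truncation_Lp_2 flip: fourier_L1_scaleR)
  show ?thesis
    unfolding ab FT_abs_l2[OF L]
    by (rule tendsto_unique[OF trivial_limit_at_top_linorder fourier_tendsto[OF L] lim[unfolded eq]])
qed

lemma bounded_linear_FT: "bounded_linear (FT :: 'n::finite l2 \<Rightarrow> _)"
  by (rule bounded_linear_intro[where K="sqrt (2 * pi) ^ CARD('n)"])
     (simp_all add: FT_add FT_scaleR norm_FT mult.commute)

text \<open>Polarization of \<open>norm_FT\<close>.\<close>

lemma inner_FT: "FT a \<bullet> FT b = (2 * pi) ^ CARD('n) * (a \<bullet> (b :: 'n::finite l2))"
  unfolding dot_norm[of "FT a"] dot_norm[of a] FT_add[symmetric] norm_FT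
  by (simp add: power_mult_distrib fourier_const_power2 right_diff_distrib del: real_sqrt_mult)

section \<open>Adjoint and inverse of the transform\<close>

definition CJ :: "'n::finite l2 \<Rightarrow> 'n l2" where
  "CJ a = abs_l2 (\<lambda>x. cnj (rep_l2 a x))"

lemma CJ_abs_l2:
  assumes "f \<in> Lp 2"
  shows "CJ (abs_l2 f) = abs_l2 (\<lambda>x. cnj (f x))"
  unfolding CJ_def
proof (rule abs_l2_eqI)
  show "AE x in lebesgue. cnj (rep_l2 (abs_l2 f) x) = cnj (f x)"
    using rep_abs_l2[OF assms] by eventually_elim simp
qed (simp add: Lp_2_cnj)

lemma norm_CJ: "norm (CJ a) = norm a"
proof -
  have "(norm (CJ a))\<^sup>2 = (norm (abs_l2 (rep_l2 a)))\<^sup>2"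
    unfolding CJ_def by (subst (1 2) norm_abs_l2_power2) (simp_all add: Lp_2_cnj)
  then show ?thesis by simp
qed

lemma bounded_linear_CJ: "bounded_linear (CJ :: 'n::finite l2 \<Rightarrow> _)"
proof (rule bounded_linear_intro[where K=1])
  fix a b :: "'n l2" and c :: real
  have "CJ (abs_l2 (rep_l2 a) + abs_l2 (rep_l2 b)) = CJ a + CJ b"
    by (simp add: abs_l2_add CJ_abs_l2 Lp_2_add CJ_def[of a] CJ_def[of b] Lp_2_cnj del: abs_rep_l2)
  then show "CJ (a + b) = CJ a + CJ b" by simp
  have "CJ (c *\<^sub>R abs_l2 (rep_l2 a)) = c *\<^sub>R CJ a"
    by (simp add: abs_l2_scaleR CJ_abs_l2 Lp_2_scaleR CJ_def[of a] Lp_2_cnj del: abs_rep_l2)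
  then show "CJ (c *\<^sub>R a) = c *\<^sub>R CJ a" by simp
qed (simp add: norm_CJ)

text \<open>Square-integrable functions need not be integrable, but their truncations are, so
  \<open>Cc_approximation\<close> is applied to these and the closure taken once more.\<close>

lemma Cc_dense: "closure {abs_l2 g |g. Cc g} = (UNIV :: 'n::finite l2 set)"
proof -
  let ?D = "{abs_l2 g |g. Cc g} :: 'n l2 set"
  have *: "abs_l2 f \<in> closure ?D" if f: "integrable lebesgue f" "f \<in> Lp 2" for f
  proof -
    obtain g where g: "\<And>k. Cc (g k)"
      and L2: "(\<lambda>k. dist (abs_l2 f) (abs_l2 (g k))) \<longlonglongrightarrow> 0"
      using Cc_approximation[OF f] by blast
    have "(\<lambda>k. abs_l2 (g k)) \<longlonglongrightarrow> abs_l2 f"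
      using L2 by (subst tendsto_dist_iff) (simp add: dist_commute)
    then show ?thesis
      unfolding closure_sequential using g by (intro exI[of _ "\<lambda>k. abs_l2 (g k)"]) auto
  qed
  have "a \<in> closure ?D" for a
  proof -
    have "(\<lambda>n. abs_l2 (truncation (real n) (rep_l2 a))) \<longlonglongrightarrow> abs_l2 (rep_l2 a)"
      by (rule filterlim_compose[OF truncation_tendsto filterlim_real_sequentially]) simp
    then have "(\<lambda>n. abs_l2 (truncation (real n) (rep_l2 a))) \<longlonglongrightarrow> a" by simp
    then show ?thesis
      by (rule Lim_in_closed_set[OF closed_closure, rotated 2])
         (intro always_eventually allI * truncation_Lp_2 rep_l2_Lp, simp)
  qed
  then show ?thesis by blast
qed

lemma Cc_dense_induct:
  fixes F G :: "'n::finite l2 \<Rightarrow> real"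
  assumes "continuous_on UNIV F" "continuous_on UNIV G"
    and "\<And>g. Cc g \<Longrightarrow> F (abs_l2 g) = G (abs_l2 g)"
  shows "F a = G a"
proof -
  have "closed {a. F a = G a}" using assms(1,2) by (rule closed_Collect_eq)
  then have "closure {abs_l2 g |g. Cc g} \<subseteq> {a. F a = G a}"
    using assms(3) by (intro closure_minimal) auto
  then show ?thesis unfolding Cc_dense by auto
qed

text \<open>The adjoint of \<^term>\<open>FT\<close> is its conjugate by complex conjugation. As an isometry up to a constant
  whose adjoint is injective, \<^term>\<open>FT\<close> is onto.\<close>

lemma FT_adjoint: "FT a \<bullet> b = a \<bullet> CJ (FT (CJ (b :: 'n::finite l2)))"
proof -
  note cont = linear_continuous_on[OF bounded_linear_FT] linear_continuous_on[OF bounded_linear_CJ]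
  have V: "continuous_on UNIV (\<lambda>b :: 'n l2. CJ (FT (CJ b)))"
    by (intro linear_continuous_on bounded_linear_compose[OF bounded_linear_CJ]
        bounded_linear_compose[OF bounded_linear_FT bounded_linear_CJ])
  \<comment> \<open>On \<open>Cc\<close> the adjoint relation is the multiplication formula for
    \<open>f\<close> and the conjugate of \<open>g\<close>; density extends it first in
    \<open>b\<close>, then in \<open>a\<close>.\<close>
  have base: "FT (abs_l2 f) \<bullet> abs_l2 g = abs_l2 f \<bullet> CJ (FT (CJ (abs_l2 g)))"
    if f: "Cc f" and g: "Cc g" for f g :: "real ^ 'n \<Rightarrow> complex"
  proof -
    have cg: "Cc (\<lambda>x. cnj (g x))" using g unfolding Cc_def by (auto intro!: continuous_intros)
    have V: "CJ (FT (CJ (abs_l2 g))) = abs_l2 (\<lambda>x. cnj (fourier_L1 (\<lambda>x. cnj (g x)) x))"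
      using g cg by (simp add: CJ_abs_l2 Cc_Lp_2 FT_L1 Cc_integrable plancherel_Cc_l2)
    have [measurable]: "f \<in> borel_measurable borel" "g \<in> borel_measurable borel"
        "fourier_L1 f \<in> borel_measurable borel" "fourier_L1 (\<lambda>x. cnj (g x)) \<in> borel_measurable borel"
      using f g cg by (auto intro: Cc_measurable measurable_fourier_L1 Cc_integrable)
    have "(\<integral>x. fourier_L1 f x * cnj (g x) \<partial>lebesgue) = (\<integral>x. cnj (g x) * fourier_L1 f x \<partial>lborel)"
      by (subst integral_completion) (simp_all add: mult.commute)
    also have "\<dots> = (\<integral>x. f x * fourier_L1 (\<lambda>x. cnj (g x)) x \<partial>lborel)"
      using f cg by (intro fourier_L1_multiplication Cc_integrable)
    also have "\<dots> = (\<integral>x. f x * fourier_L1 (\<lambda>x. cnj (g x)) x \<partial>lebesgue)"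
      by (subst integral_completion) simp_all
    finally show ?thesis
      unfolding V using f g cg
      by (simp add: FT_L1 Cc_integrable Cc_Lp_2 abs_l2_inner plancherel_Cc_l2(1) Lp_2_cnj)
  qed
  have *: "FT (abs_l2 f) \<bullet> b = abs_l2 f \<bullet> CJ (FT (CJ b))" if "Cc f" for f
    by (rule Cc_dense_induct[where a=b]) (intro continuous_intros V base that)+
  show ?thesis
    by (rule Cc_dense_induct[where a=a]) (intro continuous_intros cont *)+
qed

text \<open>\<open>inner_FT\<close> shows that the adjoint of \<open>FT\<close> composed with
  \<open>FT\<close> is (2 pi)^n times the identity. The inverse is therefore the adjoint of
  \<open>FT_adjoint\<close> divided by that constant.\<close>

definition IFT :: "'n::finite l2 \<Rightarrow> 'n l2" where
  "IFT a = inverse ((2 * pi) ^ CARD('n)) *\<^sub>R CJ (FT (CJ a))"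

lemma bounded_linear_IFT: "bounded_linear IFT"
  unfolding IFT_def
  by (intro bounded_linear_const_scaleR bounded_linear_compose[OF bounded_linear_CJ]
      bounded_linear_compose[OF bounded_linear_FT bounded_linear_CJ])

lemma IFT_FT: "IFT (FT a) = a"
proof -
  have "c \<bullet> IFT (FT a) = c \<bullet> a" for c
    by (simp add: IFT_def FT_adjoint[symmetric] inner_FT field_simps)
  then show ?thesis by (metis vector_eq_ldot)
qed

lemma FT_IFT: "FT (IFT a) = (a :: 'n::finite l2)"
proof -
  \<comment> \<open>\<open>IFT\<close> is a left inverse of \<open>FT\<close>, and it is injective
    because \<open>CJ\<close> and \<open>FT\<close> preserve norms up to a constant.\<close>
  have "IFT (FT (IFT a) - a) = 0"
    by (simp add: bounded_linear.linear[OF bounded_linear_IFT, THEN linear_diff] IFT_FT)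
  then have "norm (IFT (FT (IFT a) - a)) = 0" by simp
  then have "norm (FT (IFT a) - a) = 0" by (simp add: IFT_def norm_CJ norm_FT)
  then show ?thesis by simp
qed

lemma norm_IFT: "norm (IFT a) = inverse (sqrt (2 * pi) ^ CARD('n)) * norm (a :: 'n::finite l2)"
  using norm_FT[of "IFT a"] by (simp add: FT_IFT del: real_sqrt_mult)

text \<open>For an integrable argument the inverse is given by an absolutely convergent integral.
  The resulting representative is bounded at every point, which is how low frequencies are
  controlled in the Sobolev embedding.\<close>

lemma IFT_sup_bound:
  fixes f :: "real ^ 'n \<Rightarrow> complex"
  assumes f: "integrable lebesgue f" "f \<in> Lp 2"
  obtains h where "h \<in> Lp 2" "IFT (abs_l2 f) = abs_l2 h"
    "\<And>x. cmod (h x) \<le> inverse ((2 * pi) ^ CARD('n)) * (\<integral>\<xi>. cmod (f \<xi>) \<partial>lebesgue)"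
proof -
  define h where "h x = inverse ((2 * pi) ^ CARD('n)) *\<^sub>R cnj (fourier_L1 (\<lambda>\<xi>. cnj (f \<xi>)) x)" for x
  have c: "integrable lebesgue (\<lambda>\<xi>. cnj (f \<xi>))" "(\<lambda>\<xi>. cnj (f \<xi>)) \<in> Lp 2"
    using f by (simp_all add: Lp_2_cnj)
  note L = plancherel_L1_L2(1)[OF c]
  show ?thesis
  proof (rule that[of h])
    show "h \<in> Lp 2" unfolding h_def by (intro Lp_2_scaleR Lp_2_cnj L)
    show "IFT (abs_l2 f) = abs_l2 h"
      unfolding IFT_def CJ_abs_l2[OF f(2)] FT_L1[OF c] CJ_abs_l2[OF L] abs_l2_scaleR[OF Lp_2_cnj[OF L]] h_def ..
    show "cmod (h x) \<le> inverse ((2 * pi) ^ CARD('n)) * (\<integral>\<xi>. cmod (f \<xi>) \<partial>lebesgue)" for x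
      using norm_fourier_L1_le[of "\<lambda>\<xi>. cnj (f \<xi>)" x] by (simp add: h_def mult_left_mono)
  qed
qed

section \<open>Fourier multipliers and Bessel potentials\<close>

definition bounded_multiplier :: "(real ^ 'n \<Rightarrow> complex) \<Rightarrow> real \<Rightarrow> bool" where
  "bounded_multiplier k C \<longleftrightarrow> k \<in> borel_measurable lebesgue \<and> (\<forall>\<xi>. cmod (k \<xi>) \<le> C)"

definition mul :: "(real ^ 'n \<Rightarrow> complex) \<Rightarrow> 'n::finite l2 \<Rightarrow> 'n l2" where
  "mul k a = abs_l2 (\<lambda>\<xi>. k \<xi> * rep_l2 a \<xi>)"

lemma bounded_multiplier_nonneg: "bounded_multiplier k C \<Longrightarrow> 0 \<le> C"
  unfolding bounded_multiplier_def by (meson norm_ge_zero order_trans)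

lemma bounded_multiplier_Lp_2:
  assumes "bounded_multiplier k C" "f \<in> Lp 2"
  shows "(\<lambda>\<xi>. k \<xi> * f \<xi>) \<in> Lp 2"
  using assms(1) by (intro Lp_2_mult_bounded[OF assms(2), of k C]) (simp_all add: bounded_multiplier_def)

lemma mul_abs_l2:
  assumes "bounded_multiplier k C" "f \<in> Lp 2"
  shows "mul k (abs_l2 f) = abs_l2 (\<lambda>\<xi>. k \<xi> * f \<xi>)"
  unfolding mul_def
proof (rule abs_l2_eqI)
  show "AE \<xi> in lebesgue. k \<xi> * rep_l2 (abs_l2 f) \<xi> = k \<xi> * f \<xi>"
    using rep_abs_l2[OF assms(2)] by eventually_elim simp
qed (rule bounded_multiplier_Lp_2[OF assms(1) rep_l2_Lp])

lemma norm_mul_le: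
  assumes "bounded_multiplier k C"
  shows "norm (mul k a) \<le> C * norm a"
proof -
  have "norm (mul k a) \<le> C * norm (abs_l2 (rep_l2 a))"
    unfolding mul_def
  proof (rule norm_abs_l2_le)
    show "AE \<xi> in lebesgue. cmod (k \<xi> * rep_l2 a \<xi>) \<le> C * cmod (rep_l2 a \<xi>)"
      using assms by (intro AE_I2) (simp add: bounded_multiplier_def norm_mult mult_right_mono)
  qed (use assms bounded_multiplier_nonneg[OF assms] in
      \<open>auto intro: Lp_2_D(1) bounded_multiplier_Lp_2\<close>)
  then show ?thesis by simp
qed

lemma bounded_linear_mul:
  assumes k: "bounded_multiplier k C"
  shows "bounded_linear (mul k)"
proof (rule bounded_linear_intro[where K=C])
  fix a b and c :: real
  have "mul k (abs_l2 (rep_l2 a) + abs_l2 (rep_l2 b)) = mul k a + mul k b"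
    by (simp add: abs_l2_add mul_abs_l2[OF k] Lp_2_add mul_def[of k a] mul_def[of k b]
        bounded_multiplier_Lp_2[OF k] distrib_left del: abs_rep_l2)
  then show "mul k (a + b) = mul k a + mul k b" by simp
  have "mul k (c *\<^sub>R abs_l2 (rep_l2 a)) = c *\<^sub>R mul k a"
    by (simp add: abs_l2_scaleR mul_abs_l2[OF k] Lp_2_scaleR mul_def[of k a]
        bounded_multiplier_Lp_2[OF k] del: abs_rep_l2)
  then show "mul k (c *\<^sub>R a) = c *\<^sub>R mul k a" by simp
  show "norm (mul k a) \<le> norm a * C"
    using norm_mul_le[OF k] by (simp add: mult.commute)
qed

lemma bounded_multiplier_mult:
  assumes "bounded_multiplier k C" "bounded_multiplier l D"
  shows "bounded_multiplier (\<lambda>\<xi>. k \<xi> * l \<xi>) (C * D)"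
  using assms bounded_multiplier_nonneg[OF assms(1)]
  by (auto simp: bounded_multiplier_def norm_mult intro!: mult_mono)

lemma mul_mul:
  assumes "bounded_multiplier k C" "bounded_multiplier l D"
  shows "mul k (mul l a) = mul (\<lambda>\<xi>. k \<xi> * l \<xi>) a"
  unfolding mul_def[of l] mul_def[of "\<lambda>\<xi>. k \<xi> * l \<xi>"]
  by (subst mul_abs_l2[OF assms(1)]) (simp_all add: bounded_multiplier_Lp_2[OF assms(2)] mult.assoc)

text \<open>Dominated convergence. Pointwise convergence of symbols under a common bound gives
  convergence on each fixed \<open>a\<close>, which is the continuity in time required of the
  solution operators.\<close>

lemma mul_tendsto:
  assumes k: "\<And>i. bounded_multiplier (k i) C" and k0: "bounded_multiplier k0 C"
    and lim: "\<And>\<xi>. (\<lambda>i. k i \<xi>) \<longlonglongrightarrow> k0 \<xi>"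
  shows "(\<lambda>i. mul (k i) a) \<longlonglongrightarrow> mul k0 a"
proof -
  let ?f = "rep_l2 a"
  have [measurable]: "?f \<in> borel_measurable lebesgue" by (rule Lp_2_D) simp
  have [measurable]: "k i \<in> borel_measurable lebesgue" "k0 \<in> borel_measurable lebesgue" for i
    using k k0 by (auto simp: bounded_multiplier_def)
  have "(\<lambda>i. \<integral>\<xi>. (cmod (k i \<xi> * ?f \<xi> - k0 \<xi> * ?f \<xi>))\<^sup>2 \<partial>lebesgue)
      \<longlonglongrightarrow> (\<integral>\<xi>. 0 \<partial>(lebesgue :: (real ^ 'a) measure))"
  proof (rule integral_dominated_convergence[where w="\<lambda>\<xi>. (2 * C)\<^sup>2 * (cmod (?f \<xi>))\<^sup>2"])
    show "integrable lebesgue (\<lambda>\<xi>. (2 * C)\<^sup>2 * (cmod (?f \<xi>))\<^sup>2)"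
      by (intro integrable_mult_right Lp_2_D(2)) simp
    show "AE \<xi> in lebesgue. (\<lambda>i. (cmod (k i \<xi> * ?f \<xi> - k0 \<xi> * ?f \<xi>))\<^sup>2) \<longlonglongrightarrow> 0"
    proof (rule AE_I2)
      fix \<xi>
      have "(\<lambda>i. (cmod (k i \<xi> * ?f \<xi> - k0 \<xi> * ?f \<xi>))\<^sup>2) \<longlonglongrightarrow> (cmod (k0 \<xi> * ?f \<xi> - k0 \<xi> * ?f \<xi>))\<^sup>2"
        by (intro tendsto_intros lim)
      then show "(\<lambda>i. (cmod (k i \<xi> * ?f \<xi> - k0 \<xi> * ?f \<xi>))\<^sup>2) \<longlonglongrightarrow> 0" by simp
    qed
    show "AE \<xi> in lebesgue. norm ((cmod (k i \<xi> * ?f \<xi> - k0 \<xi> * ?f \<xi>))\<^sup>2) \<le> (2 * C)\<^sup>2 * (cmod (?f \<xi>))\<^sup>2" for i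
    proof (rule AE_I2)
      fix \<xi>
      have "cmod (k i \<xi> - k0 \<xi>) \<le> 2 * C"
        using norm_triangle_ineq4[of "k i \<xi>" "k0 \<xi>"] k[of i] k0
        unfolding bounded_multiplier_def by (smt (verit))
      then have "(cmod ((k i \<xi> - k0 \<xi>) * ?f \<xi>))\<^sup>2 \<le> (2 * C * cmod (?f \<xi>))\<^sup>2"
        by (intro power_mono) (simp_all add: norm_mult mult_right_mono)
      then show "norm ((cmod (k i \<xi> * ?f \<xi> - k0 \<xi> * ?f \<xi>))\<^sup>2) \<le> (2 * C)\<^sup>2 * (cmod (?f \<xi>))\<^sup>2"
        by (simp add: left_diff_distrib power_mult_distrib)
    qed
  qed measurable
  moreover have "(\<integral>\<xi>. (cmod (k i \<xi> * ?f \<xi> - k0 \<xi> * ?f \<xi>))\<^sup>2 \<partial>lebesgue) = (dist (mul (k i) a) (mul k0 a))\<^sup>2" for i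
    unfolding mul_def dist_norm
    by (simp add: abs_l2_diff bounded_multiplier_Lp_2[OF k] bounded_multiplier_Lp_2[OF k0]
        norm_abs_l2_power2 Lp_2_diff)
  ultimately have "(\<lambda>i. (dist (mul (k i) a) (mul k0 a))\<^sup>2) \<longlonglongrightarrow> 0" by simp
  from tendsto_real_sqrt[OF this] have "(\<lambda>i. dist (mul (k i) a) (mul k0 a)) \<longlonglongrightarrow> 0" by simp
  then show ?thesis by (rule tendsto_dist_iff[THEN iffD2])
qed

lemma fourier_mul_iff:
  assumes "bounded_multiplier k C" "f \<in> Lp 2" "g \<in> Lp 2"
  shows "(AE \<xi> in lebesgue. fourier g \<xi> = k \<xi> * fourier f \<xi>) \<longleftrightarrow> abs_l2 g = IFT (mul k (FT (abs_l2 f)))"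
proof -
  have "(AE \<xi> in lebesgue. fourier g \<xi> = k \<xi> * fourier f \<xi>) \<longleftrightarrow> FT (abs_l2 g) = mul k (FT (abs_l2 f))"
    by (simp add: FT_abs_l2 assms mul_abs_l2[OF assms(1)] fourier_Lp_2 abs_l2_eq_iff
        bounded_multiplier_Lp_2[OF assms(1)])
  also have "\<dots> \<longleftrightarrow> abs_l2 g = IFT (mul k (FT (abs_l2 f)))"
    by (metis IFT_FT FT_IFT)
  finally show ?thesis .
qed

text \<open>The inverse transform is a witness for the \<open>SOME\<close> in
  \<open>kernel_conv\<close>, and \<open>fourier_mul_iff\<close> determines the class of whichever
  function is chosen.\<close>

lemma kernel_conv_l2:
  assumes k: "bounded_multiplier k C" and f: "f \<in> Lp 2"
  shows "kernel_conv k f \<in> Lp 2" "abs_l2 (kernel_conv k f) = IFT (mul k (FT (abs_l2 f)))"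
proof -
  let ?P = "\<lambda>g. g \<in> Lp 2 \<and> (AE \<xi> in lebesgue. fourier g \<xi> = k \<xi> * fourier f \<xi>)"
  have "?P (rep_l2 (IFT (mul k (FT (abs_l2 f)))))"
    using fourier_mul_iff[OF k f] by simp
  then have P: "?P (kernel_conv k f)"
    unfolding kernel_conv_def by (rule someI[where P="?P"])
  then show "kernel_conv k f \<in> Lp 2" by blast
  with P show "abs_l2 (kernel_conv k f) = IFT (mul k (FT (abs_l2 f)))"
    using fourier_mul_iff[OF k f] by blast
qed

section \<open>Bessel potentials\<close>

definition bessel_inv :: "real \<Rightarrow> real ^ 'n \<Rightarrow> complex" where
  "bessel_inv a \<xi> = of_real ((1 + (norm \<xi>)\<^sup>2) powr (- a / 2))"

lemma bessel_inv_multiplier: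
  assumes "0 \<le> a"
  shows "bounded_multiplier (bessel_inv a) 1"
proof -
  have "continuous_on UNIV (bessel_inv a :: real ^ 'a \<Rightarrow> complex)"
    unfolding bessel_inv_def
    by (intro continuous_intros) (auto simp: add_nonneg_eq_0_iff)
  moreover have "cmod (bessel_inv a \<xi>) \<le> 1" for \<xi> :: "real ^ 'a"
    using assms powr_mono[of "- a / 2" 0 "1 + (norm \<xi>)\<^sup>2"]
    by (auto simp: bessel_inv_def split: if_splits)
  ultimately show ?thesis
    by (simp add: bounded_multiplier_def measurable_lebesgue_continuous)
qed

text \<open>The argument lives on the Fourier side, as a weighted transform. The map parametrizes
  \<open>H^a\<close> (up to null sets) bijectively by \<open>L^2\<close>, so that \<open>H^a\<close>
  can be treated without a type of its own.\<close>

definition bessel_pot :: "real \<Rightarrow> 'n::finite l2 \<Rightarrow> 'n l2" where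
  "bessel_pot a w = IFT (mul (bessel_inv a) w)"

lemma bounded_linear_bessel_pot:
  assumes "0 \<le> a"
  shows "bounded_linear (bessel_pot a)"
  unfolding bessel_pot_def
  by (rule bounded_linear_compose[OF bounded_linear_IFT bounded_linear_mul[OF bessel_inv_multiplier[OF assms]]])

lemma bessel_weight_inv: "of_real ((1 + (norm \<xi>)\<^sup>2) powr (a / 2)) * bessel_inv a \<xi> = 1"
proof -
  have "(1 + (norm \<xi>)\<^sup>2) powr (a / 2) * (1 + (norm \<xi>)\<^sup>2) powr (- a / 2) = (1 + (norm \<xi>)\<^sup>2) powr 0"
    by (subst powr_add[symmetric]) simp
  also have "\<dots> = 1" by (simp add: add_nonneg_eq_0_iff)
  finally show ?thesis by (simp add: bessel_inv_def flip: of_real_mult)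
qed

lemma Hs_bessel_pot:
  assumes "0 \<le> a" "f \<in> Hs a"
  shows "bessel_pot a (abs_l2 (bessel_weight a f)) = abs_l2 f"
proof -
  have f: "f \<in> Lp 2" "bessel_weight a f \<in> Lp 2" using assms(2) by (auto simp: Hs_def)
  note k = bessel_inv_multiplier[OF assms(1)]
  have "bessel_inv a \<xi> * bessel_weight a f \<xi> = fourier f \<xi>" for \<xi>
    using bessel_weight_inv[of \<xi> a] by (simp add: bessel_weight_def mult.assoc[symmetric] mult.commute)
  then have "mul (bessel_inv a) (abs_l2 (bessel_weight a f)) = FT (abs_l2 f)"
    by (simp add: mul_abs_l2[OF k f(2)] FT_abs_l2 f)
  then show ?thesis by (simp add: bessel_pot_def IFT_FT)
qed

text \<open>Together with \<open>Hs_bessel_pot\<close> this makes \<open>bessel_pot a\<close> and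
  the class of \<open>bessel_weight a\<close> mutually inverse.\<close>

lemma bessel_pot_Hs:
  assumes "0 \<le> a" "f \<in> Lp 2" "abs_l2 f = bessel_pot a w"
  shows "f \<in> Hs a" "abs_l2 (bessel_weight a f) = w"
proof -
  note k = bessel_inv_multiplier[OF assms(1)]
  have "abs_l2 (fourier f) = abs_l2 (\<lambda>\<xi>. bessel_inv a \<xi> * rep_l2 w \<xi>)"
    using assms(2,3) by (simp add: FT_abs_l2[symmetric] bessel_pot_def FT_IFT mul_def)
  then have "AE \<xi> in lebesgue. fourier f \<xi> = bessel_inv a \<xi> * rep_l2 w \<xi>"
    by (subst (asm) abs_l2_eq_iff) (simp_all add: fourier_Lp_2 assms bounded_multiplier_Lp_2[OF k])
  then have ae: "AE \<xi> in lebesgue. rep_l2 w \<xi> = bessel_weight a f \<xi>"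
    by eventually_elim (simp add: bessel_weight_def mult.assoc[symmetric] bessel_weight_inv)
  from Lp_2_cong_AE[OF _ ae] show "f \<in> Hs a" using assms(2) by (simp add: Hs_def)
  from abs_l2_eqI[OF _ ae] show "abs_l2 (bessel_weight a f) = w" by simp
qed

lemma bessel_pot_inj:
  assumes "0 \<le> a" "bessel_pot a v = bessel_pot a w"
  shows "v = w"
  using bessel_pot_Hs(2)[OF assms(1), of "rep_l2 (bessel_pot a v)"] assms(2)
  by (metis abs_rep_l2 rep_l2_Lp)

lemma Hs_diff:
  assumes "0 \<le> a" "f \<in> Hs a" "g \<in> Hs a"
  shows "(\<lambda>x. f x - g x) \<in> Hs a"
    "abs_l2 (bessel_weight a (\<lambda>x. f x - g x)) = abs_l2 (bessel_weight a f) - abs_l2 (bessel_weight a g)"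
proof -
  have L: "f \<in> Lp 2" "g \<in> Lp 2" using assms by (auto simp: Hs_def)
  have "abs_l2 (\<lambda>x. f x - g x) = bessel_pot a (abs_l2 (bessel_weight a f) - abs_l2 (bessel_weight a g))"
    by (simp add: linear_diff[OF bounded_linear.linear[OF bounded_linear_bessel_pot[OF assms(1)]]]
        Hs_bessel_pot assms abs_l2_diff L)
  from bessel_pot_Hs[OF assms(1) Lp_2_diff[OF L] this]
  show "(\<lambda>x. f x - g x) \<in> Hs a"
    "abs_l2 (bessel_weight a (\<lambda>x. f x - g x)) = abs_l2 (bessel_weight a f) - abs_l2 (bessel_weight a g)" .
qed

text \<open>Dyadic shells \<open>2\<^sup>-\<^sup>k\<^sup>-\<^sup>1 A \<le> |\<xi>| < 2\<^sup>-\<^sup>k A\<close> bound the singular integral.\<close>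

lemma nn_integral_ball_norm_powr:
  assumes b: "0 \<le> b" "b < real CARD('n)"
  obtains K where "0 < K"
    "\<And>A. 0 < A \<Longrightarrow> (\<integral>\<^sup>+\<xi>. indicator (ball 0 A) \<xi> * ennreal (norm (\<xi> :: real ^ 'n) powr (- b)) \<partial>lborel)
      \<le> ennreal (K * A powr (real CARD('n) - b))"
proof -
  define n where "n = CARD('n)"
  define V where "V = unit_ball_vol (real n)"
  have V: "V > 0" by (simp add: V_def)
  \<comment> \<open>\<open>q\<close> is the ratio of the bounds for consecutive shells, less than 1
    because \<open>b < n\<close>. In \<open>K\<close> below, \<open>2 powr b\<close> appears since
    the inner radius of a shell is half the outer one, and \<open>1 - q\<close> sums the geometric
    series.\<close>
  define q where "q = (1/2) powr (real n - b)"
  have q: "0 < q" "q < 1" using b powr_less_mono2[of "real n - b" "1/2" 1] by (simp_all add: q_def n_def)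
  define K where "K = V * 2 powr b / (1 - q)"
  show ?thesis
  proof (rule that)
    show "0 < K" using V q by (simp add: K_def)
  next
    fix A :: real assume A: "0 < A"
    define r where "r k = A * (1/2) ^ k" for k
    have r: "0 < r k" for k using A by (simp add: r_def)
    define T where "T k \<xi> = ennreal (r (Suc k) powr (- b)) * indicator (ball 0 (r k)) \<xi>" for k and \<xi> :: "real ^ 'n"
    have [measurable]: "ball (0 :: real ^ 'n) (r k) \<in> sets borel" for k by (rule borel_open) simp
    have T_meas [measurable]: "T k \<in> borel_measurable borel" for k
      unfolding T_def by (intro borel_measurable_times_ennreal borel_measurable_const borel_measurable_indicator) simp
    have le: "indicator (ball 0 A) \<xi> * ennreal (norm \<xi> powr (- b)) \<le> (\<Sum>k. T k \<xi>)" for \<xi> :: "real ^ 'n"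
    proof (cases "\<xi> \<noteq> 0 \<and> norm \<xi> < A")
      case True
      have "\<exists>k. r k \<le> norm \<xi>"
      proof -
        obtain k where "(1/2) ^ k < norm \<xi> / A"
          using real_arch_pow_inv[of "norm \<xi> / A" "1/2"] True A by (auto simp del: power_one_over)
        then show ?thesis using A by (intro exI[of _ k]) (simp add: r_def field_simps)
      qed
      then obtain m where m: "r m \<le> norm \<xi>" "\<And>i. i < m \<Longrightarrow> \<not> r i \<le> norm \<xi>"
        using exists_least_iff[of "\<lambda>k. r k \<le> norm \<xi>"] by blast
      with True obtain k where k: "m = Suc k" by (cases m) (auto simp: r_def)
      then have bd: "r (Suc k) \<le> norm \<xi>" "norm \<xi> < r k" using m by (auto simp: not_le)
      have "norm \<xi> powr (- b) \<le> r (Suc k) powr (- b)"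
        using bd(1) r[of "Suc k"] b by (intro powr_mono2') auto
      then have "indicator (ball 0 A) \<xi> * ennreal (norm \<xi> powr (- b)) \<le> T k \<xi>"
        using True bd by (simp add: T_def ennreal_leI)
      also have "\<dots> = (\<Sum>i\<in>{k}. T i \<xi>)" by simp
      also have "\<dots> \<le> (\<Sum>i. T i \<xi>)" by (rule sum_le_suminf) auto
      finally show ?thesis .
    next
      \<comment> \<open>The origin belongs to no shell, but there the integrand is 0 by
        \<open>0 powr (- b) = 0\<close>.\<close>
      case False
      then have "indicator (ball 0 A) \<xi> * ennreal (norm \<xi> powr (- b)) = 0"
        by (cases "\<xi> = 0") auto
      then show ?thesis by (simp only: zero_le)
    qed
    have "(\<integral>\<^sup>+\<xi>. indicator (ball 0 A) \<xi> * ennreal (norm (\<xi> :: real ^ 'n) powr (- b)) \<partial>lborel)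
        \<le> (\<integral>\<^sup>+\<xi>. (\<Sum>k. T k \<xi>) \<partial>lborel)"
      by (intro nn_integral_mono le)
    also have "\<dots> = (\<Sum>k. \<integral>\<^sup>+\<xi>. T k \<xi> \<partial>lborel)"
      by (rule nn_integral_suminf) measurable
    also have "\<dots> = (\<Sum>k. ennreal (V * 2 powr b * A powr (real n - b) * q ^ k))"
    proof (intro suminf_cong)
      fix k
      have "(\<integral>\<^sup>+\<xi>. T k \<xi> \<partial>lborel) = ennreal (r (Suc k) powr (- b)) * ennreal (V * r k ^ n)"
        unfolding T_def using r[of k]
        by (subst nn_integral_cmult) (auto simp: emeasure_ball V_def n_def)
      also have "\<dots> = ennreal (r (Suc k) powr (- b) * (V * r k ^ n))"
        using V r[of k] by (intro ennreal_mult[symmetric]) auto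
      also have "r (Suc k) powr (- b) * (V * r k ^ n) = V * 2 powr b * A powr (real n - b) * q ^ k"
      proof -
        have rS: "r (Suc k) = r k * (1/2)" by (simp add: r_def)
        have "r (Suc k) powr (- b) = r k powr (- b) * (1/2) powr (- b)"
          unfolding rS using r[of k] by (subst powr_mult) simp_all
        also have "(1/2) powr (- b) = 2 powr b" by (simp add: powr_minus powr_divide)
        finally have "r (Suc k) powr (- b) * (V * r k ^ n) = V * 2 powr b * (r k powr (- b) * r k powr (real n))"
          using r[of k] by (simp add: powr_realpow)
        also have "r k powr (- b) * r k powr (real n) = r k powr (real n - b)"
          by (simp add: powr_add[symmetric])
        also have "r k powr (real n - b) = A powr (real n - b) * ((1/2) ^ k) powr (real n - b)"
          using A by (simp add: r_def powr_mult)
        also have "((1/2::real) ^ k) powr (real n - b) = q ^ k"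
          by (simp add: q_def powr_powr powr_realpow[symmetric] mult.commute)
        finally show ?thesis by simp
      qed
      finally show "(\<integral>\<^sup>+\<xi>. T k \<xi> \<partial>lborel) = ennreal (V * 2 powr b * A powr (real n - b) * q ^ k)" .
    qed
    also have "\<dots> = ennreal (\<Sum>k. V * 2 powr b * A powr (real n - b) * q ^ k)"
      using V q by (intro suminf_ennreal2 summable_mult summable_geometric) auto
    also have "(\<Sum>k. V * 2 powr b * A powr (real n - b) * q ^ k) = K * A powr (real n - b)"
      using q by (subst suminf_mult) (auto simp: suminf_geometric K_def intro: summable_geometric)
    finally show "(\<integral>\<^sup>+\<xi>. indicator (ball 0 A) \<xi> * ennreal (norm (\<xi> :: real ^ 'n) powr (- b)) \<partial>lborel)
      \<le> ennreal (K * A powr (real CARD('n) - b))" by (simp add: n_def)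
  qed
qed

lemma nn_integral_powr_interval:
  assumes "0 < q" "0 \<le> y"
  shows "(\<integral>\<^sup>+l. ennreal (l powr (q - 1)) * indicator {0..y} l \<partial>lborel) = ennreal (y powr q / q)"
  using has_integral_powr_from_0[of "q - 1" y] assms
  by (intro nn_integral_has_integral_lebesgue') auto

section \<open>The Sobolev embedding\<close>

lemma ball_multiplier: "bounded_multiplier (indicator (ball 0 A) :: real ^ 'n \<Rightarrow> complex) 1"
proof -
  have "(indicator (ball 0 A) :: real ^ 'n \<Rightarrow> complex) \<in> borel_measurable lebesgue"
    by (rule Lp_2_D(1)[OF indicator_Lp_2]) simp
  then show ?thesis by (simp add: bounded_multiplier_def indicator_def)
qed

lemma compl_ball_multiplier: "bounded_multiplier (indicator (- ball 0 A) :: real ^ 'n \<Rightarrow> complex) 1"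
proof -
  have "(indicator (- ball 0 A) :: real ^ 'n \<Rightarrow> complex) \<in> borel_measurable lebesgue"
    by (intro borel_measurable_indicator) simp
  then show ?thesis by (simp add: bounded_multiplier_def indicator_def)
qed

text \<open>Trades the Bessel symbol for a homogeneous power. Allowing \<open>b\<close> below
  \<open>2 * a\<close> lets the critical scaling be used for every order from the critical one
  upwards.\<close>

lemma bessel_inv_le:
  fixes \<xi> :: "real ^ 'n"
  assumes "0 \<le> b" "b \<le> 2 * a" "\<xi> \<noteq> 0"
  shows "(cmod (bessel_inv a \<xi>))\<^sup>2 \<le> norm \<xi> powr (- b)"
proof -
  have pos: "0 < norm \<xi>" using assms(3) by simp
  have "(cmod (bessel_inv a \<xi>))\<^sup>2 = (1 + (norm \<xi>)\<^sup>2) powr (- a)"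
    by (simp add: bessel_inv_def power2_eq_square powr_add[symmetric])
  also have "\<dots> \<le> (1 + (norm \<xi>)\<^sup>2) powr (- b / 2)"
    using assms by (intro powr_mono) auto
  also have "\<dots> \<le> ((norm \<xi>)\<^sup>2) powr (- b / 2)"
    using assms pos by (intro powr_mono2') auto
  also have "\<dots> = norm \<xi> powr (- b)"
    using pos by (simp add: powr_powr flip: powr_numeral)
  finally show ?thesis .
qed

text \<open>The sup norm is bounded by the \<open>L^1\<close> norm of the transform. Cauchy-Schwarz
  separates \<open>w\<close> from the symbol, whose square is integrable over the ball because
  \<open>b < n\<close>.\<close>

lemma low_frequency_bound:
  assumes b: "0 \<le> b" "b < real CARD('n)" "b \<le> 2 * a" and a: "0 \<le> a"
  obtains M where "0 < M"
    "\<And>A (w :: 'n::finite l2). 0 < A \<Longrightarrow> \<exists>h\<in>Lp 2. bessel_pot a (mul (indicator (ball 0 A)) w) = abs_l2 h \<and>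
       (\<forall>x. cmod (h x) \<le> M * A powr ((real CARD('n) - b) / 2) * norm w)"
proof -
  obtain K where K: "0 < K"
    "\<And>A. 0 < A \<Longrightarrow> (\<integral>\<^sup>+\<xi>. indicator (ball 0 A) \<xi> * ennreal (norm (\<xi> :: real ^ 'n) powr (- b)) \<partial>lborel)
      \<le> ennreal (K * A powr (real CARD('n) - b))"
    using nn_integral_ball_norm_powr[OF b(1,2)] by blast
  define c where "c = inverse ((2 * pi) ^ CARD('n))"
  have c: "c > 0" by (simp add: c_def)
  show ?thesis
  proof (rule that[of "c * sqrt K"])
    show "0 < c * sqrt K" using c K(1) by simp
    fix A :: real and w :: "'n l2"
    assume A: "0 < A"
    let ?W = "rep_l2 w"
    have [measurable]: "?W \<in> borel_measurable lebesgue" by (rule Lp_2_D) simp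
    note mb = bessel_inv_multiplier[OF a, where 'a='n] and mi = ball_multiplier[of A, where 'n='n]
    have [measurable]: "(bessel_inv a :: real ^ 'n \<Rightarrow> complex) \<in> borel_measurable lebesgue"
      using mb by (simp add: bounded_multiplier_def)
    have [measurable]: "(indicator (ball 0 A) :: real ^ 'n \<Rightarrow> complex) \<in> borel_measurable lebesgue"
      using mi by (simp add: bounded_multiplier_def)
    define \<phi> where "\<phi> \<xi> = bessel_inv a \<xi> * indicator (ball 0 A) \<xi> * ?W \<xi>" for \<xi>
    have bi: "(\<lambda>\<xi> :: real ^ 'n. bessel_inv a \<xi> * indicator (ball 0 A) \<xi>) \<in> Lp 2"
      by (intro bounded_multiplier_Lp_2[OF mb] indicator_Lp_2) simp
    have \<phi>1: "integrable lebesgue \<phi>"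
      unfolding \<phi>_def by (intro Lp_2_mult_integrable bi) simp
    have \<phi>2: "\<phi> \<in> Lp 2"
      unfolding \<phi>_def by (intro bounded_multiplier_Lp_2[OF bounded_multiplier_mult[OF mb mi]]) simp
    have pot: "bessel_pot a (mul (indicator (ball 0 A)) w) = IFT (abs_l2 \<phi>)"
      unfolding bessel_pot_def mul_mul[OF mb mi] \<phi>_def by (simp add: mul_def)
    have m: "(\<lambda>\<xi>. ennreal (cmod (k \<xi>))) \<in> borel_measurable lebesgue" if "k \<in> Lp 2" for k :: "real ^ 'n \<Rightarrow> complex"
      using Lp_2_D(1)[OF that] by measurable
    define I where "I = (\<integral>\<xi>. cmod (\<phi> \<xi>) \<partial>lebesgue)"
    have I: "0 \<le> I" unfolding I_def by (intro integral_nonneg_AE) simp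
    have "ennreal I = (\<integral>\<^sup>+\<xi>. ennreal (cmod (\<phi> \<xi>)) \<partial>lebesgue)"
      unfolding I_def using \<phi>1 by (intro nn_integral_eq_integral[symmetric]) auto
    also have "\<dots> = (\<integral>\<^sup>+\<xi>. ennreal (cmod (bessel_inv a \<xi> * indicator (ball 0 A) \<xi>)) * ennreal (cmod (?W \<xi>)) \<partial>lebesgue)"
      by (simp add: \<phi>_def norm_mult ennreal_mult)
    finally have I_eq: "ennreal I = (\<integral>\<^sup>+\<xi>. ennreal (cmod (bessel_inv a \<xi> * indicator (ball 0 A) \<xi>)) * ennreal (cmod (?W \<xi>)) \<partial>lebesgue)" .
    have "(ennreal I)\<^sup>2 \<le> (\<integral>\<^sup>+\<xi>. (ennreal (cmod (bessel_inv a \<xi> * indicator (ball 0 A) (\<xi> :: real ^ 'n))))\<^sup>2 \<partial>lebesgue)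
        * (\<integral>\<^sup>+\<xi>. (ennreal (cmod (?W \<xi>)))\<^sup>2 \<partial>lebesgue)"
      unfolding I_eq by (rule Cauchy_Schwarz_nn_integral[OF m[OF bi] m[OF rep_l2_Lp[of w]]])
    also have "(\<integral>\<^sup>+\<xi>. (ennreal (cmod (?W \<xi>)))\<^sup>2 \<partial>lebesgue) = ennreal ((norm w)\<^sup>2)"
      using nn_integral_abs_l2[of ?W] by (simp add: ennreal_power)
    also have "(\<integral>\<^sup>+\<xi>. (ennreal (cmod (bessel_inv a \<xi> * indicator (ball 0 A) (\<xi> :: real ^ 'n))))\<^sup>2 \<partial>lebesgue)
        \<le> ennreal (K * A powr (real CARD('n) - b))"
    proof -
      have "AE \<xi> in lebesgue. (ennreal (cmod (bessel_inv a \<xi> * indicator (ball 0 A) \<xi>)))\<^sup>2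
          \<le> indicator (ball 0 A) \<xi> * ennreal (norm (\<xi> :: real ^ 'n) powr (- b))"
        using AE_completion[OF AE_lborel_singleton[of "0 :: real ^ 'n"]]
      proof eventually_elim
        case (elim \<xi>)
        then show ?case
          using bessel_inv_le[OF b(1,3) elim]
          by (cases "\<xi> \<in> ball 0 A") (simp_all add: ennreal_power norm_mult ennreal_leI)
      qed
      then have "(\<integral>\<^sup>+\<xi>. (ennreal (cmod (bessel_inv a \<xi> * indicator (ball 0 A) (\<xi> :: real ^ 'n))))\<^sup>2 \<partial>lebesgue)
          \<le> (\<integral>\<^sup>+\<xi>. indicator (ball 0 A) \<xi> * ennreal (norm (\<xi> :: real ^ 'n) powr (- b)) \<partial>lebesgue)"
        by (rule nn_integral_mono_AE)
      also have "\<dots> \<le> ennreal (K * A powr (real CARD('n) - b))"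
        unfolding nn_integral_completion by (rule K(2)[OF A])
      finally show ?thesis .
    qed
    finally have "(ennreal I)\<^sup>2 \<le> ennreal (K * A powr (real CARD('n) - b)) * ennreal ((norm w)\<^sup>2)"
      by (simp add: mult_right_mono)
    then have "ennreal (I\<^sup>2) \<le> ennreal (K * A powr (real CARD('n) - b) * (norm w)\<^sup>2)"
      using I K(1) by (simp add: ennreal_power ennreal_mult)
    then have "I\<^sup>2 \<le> K * A powr (real CARD('n) - b) * (norm w)\<^sup>2"
      using K(1) by (subst (asm) ennreal_le_iff) auto
    also have "\<dots> = (sqrt K * A powr ((real CARD('n) - b) / 2) * norm w)\<^sup>2"
      using K(1) by (simp add: power_mult_distrib) (simp add: power2_eq_square powr_add[symmetric])
    finally have I_le: "I \<le> sqrt K * A powr ((real CARD('n) - b) / 2) * norm w"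
      by (rule power2_le_imp_le) (use K(1) in simp)
    obtain h where h: "h \<in> Lp 2" "IFT (abs_l2 \<phi>) = abs_l2 h" "\<And>x. cmod (h x) \<le> c * I"
      using IFT_sup_bound[OF \<phi>1 \<phi>2] unfolding I_def c_def by blast
    have "cmod (h x) \<le> c * sqrt K * A powr ((real CARD('n) - b) / 2) * norm w" for x
      using order_trans[OF h(3)[of x] mult_left_mono[OF I_le, of c]] c by (simp add: mult.assoc)
    then show "\<exists>h\<in>Lp 2. bessel_pot a (mul (indicator (ball 0 A)) w) = abs_l2 h \<and>
       (\<forall>x. cmod (h x) \<le> c * sqrt K * A powr ((real CARD('n) - b) / 2) * norm w)"
      using h pot by auto
  qed
qed

text \<open>Plancherel's identity turns the norm into a frequency integral. \<open>v\<close> stands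
  for a Borel version of |w|, since this integral is later exchanged with one over the
  height.\<close>

lemma high_frequency_bound:
  fixes w :: "'n::finite l2" and v :: "real ^ 'n \<Rightarrow> real"
  assumes b: "0 \<le> b" "b \<le> 2 * a" and a: "0 \<le> a"
    and v: "v \<in> borel_measurable borel" "AE \<xi> in lborel. cmod (rep_l2 w \<xi>) = v \<xi>"
  shows "ennreal ((norm (bessel_pot a (mul (indicator (- ball 0 A)) w)))\<^sup>2)
    \<le> ennreal (inverse ((2 * pi) ^ CARD('n))) *
      (\<integral>\<^sup>+\<xi>. indicator (- ball 0 A) \<xi> * ennreal (norm \<xi> powr (- b) * (v \<xi>)\<^sup>2) \<partial>lborel)"
proof -
  note mb = bessel_inv_multiplier[OF a] and mi = compl_ball_multiplier[of A]
  note m = bounded_multiplier_mult[OF mb mi]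
  let ?k = "\<lambda>\<xi> :: real ^ 'n. bessel_inv a \<xi> * indicator (- ball 0 A) \<xi>"
  have "norm (bessel_pot a (mul (indicator (- ball 0 A)) w)) = inverse (sqrt (2 * pi) ^ CARD('n)) * norm (mul ?k w)"
    unfolding bessel_pot_def mul_mul[OF mb mi] norm_IFT ..
  then have "(norm (bessel_pot a (mul (indicator (- ball 0 A)) w)))\<^sup>2
      = inverse ((2 * pi) ^ CARD('n)) * (norm (mul ?k w))\<^sup>2"
    by (simp only: power_mult_distrib[of "inverse _"] power_inverse fourier_const_power2)
  then have "ennreal ((norm (bessel_pot a (mul (indicator (- ball 0 A)) w)))\<^sup>2)
      = ennreal (inverse ((2 * pi) ^ CARD('n))) * ennreal ((norm (mul ?k w))\<^sup>2)"
    by (simp only:) (intro ennreal_mult; simp)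
  also have "ennreal ((norm (mul ?k w))\<^sup>2) = (\<integral>\<^sup>+\<xi>. ennreal ((cmod (?k \<xi> * rep_l2 w \<xi>))\<^sup>2) \<partial>lebesgue)"
    unfolding mul_def by (intro nn_integral_abs_l2[symmetric] bounded_multiplier_Lp_2[OF m]) simp
  also have "\<dots> \<le> (\<integral>\<^sup>+\<xi>. indicator (- ball 0 A) \<xi> * ennreal (norm \<xi> powr (- b) * (v \<xi>)\<^sup>2) \<partial>lebesgue)"
  proof (rule nn_integral_mono_AE)
    show "AE \<xi> in lebesgue. ennreal ((cmod (?k \<xi> * rep_l2 w \<xi>))\<^sup>2)
        \<le> indicator (- ball 0 A) \<xi> * ennreal (norm \<xi> powr (- b) * (v \<xi>)\<^sup>2)"
      using AE_completion[OF AE_lborel_singleton[of "0 :: real ^ 'n"]] AE_completion[OF v(2)]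
    proof eventually_elim
      case (elim \<xi>)
      then show ?case
        using bessel_inv_le[OF b elim(1)]
        by (cases "\<xi> \<in> ball 0 A") (simp_all add: norm_mult power_mult_distrib ennreal_leI mult_right_mono)
    qed
  qed
  finally show ?thesis
    unfolding nn_integral_completion by (simp add: mult_left_mono)
qed


text \<open>Chemin and Xu's proof, which covers the critical exponent: at height \<open>l\<close>, cut the frequencies at the
  radius \<open>A l\<close> for which the low-frequency part stays below \<open>l/2\<close>, estimate the level set by the
  \<open>L\<^sup>2\<close>-norm of the high-frequency part, and integrate over \<open>l\<close>.\<close>

lemma sobolev_embedding:
  fixes a p :: real
  assumes p: "1 < p" and a: "0 \<le> a" "real CARD('n) * (1 - 1 / p) \<le> 2 * a"
  obtains C where "0 \<le> C"
    "\<And>w :: 'n::finite l2. (\<integral>\<^sup>+x. ennreal (cmod (rep_l2 (bessel_pot a w) x) powr (2 * p)) \<partial>lebesgue)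
      \<le> ennreal (C * norm w powr (2 * p))"
proof -
  define n where "n = real CARD('n)"
  have n: "0 < n" by (simp add: n_def)
  \<comment> \<open>\<open>b / 2 = n (1/2 - 1/(2 p))\<close> is the critical order for
    \<open>L^(2p)\<close>. With this choice the low-frequency bound grows like
    \<open>A powr (n / (2 * p))\<close>.\<close>
  define b where "b = n * (1 - 1 / p)"
  have b: "0 \<le> b" "b < n" "b \<le> 2 * a" using p a n by (simp_all add: b_def n_def field_simps)
  have exps: "(n - b) / 2 = n / (2 * p)" "n / (2 * p) * (2 * p - 2) = b"
    using p n by (simp_all add: b_def field_simps)
  obtain M where M: "0 < M"
    "\<And>A (w :: 'n::finite l2). 0 < A \<Longrightarrow> \<exists>h\<in>Lp 2. bessel_pot a (mul (indicator (ball 0 A)) w) = abs_l2 h \<and>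
       (\<forall>x. cmod (h x) \<le> M * A powr (n / (2 * p)) * norm w)"
    using low_frequency_bound[OF b(1) b(2)[unfolded n_def] b(3) a(1)] unfolding n_def[symmetric] exps(1) by blast
  define N where "N = inverse ((2 * pi) ^ CARD('n))"
  have N: "0 < N" by (simp add: N_def)
  \<comment> \<open>\<open>8 * p\<close> is \<open>2 * p\<close> from the layer-cake formula times 4
    from the level \<open>l / 2\<close> squared; \<open>N\<close> comes from Plancherel, and the
    rest from integrating \<open>l powr (2 * p - 3)\<close> up to \<open>L \<xi>\<close>.\<close>
  define C where "C = 8 * p * N * (2 * M) powr (2 * p - 2) / (2 * p - 2)"
  have C: "0 \<le> C" using p N M by (simp add: C_def)
  have main: "(\<integral>\<^sup>+x. ennreal (cmod (rep_l2 (bessel_pot a w) x) powr (2 * p)) \<partial>lebesgue)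
      \<le> ennreal (C * norm w powr (2 * p))" if w: "w \<noteq> 0" for w :: "'n l2"
  proof -
    define E where "E = norm w"
    have E: "0 < E" using w by (simp add: E_def)
    define u where "u = bessel_pot a w"
    have meas: "(\<lambda>x. cmod (rep_l2 y x)) \<in> borel_measurable lebesgue" for y :: "'n l2"
      using Lp_2_D(1)[OF rep_l2_Lp[of y]] by measurable
    \<comment> \<open>Representatives are only Lebesgue measurable, whereas exchanging integrals
      over \<open>lborel\<close> requires Borel functions.\<close>
    from completion_ex_borel_measurable_real[OF meas[of u]] completion_ex_borel_measurable_real[OF meas[of w]]
    obtain H v
      where [measurable]: "H \<in> borel_measurable lborel" "v \<in> borel_measurable lborel"
        and H: "AE x in lborel. cmod (rep_l2 u x) = H x"
        and v: "AE x in lborel. cmod (rep_l2 w x) = v x" by blast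
    define G where "G \<xi> = norm \<xi> powr (- b) * (v \<xi>)\<^sup>2" for \<xi>
    \<comment> \<open>\<open>l \<le> L \<xi>\<close> is the condition that |\<xi>| is at least the
      cut-off radius at height \<open>l\<close>, solved for \<open>l\<close>.\<close>
    define L where "L \<xi> = 2 * M * E * norm \<xi> powr (n / (2 * p))" for \<xi> :: "real ^ 'n"
    have [measurable]: "G \<in> borel_measurable borel" "L \<in> borel_measurable borel"
      unfolding G_def L_def by measurable
    have G: "0 \<le> G \<xi>" for \<xi> by (simp add: G_def)
    have L: "0 \<le> L \<xi>" for \<xi> using M(1) E by (simp add: L_def)
    have level: "emeasure lborel {x. l \<le> H x} \<le> ennreal (4 / l\<^sup>2 * N) *
        (\<integral>\<^sup>+\<xi>. (if l \<le> L \<xi> then ennreal (G \<xi>) else 0) \<partial>lborel)" if l: "0 < l" for l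
    proof -
      define A where "A = (l / (2 * M * E)) powr (2 * p / n)"
      have A: "0 < A" using l M(1) E by (simp add: A_def)
      have A_pow: "A powr (n / (2 * p)) = l / (2 * M * E)"
        using l M(1) E p n by (simp add: A_def powr_powr)
      obtain h where h: "h \<in> Lp 2" "bessel_pot a (mul (indicator (ball 0 A)) w) = abs_l2 h"
        "\<And>x. cmod (h x) \<le> M * A powr (n / (2 * p)) * norm w"
        using M(2)[OF A, of w] by blast
      have h_le: "cmod (h x) \<le> l / 2" for x
        using h(3)[of x] M(1) E by (simp add: A_pow E_def[symmetric])
      define z where "z = bessel_pot a (mul (indicator (- ball 0 A)) w)"
      have "mul (indicator (ball 0 A)) w + mul (indicator (- ball 0 A)) w
          = abs_l2 (\<lambda>x. indicator (ball 0 A) x * rep_l2 w x + indicator (- ball 0 A) x * rep_l2 w x)"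
        unfolding mul_def
        by (intro abs_l2_add bounded_multiplier_Lp_2[OF ball_multiplier] bounded_multiplier_Lp_2[OF compl_ball_multiplier] rep_l2_Lp)
      also have "(\<lambda>x. indicator (ball 0 A) x * rep_l2 w x + indicator (- ball 0 A) x * rep_l2 w x) = rep_l2 w"
        by (rule ext) (simp add: indicator_def)
      finally have "u = abs_l2 h + z"
        unfolding u_def z_def h(2)[symmetric]
        by (simp add: linear_add[OF bounded_linear.linear[OF bounded_linear_bessel_pot[OF a(1)]], symmetric])
      also have "abs_l2 h + z = abs_l2 (\<lambda>x. h x + rep_l2 z x)"
        using abs_l2_add[OF h(1) rep_l2_Lp[of z]] by simp
      finally have "AE x in lebesgue. rep_l2 u x = h x + rep_l2 z x"
        using rep_abs_l2[OF Lp_2_add[OF h(1) rep_l2_Lp[of z]]] by simp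
      then have "AE x in lebesgue. ennreal ((l / 2)\<^sup>2) * indicator {x. l \<le> H x} x \<le> ennreal ((cmod (rep_l2 z x))\<^sup>2)"
        using AE_completion[OF H]
      proof eventually_elim
        case (elim x)
        show ?case
        proof (cases "l \<le> H x")
          case True
          then have "l / 2 \<le> cmod (rep_l2 z x)"
            using elim h_le[of x] norm_triangle_ineq[of "h x" "rep_l2 z x"] by simp
          then have "(l / 2)\<^sup>2 \<le> (cmod (rep_l2 z x))\<^sup>2" using l by (intro power_mono) auto
          then show ?thesis using True by (simp add: ennreal_leI)
        qed simp
      qed
      then have "(\<integral>\<^sup>+x. ennreal ((l / 2)\<^sup>2) * indicator {x. l \<le> H x} x \<partial>lebesgue)
          \<le> (\<integral>\<^sup>+x. ennreal ((cmod (rep_l2 z x))\<^sup>2) \<partial>lebesgue)"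
        by (rule nn_integral_mono_AE)
      also have "(\<integral>\<^sup>+x. ennreal ((l / 2)\<^sup>2) * indicator {x. l \<le> H x} x \<partial>lebesgue)
          = ennreal ((l / 2)\<^sup>2) * emeasure lborel {x. l \<le> H x}"
        unfolding nn_integral_completion by (rule nn_integral_cmult_indicator) measurable
      also have "(\<integral>\<^sup>+x. ennreal ((cmod (rep_l2 z x))\<^sup>2) \<partial>lebesgue) = ennreal ((norm z)\<^sup>2)"
        using nn_integral_abs_l2[of "rep_l2 z"] by simp
      also have "\<dots> \<le> ennreal N * (\<integral>\<^sup>+\<xi>. indicator (- ball 0 A) \<xi> * ennreal (G \<xi>) \<partial>lborel)"
        unfolding z_def N_def G_def using v b a by (intro high_frequency_bound) auto
      also have "\<dots> \<le> ennreal N * (\<integral>\<^sup>+\<xi>. (if l \<le> L \<xi> then ennreal (G \<xi>) else 0) \<partial>lborel)"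
      proof (intro mult_left_mono nn_integral_mono)
        fix \<xi> :: "real ^ 'n"
        show "indicator (- ball 0 A) \<xi> * ennreal (G \<xi>) \<le> (if l \<le> L \<xi> then ennreal (G \<xi>) else 0)"
        proof (cases "A \<le> norm \<xi>")
          case True
          then have "A powr (n / (2 * p)) \<le> norm \<xi> powr (n / (2 * p))"
            using A n p by (intro powr_mono2) auto
          then have "2 * M * E * (l / (2 * M * E)) \<le> L \<xi>"
            unfolding A_pow L_def using M(1) E by (intro mult_left_mono) auto
          then have "l \<le> L \<xi>" using M(1) E by simp
          then show ?thesis using True by simp
        qed simp
      qed simp
      finally have le: "ennreal ((l / 2)\<^sup>2) * emeasure lborel {x. l \<le> H x}
          \<le> ennreal N * (\<integral>\<^sup>+\<xi>. (if l \<le> L \<xi> then ennreal (G \<xi>) else 0) \<partial>lborel)" .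
      have one: "ennreal (4 / l\<^sup>2) * ennreal ((l / 2)\<^sup>2) = 1"
        using l by (simp add: ennreal_mult[symmetric] power2_eq_square)
      have "emeasure lborel {x. l \<le> H x} = ennreal (4 / l\<^sup>2) * (ennreal ((l / 2)\<^sup>2) * emeasure lborel {x. l \<le> H x})"
        unfolding mult.assoc[symmetric] one by simp
      also have "\<dots> \<le> ennreal (4 / l\<^sup>2) * (ennreal N * (\<integral>\<^sup>+\<xi>. (if l \<le> L \<xi> then ennreal (G \<xi>) else 0) \<partial>lborel))"
        by (intro mult_left_mono le) simp
      finally show ?thesis
        using N by (subst ennreal_mult) (simp_all add: mult.assoc)
    qed
    have "(\<integral>\<^sup>+x. ennreal (cmod (rep_l2 u x) powr (2 * p)) \<partial>lebesgue) = (\<integral>\<^sup>+x. ennreal (H x powr (2 * p)) \<partial>lborel)"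
      unfolding nn_integral_completion using H by (intro nn_integral_cong_AE) auto
    also have "\<dots> = (\<integral>\<^sup>+x. (\<integral>\<^sup>+l. (if 0 \<le> l \<and> l \<le> H x then ennreal (2 * p * l powr (2 * p - 1)) else 0) \<partial>lborel) \<partial>lborel)"
    proof (rule nn_integral_cong_AE)
      show "AE x in lborel. ennreal (H x powr (2 * p))
          = (\<integral>\<^sup>+l. (if 0 \<le> l \<and> l \<le> H x then ennreal (2 * p * l powr (2 * p - 1)) else 0) \<partial>lborel)"
        using H
      proof eventually_elim
        case (elim x)
        have Hx: "0 \<le> H x" using elim[symmetric] by simp
        have "(\<integral>\<^sup>+l. (if 0 \<le> l \<and> l \<le> H x then ennreal (2 * p * l powr (2 * p - 1)) else 0) \<partial>lborel)
            = (\<integral>\<^sup>+l. ennreal (2 * p) * (ennreal (l powr (2 * p - 1)) * indicator {0..H x} l) \<partial>lborel)"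
          using p by (intro nn_integral_cong) (auto simp: ennreal_mult)
        also have "\<dots> = ennreal (2 * p) * ennreal (H x powr (2 * p) / (2 * p))"
          using p Hx by (subst nn_integral_cmult) (auto simp: nn_integral_powr_interval)
        also have "\<dots> = ennreal (H x powr (2 * p))"
          using p by (simp add: ennreal_mult[symmetric])
        finally show ?case by simp
      qed
    qed
    also have "\<dots> = (\<integral>\<^sup>+l. (\<integral>\<^sup>+x. (if 0 \<le> l \<and> l \<le> H x then ennreal (2 * p * l powr (2 * p - 1)) else 0) \<partial>lborel) \<partial>lborel)"
      by (rule lborel_pair.Fubini') measurable
    also have "\<dots> \<le> (\<integral>\<^sup>+l. (\<integral>\<^sup>+\<xi>. (if 0 \<le> l \<and> l \<le> L \<xi> then ennreal (8 * p * N * l powr (2 * p - 3) * G \<xi>) else 0) \<partial>lborel) \<partial>lborel)"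
    proof (rule nn_integral_mono)
      fix l :: real
      show "(\<integral>\<^sup>+x. (if 0 \<le> l \<and> l \<le> H x then ennreal (2 * p * l powr (2 * p - 1)) else 0) \<partial>lborel)
          \<le> (\<integral>\<^sup>+\<xi>. (if 0 \<le> l \<and> l \<le> L \<xi> then ennreal (8 * p * N * l powr (2 * p - 3) * G \<xi>) else 0) \<partial>lborel)"
      proof (cases "0 < l")
        case True
        have "(\<integral>\<^sup>+x. (if 0 \<le> l \<and> l \<le> H x then ennreal (2 * p * l powr (2 * p - 1)) else 0) \<partial>lborel)
            = (\<integral>\<^sup>+x. ennreal (2 * p * l powr (2 * p - 1)) * indicator {x. l \<le> H x} x \<partial>lborel)"
          using True by (intro nn_integral_cong) auto
        also have "\<dots> = ennreal (2 * p * l powr (2 * p - 1)) * emeasure lborel {x. l \<le> H x}"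
          by (rule nn_integral_cmult_indicator) measurable
        also have "\<dots> \<le> ennreal (2 * p * l powr (2 * p - 1)) * (ennreal (4 / l\<^sup>2 * N) *
            (\<integral>\<^sup>+\<xi>. (if l \<le> L \<xi> then ennreal (G \<xi>) else 0) \<partial>lborel))"
          by (intro mult_left_mono level True) simp
        also have "\<dots> = ennreal (8 * p * N * l powr (2 * p - 3)) * (\<integral>\<^sup>+\<xi>. (if l \<le> L \<xi> then ennreal (G \<xi>) else 0) \<partial>lborel)"
        proof -
          have "l powr (2 * p - 1) = l powr (2 * p - 3) * l powr 2"
            by (simp add: powr_add[symmetric])
          then have "2 * p * l powr (2 * p - 1) * (4 / l\<^sup>2 * N) = 8 * p * N * l powr (2 * p - 3)"
            using True by simp
          then show ?thesis
            using p N by (subst mult.assoc[symmetric], subst ennreal_mult[symmetric]) auto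
        qed
        also have "\<dots> = (\<integral>\<^sup>+\<xi>. ennreal (8 * p * N * l powr (2 * p - 3)) * (if l \<le> L \<xi> then ennreal (G \<xi>) else 0) \<partial>lborel)"
          by (rule nn_integral_cmult[symmetric]) measurable
        also have "\<dots> = (\<integral>\<^sup>+\<xi>. (if 0 \<le> l \<and> l \<le> L \<xi> then ennreal (8 * p * N * l powr (2 * p - 3) * G \<xi>) else 0) \<partial>lborel)"
          using True p N G by (intro nn_integral_cong) (auto simp: ennreal_mult)
        finally show ?thesis .
      next
        case False
        then have "(\<lambda>x. (if 0 \<le> l \<and> l \<le> H x then ennreal (2 * p * l powr (2 * p - 1)) else 0)) = (\<lambda>x. 0)"
          by auto
        then show ?thesis by (simp only: nn_integral_const) simp
      qed
    qed
    \<comment> \<open>With the frequency fixed, \<open>l\<close> runs from 0 to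
      \<open>L \<xi>\<close>, and \<open>l powr (2 * p - 3)\<close> is integrable at 0 because
      \<open>p > 1\<close>.\<close>
    also have "\<dots> = (\<integral>\<^sup>+\<xi>. (\<integral>\<^sup>+l. (if 0 \<le> l \<and> l \<le> L \<xi> then ennreal (8 * p * N * l powr (2 * p - 3) * G \<xi>) else 0) \<partial>lborel) \<partial>lborel)"
      by (rule lborel_pair.Fubini') measurable
    also have "\<dots> \<le> (\<integral>\<^sup>+\<xi>. ennreal (C * E powr (2 * p - 2)) * ennreal ((v \<xi>)\<^sup>2) \<partial>lborel)"
    proof (rule nn_integral_mono)
      fix \<xi> :: "real ^ 'n"
      have "(\<integral>\<^sup>+l. (if 0 \<le> l \<and> l \<le> L \<xi> then ennreal (8 * p * N * l powr (2 * p - 3) * G \<xi>) else 0) \<partial>lborel)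
          = (\<integral>\<^sup>+l. ennreal (8 * p * N * G \<xi>) * (ennreal (l powr ((2 * p - 2) - 1)) * indicator {0..L \<xi>} l) \<partial>lborel)"
        using p N G by (intro nn_integral_cong) (auto simp: ennreal_mult[symmetric] mult_ac)
      also have "\<dots> = ennreal (8 * p * N * G \<xi>) * ennreal (L \<xi> powr (2 * p - 2) / (2 * p - 2))"
        using nn_integral_powr_interval[of "2 * p - 2" "L \<xi>"] p L[of \<xi>]
        by (subst nn_integral_cmult) simp_all
      also have "\<dots> = ennreal (8 * p * N * G \<xi> * (L \<xi> powr (2 * p - 2) / (2 * p - 2)))"
        using p N G by (intro ennreal_mult[symmetric]) auto
      also have "\<dots> \<le> ennreal (C * E powr (2 * p - 2) * (v \<xi>)\<^sup>2)"
      proof (rule ennreal_leI)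
        have "(norm \<xi> powr (n / (2 * p))) powr (2 * p - 2) = norm \<xi> powr b"
          unfolding powr_powr exps(2) ..
        then have "L \<xi> powr (2 * p - 2) = (2 * M) powr (2 * p - 2) * E powr (2 * p - 2) * norm \<xi> powr b"
          using M(1) E by (simp add: L_def powr_mult)
        then have "8 * p * N * G \<xi> * (L \<xi> powr (2 * p - 2) / (2 * p - 2))
            = C * E powr (2 * p - 2) * (v \<xi>)\<^sup>2 * (norm \<xi> powr (- b) * norm \<xi> powr b)"
          by (simp add: C_def G_def mult_ac)
        \<comment> \<open>The two powers of |\<xi>| cancel except at \<xi> = 0, where their product
          is 0; hence only an inequality.\<close>
        also have "\<dots> \<le> C * E powr (2 * p - 2) * (v \<xi>)\<^sup>2 * 1"
          using C E by (intro mult_left_mono) (simp_all add: powr_add[symmetric])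
        finally show "8 * p * N * G \<xi> * (L \<xi> powr (2 * p - 2) / (2 * p - 2)) \<le> C * E powr (2 * p - 2) * (v \<xi>)\<^sup>2"
          by simp
      qed
      also have "\<dots> = ennreal (C * E powr (2 * p - 2)) * ennreal ((v \<xi>)\<^sup>2)"
        using C by (intro ennreal_mult) auto
      finally show "(\<integral>\<^sup>+l. (if 0 \<le> l \<and> l \<le> L \<xi> then ennreal (8 * p * N * l powr (2 * p - 3) * G \<xi>) else 0) \<partial>lborel)
          \<le> ennreal (C * E powr (2 * p - 2)) * ennreal ((v \<xi>)\<^sup>2)" .
    qed
    also have "\<dots> = ennreal (C * E powr (2 * p - 2)) * (\<integral>\<^sup>+\<xi>. ennreal ((v \<xi>)\<^sup>2) \<partial>lborel)"
      by (rule nn_integral_cmult) measurable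
    also have "(\<integral>\<^sup>+\<xi>. ennreal ((v \<xi>)\<^sup>2) \<partial>lborel) = (\<integral>\<^sup>+\<xi>. ennreal ((cmod (rep_l2 w \<xi>))\<^sup>2) \<partial>lebesgue)"
      unfolding nn_integral_completion using v by (intro nn_integral_cong_AE) auto
    also have "\<dots> = ennreal (E\<^sup>2)"
      using nn_integral_abs_l2[of "rep_l2 w"] by (simp add: E_def)
    also have "ennreal (C * E powr (2 * p - 2)) * ennreal (E\<^sup>2) = ennreal (C * norm w powr (2 * p))"
    proof -
      have "E powr (2 * p) = E powr (2 * p - 2) * E powr 2" by (simp add: powr_add[symmetric])
      then have "E powr (2 * p) = E powr (2 * p - 2) * E\<^sup>2" using E by simp
      then show ?thesis
        using C by (simp add: ennreal_mult[symmetric] E_def mult.assoc)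
    qed
    finally show ?thesis unfolding u_def .
  qed
  show ?thesis
  proof (rule that[OF C])
    fix w :: "'n l2"
    show "(\<integral>\<^sup>+x. ennreal (cmod (rep_l2 (bessel_pot a w) x) powr (2 * p)) \<partial>lebesgue) \<le> ennreal (C * norm w powr (2 * p))"
    \<comment> \<open>The cut-off radius involves division by \<open>norm w\<close>.\<close>
    proof (cases "w = 0")
      case True
      then have "bessel_pot a w = 0"
        by (simp add: linear_0[OF bounded_linear.linear[OF bounded_linear_bessel_pot[OF a(1)]]])
      then have "AE x in lebesgue. rep_l2 (bessel_pot a w) x = 0"
        using rep_abs_l2[OF Lp_2_zero] by (simp add: abs_l2_zero)
      then have "AE x in lebesgue. ennreal (cmod (rep_l2 (bessel_pot a w) x) powr (2 * p)) = 0"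
        by eventually_elim simp
      then have "(\<integral>\<^sup>+x. ennreal (cmod (rep_l2 (bessel_pot a w) x) powr (2 * p)) \<partial>lebesgue) = (\<integral>\<^sup>+x. 0 \<partial>(lebesgue :: (real ^ 'n) measure))"
        by (rule nn_integral_cong_AE)
      then show ?thesis by simp
    qed (rule main)
  qed
qed

section \<open>The kernels\<close>

text \<open>The terms with \<open>q\<close> cancel in the derivative of the energy, leaving
  \<open>- 2 * d\<close> times the squared velocity.\<close>

lemma damped_oscillator_energy:
  fixes y z :: "real \<Rightarrow> complex" and d q :: real
  assumes y: "\<And>t. (y has_vector_derivative z t) (at t)"
    and z: "\<And>t. (z has_vector_derivative - (d *\<^sub>R z t) - q *\<^sub>R y t) (at t)"
    and "0 \<le> d" "0 \<le> t"
  shows "(cmod (z t))\<^sup>2 + q * (cmod (y t))\<^sup>2 \<le> (cmod (z 0))\<^sup>2 + q * (cmod (y 0))\<^sup>2"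
proof -
  define e where "e t = z t \<bullet> z t + q * (y t \<bullet> y t)" for t
  have ex: "\<exists>D. (e has_real_derivative D) (at s) \<and> D \<le> 0" for s
  proof (intro exI conjI)
    note inner = bounded_bilinear.has_vector_derivative[OF bounded_bilinear_inner]
    have "(e has_vector_derivative (z s \<bullet> (- (d *\<^sub>R z s) - q *\<^sub>R y s) + (- (d *\<^sub>R z s) - q *\<^sub>R y s) \<bullet> z s)
        + q * (y s \<bullet> z s + z s \<bullet> y s)) (at s)"
      unfolding e_def[abs_def]
      by (rule has_vector_derivative_add[OF inner[OF z z] has_vector_derivative_mult_right[OF inner[OF y y]]])
    moreover have "(z s \<bullet> (- (d *\<^sub>R z s) - q *\<^sub>R y s) + (- (d *\<^sub>R z s) - q *\<^sub>R y s) \<bullet> z s)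
        + q * (y s \<bullet> z s + z s \<bullet> y s) = - 2 * d * (z s \<bullet> z s)"
      unfolding inner_diff_right inner_diff_left inner_minus_left inner_minus_right inner_scaleR_left
        inner_scaleR_right inner_commute[of "y s" "z s"] by (simp add: distrib_left)
    ultimately show "(e has_real_derivative (- 2 * d * (z s \<bullet> z s))) (at s)"
      unfolding has_real_derivative_iff_has_vector_derivative by (simp only:)
    show "- 2 * d * (z s \<bullet> z s) \<le> 0" using assms(3) by (simp add: mult_nonpos_nonneg)
  qed
  have "e t \<le> e 0"
    by (rule DERIV_nonpos_imp_nonincreasing[OF assms(4)]) (rule ex)
  then show ?thesis by (simp add: e_def power2_norm_eq_inner)
qed

text \<open>The symbols with the two roots as parameters and a complex time, so that ordinary field
  derivatives apply before restriction to real times.\<close>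

definition kern0 :: "complex \<Rightarrow> complex \<Rightarrow> complex \<Rightarrow> complex" where
  "kern0 l1 l2 z = (if l1 = l2 then (1 - l1 * z) * exp (l1 * z)
     else (l1 * exp (l2 * z) - l2 * exp (l1 * z)) / (l1 - l2))"

definition kern1 :: "complex \<Rightarrow> complex \<Rightarrow> complex \<Rightarrow> complex" where
  "kern1 l1 l2 z = (if l1 = l2 then z * exp (l1 * z) else (exp (l1 * z) - exp (l2 * z)) / (l1 - l2))"

text \<open>Together with \<open>kern1_deriv\<close> this is a closed first-order system whose
  coefficients are the sum and product of the roots. Beyond this point distinct and double roots
  need no separate treatment.\<close>

lemma kern0_deriv: "(kern0 l1 l2 has_field_derivative - (l1 * l2) * kern1 l1 l2 z) (at z)"
proof (cases "l1 = l2")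
  case True
  then show ?thesis unfolding kern0_def[abs_def] kern1_def
    by (auto intro!: derivative_eq_intros simp: algebra_simps)
next
  case False
  then show ?thesis unfolding kern0_def[abs_def] kern1_def
    by (auto intro!: derivative_eq_intros simp: divide_simps) (simp add: algebra_simps)
qed

lemma kern1_deriv: "(kern1 l1 l2 has_field_derivative kern0 l1 l2 z + (l1 + l2) * kern1 l1 l2 z) (at z)"
proof (cases "l1 = l2")
  case True
  then show ?thesis unfolding kern1_def[abs_def] kern0_def
    by (auto intro!: derivative_eq_intros simp: algebra_simps)
next
  case False
  then show ?thesis unfolding kern1_def[abs_def] kern0_def
    by (auto intro!: derivative_eq_intros simp: divide_simps) (simp add: algebra_simps)
qed

text \<open>\<open>kern1\<close> starts with value 0 and velocity 1, so its energy is at most 1.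
  This bounds the velocity and the second quantity directly, and the bound by \<open>t\<close>
  follows from the mean value inequality. \<open>kern0\<close> starts with value 1 and velocity
  0.\<close>

lemma kern_bounds:
  fixes d q :: real
  assumes sum: "l1 + l2 = - of_real d" and prod: "l1 * l2 = of_real q" and "0 \<le> d" "0 \<le> q" "0 \<le> t"
  shows "cmod (kern1 l1 l2 (of_real t)) \<le> t"
    and "sqrt q * cmod (kern1 l1 l2 (of_real t)) \<le> 1"
    and "0 < q \<Longrightarrow> cmod (kern0 l1 l2 (of_real t)) \<le> 1"
proof -
  define y0 where "y0 s = kern0 l1 l2 (of_real s)" for s :: real
  define y1 where "y1 s = kern1 l1 l2 (of_real s)" for s :: real
  have d0: "(y0 has_vector_derivative - (q *\<^sub>R y1 s)) (at s)" for s
    using has_vector_derivative_real_field[OF kern0_deriv[of l1 l2 "of_real s"]]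
    by (simp add: y0_def[abs_def] y1_def prod scaleR_conv_of_real)
  \<comment> \<open>The velocity of \<open>y1\<close>, by \<open>kern1_deriv\<close>.\<close>
  define z1 where "z1 s = y0 s - d *\<^sub>R y1 s" for s
  have d1: "(y1 has_vector_derivative z1 s) (at s)" for s
    using has_vector_derivative_real_field[OF kern1_deriv[of l1 l2 "of_real s"]]
    by (simp add: y0_def y1_def[abs_def] z1_def sum scaleR_conv_of_real)
  have dz1: "(z1 has_vector_derivative - (d *\<^sub>R z1 s) - q *\<^sub>R y1 s) (at s)" for s
  proof -
    have "(z1 has_vector_derivative - (q *\<^sub>R y1 s) - d *\<^sub>R z1 s) (at s)"
      unfolding z1_def[abs_def]
      by (intro has_vector_derivative_diff d0
          bounded_linear.has_vector_derivative[OF bounded_linear_scaleR_right d1[unfolded z1_def]])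
    moreover have "- (q *\<^sub>R y1 s) - d *\<^sub>R z1 s = - (d *\<^sub>R z1 s) - q *\<^sub>R y1 s" by simp
    ultimately show ?thesis by (simp only:)
  qed
  have init: "y0 0 = 1" "y1 0 = 0" "z1 0 = 1"
    by (auto simp: y0_def y1_def z1_def kern0_def kern1_def)
  have E1: "(cmod (z1 s))\<^sup>2 + q * (cmod (y1 s))\<^sup>2 \<le> 1" if "0 \<le> s" for s
    using damped_oscillator_energy[OF d1 dz1 assms(3) that] by (simp add: init)
  have z1_le: "cmod (z1 s) \<le> 1" if "0 \<le> s" for s
  proof (rule power2_le_imp_le)
    have "0 \<le> q * (cmod (y1 s))\<^sup>2" using assms(4) by simp
    then show "(cmod (z1 s))\<^sup>2 \<le> 1\<^sup>2" using E1[OF that] by (simp only: one_power2)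
  qed simp
  show "cmod (kern1 l1 l2 (of_real t)) \<le> t"
  proof -
    have "norm (y1 t - y1 0) \<le> 1 * norm (t - 0)"
    proof (rule differentiable_bound[where S="{0..t}" and f'="\<lambda>s h. h *\<^sub>R z1 s"])
      fix s assume s: "s \<in> {0..t}"
      show "(y1 has_derivative (\<lambda>h. h *\<^sub>R z1 s)) (at s within {0..t})"
        using d1[of s] by (simp add: has_vector_derivative_def has_derivative_at_withinI)
      have "onorm (\<lambda>h. h *\<^sub>R z1 s) \<le> cmod (z1 s)"
        by (rule onorm_le) simp
      then show "onorm (\<lambda>h. h *\<^sub>R z1 s) \<le> 1" using z1_le[of s] s by simp
    qed (use assms(5) in auto)
    then show ?thesis using assms(5) unfolding init by (simp add: y1_def)
  qed
  show "sqrt q * cmod (kern1 l1 l2 (of_real t)) \<le> 1"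
  proof (rule power2_le_imp_le)
    show "(sqrt q * cmod (kern1 l1 l2 (of_real t)))\<^sup>2 \<le> 1\<^sup>2"
      using order_trans[OF le_add_same_cancel2[THEN iffD2, OF zero_le_power2] E1[OF assms(5)]] assms(4)
      by (simp add: y1_def power_mult_distrib)
  qed simp
  \<comment> \<open>The energy of \<open>kern0\<close> starts at \<open>q\<close> and controls
    \<open>q\<close> times the squared modulus, so \<open>q\<close> has to be cancelled.\<close>
  assume q: "0 < q"
  have dz0: "((\<lambda>s. - (q *\<^sub>R y1 s)) has_vector_derivative - (d *\<^sub>R (- (q *\<^sub>R y1 s))) - q *\<^sub>R y0 s) (at s)" for s
  proof -
    have "((\<lambda>s. - (q *\<^sub>R y1 s)) has_vector_derivative - (q *\<^sub>R z1 s)) (at s)"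
      by (intro has_vector_derivative_minus bounded_linear.has_vector_derivative[OF bounded_linear_scaleR_right d1])
    then show ?thesis by (simp add: z1_def algebra_simps)
  qed
  have "(cmod (- (q *\<^sub>R y1 t)))\<^sup>2 + q * (cmod (y0 t))\<^sup>2 \<le> (cmod (- (q *\<^sub>R y1 0)))\<^sup>2 + q * (cmod (y0 0))\<^sup>2"
    by (rule damped_oscillator_energy[OF d0 dz0 assms(3) assms(5)])
  from order_trans[OF le_add_same_cancel2[THEN iffD2, OF zero_le_power2] this]
  have "q * (cmod (y0 t))\<^sup>2 \<le> q * 1" by (simp add: init)
  then have "(cmod (y0 t))\<^sup>2 \<le> 1\<^sup>2" using q by simp
  then have "cmod (y0 t) \<le> 1" by (rule power2_le_imp_le) simp
  then show "cmod (kern0 l1 l2 (of_real t)) \<le> 1" by (simp add: y0_def)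
qed

section \<open>The kernels of the equation as Fourier multipliers\<close>

lemma K0_hat_kern0: "K0_hat \<sigma> \<sigma>1 \<sigma>2 t \<xi> = kern0 (lam1 \<sigma> \<sigma>1 \<sigma>2 \<xi>) (lam2 \<sigma> \<sigma>1 \<sigma>2 \<xi>) (of_real t)"
  by (simp add: K0_hat_def kern0_def Let_def)

lemma K1_hat_kern1: "K1_hat \<sigma> \<sigma>1 \<sigma>2 t \<xi> = kern1 (lam1 \<sigma> \<sigma>1 \<sigma>2 \<xi>) (lam2 \<sigma> \<sigma>1 \<sigma>2 \<xi>) (of_real t)"
  by (simp add: K1_hat_def kern1_def Let_def)

lemma lam_sum_prod:
  "lam1 \<sigma> \<sigma>1 \<sigma>2 \<xi> + lam2 \<sigma> \<sigma>1 \<sigma>2 \<xi> = - of_real (damping \<sigma>1 \<sigma>2 \<xi>)"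
  "lam1 \<sigma> \<sigma>1 \<sigma>2 \<xi> * lam2 \<sigma> \<sigma>1 \<sigma>2 \<xi> = of_real (norm \<xi> powr (2 * \<sigma>))"
proof -
  let ?d = "complex_of_real (damping \<sigma>1 \<sigma>2 \<xi>)" and ?r = "disc_root \<sigma> \<sigma>1 \<sigma>2 \<xi>"
  show "lam1 \<sigma> \<sigma>1 \<sigma>2 \<xi> + lam2 \<sigma> \<sigma>1 \<sigma>2 \<xi> = - ?d"
    by (simp add: lam1_def lam2_def field_simps)
  have r2: "?r\<^sup>2 = ?d\<^sup>2 - 4 * of_real (norm \<xi> powr (2 * \<sigma>))"
    by (simp add: disc_root_def)
  have "lam1 \<sigma> \<sigma>1 \<sigma>2 \<xi> * lam2 \<sigma> \<sigma>1 \<sigma>2 \<xi> = (?d\<^sup>2 - ?r\<^sup>2) / 4"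
    by (simp add: lam1_def lam2_def power2_eq_square algebra_simps)
  then show "lam1 \<sigma> \<sigma>1 \<sigma>2 \<xi> * lam2 \<sigma> \<sigma>1 \<sigma>2 \<xi> = of_real (norm \<xi> powr (2 * \<sigma>))"
    unfolding r2 by simp
qed

lemma K_hat_bounds:
  assumes t: "0 \<le> t"
  shows "cmod (K1_hat \<sigma> \<sigma>1 \<sigma>2 t \<xi>) \<le> t"
    and "norm \<xi> powr \<sigma> * cmod (K1_hat \<sigma> \<sigma>1 \<sigma>2 t \<xi>) \<le> 1"
    and "cmod (K0_hat \<sigma> \<sigma>1 \<sigma>2 t \<xi>) \<le> 1"
proof -
  have "0 \<le> damping \<sigma>1 \<sigma>2 \<xi>" "0 \<le> norm \<xi> powr (2 * \<sigma>)" by (simp_all add: damping_def)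
  note * = kern_bounds[OF lam_sum_prod[of \<sigma> \<sigma>1 \<sigma>2 \<xi>] this t]
  show "cmod (K1_hat \<sigma> \<sigma>1 \<sigma>2 t \<xi>) \<le> t" unfolding K1_hat_kern1 by (rule *)
  have "sqrt (norm \<xi> powr (2 * \<sigma>)) = norm \<xi> powr \<sigma>"
    by (subst powr_half_sqrt[symmetric]) (simp_all add: powr_powr)
  then show "norm \<xi> powr \<sigma> * cmod (K1_hat \<sigma> \<sigma>1 \<sigma>2 t \<xi>) \<le> 1"
    unfolding K1_hat_kern1 using *(2) by simp
  show "cmod (K0_hat \<sigma> \<sigma>1 \<sigma>2 t \<xi>) \<le> 1"
  \<comment> \<open>The product of the roots vanishes only at the origin. There both roots are 0,
    also for \<open>\<sigma>1 = 0\<close> since \<open>0 powr 0 = 0\<close>, and the symbol equals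
    1.\<close>
  proof (cases "\<xi> = 0")
    case True
    then have "lam1 \<sigma> \<sigma>1 \<sigma>2 \<xi> = 0" "lam2 \<sigma> \<sigma>1 \<sigma>2 \<xi> = 0"
      by (simp_all add: lam1_def lam2_def disc_root_def damping_def)
    then show ?thesis by (simp add: K0_hat_kern0 kern0_def)
  next
    case False
    then show ?thesis unfolding K0_hat_kern0 by (intro *(3)) simp
  qed
qed

lemma K_hat_continuous:
  "continuous_on UNIV (\<lambda>t. K0_hat \<sigma> \<sigma>1 \<sigma>2 t \<xi>)" "continuous_on UNIV (\<lambda>t. K1_hat \<sigma> \<sigma>1 \<sigma>2 t \<xi>)"
proof -
  have of_real: "continuous_on UNIV (complex_of_real)" by (intro continuous_intros)
  have c: "continuous_on UNIV (kern0 l1 l2)" "continuous_on UNIV (kern1 l1 l2)" for l1 l2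
    using kern0_deriv kern1_deriv by (meson DERIV_isCont continuous_at_imp_continuous_on)+
  show "continuous_on UNIV (\<lambda>t. K0_hat \<sigma> \<sigma>1 \<sigma>2 t \<xi>)" "continuous_on UNIV (\<lambda>t. K1_hat \<sigma> \<sigma>1 \<sigma>2 t \<xi>)"
    unfolding K0_hat_kern0 K1_hat_kern1
    by (rule continuous_on_compose2[OF c(1) of_real subset_UNIV] continuous_on_compose2[OF c(2) of_real subset_UNIV])+
qed

text \<open>\<open>csqrt\<close> jumps across the negative real axis, where the discriminant may
  lie. Along the real line it is given by two explicit continuous branches.\<close>

lemma measurable_csqrt_of_real [measurable]:
  "(\<lambda>x. csqrt (complex_of_real x)) \<in> borel_measurable borel"
proof -
  have "(\<lambda>x. csqrt (complex_of_real x)) = (\<lambda>x. if 0 \<le> x then of_real (sqrt x) else \<i> * of_real (sqrt (- x)))"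
    by (rule ext) (auto simp: csqrt_of_real_nonneg csqrt_of_real_nonpos)
  also have "\<dots> \<in> borel_measurable borel" by measurable
  finally show ?thesis .
qed

lemma K_hat_measurable:
  "K0_hat \<sigma> \<sigma>1 \<sigma>2 t \<in> borel_measurable lebesgue" "K1_hat \<sigma> \<sigma>1 \<sigma>2 t \<in> borel_measurable lebesgue"
proof -
  have [measurable]: "damping \<sigma>1 \<sigma>2 \<in> borel_measurable (borel :: (real ^ 'n) measure)"
    unfolding damping_def by measurable
  have [measurable]: "disc_root \<sigma> \<sigma>1 \<sigma>2 \<in> borel_measurable (borel :: (real ^ 'n) measure)"
    unfolding disc_root_def by measurable
  have [measurable]: "lam1 \<sigma> \<sigma>1 \<sigma>2 \<in> borel_measurable (borel :: (real ^ 'n) measure)"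
      "lam2 \<sigma> \<sigma>1 \<sigma>2 \<in> borel_measurable (borel :: (real ^ 'n) measure)"
    unfolding lam1_def lam2_def by measurable
  show "K0_hat \<sigma> \<sigma>1 \<sigma>2 t \<in> borel_measurable (lebesgue :: (real ^ 'n) measure)"
    "K1_hat \<sigma> \<sigma>1 \<sigma>2 t \<in> borel_measurable (lebesgue :: (real ^ 'n) measure)"
    unfolding K0_hat_def K1_hat_def Let_def by (intro measurable_completion; measurable)+
qed

lemma K0_hat_multiplier: "0 \<le> t \<Longrightarrow> bounded_multiplier (K0_hat \<sigma> \<sigma>1 \<sigma>2 t) 1"
  by (simp add: bounded_multiplier_def K_hat_measurable K_hat_bounds)

lemma K1_hat_multiplier: "0 \<le> t \<Longrightarrow> bounded_multiplier (K1_hat \<sigma> \<sigma>1 \<sigma>2 t) t"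
  by (simp add: bounded_multiplier_def K_hat_measurable K_hat_bounds)

text \<open>The operator from the Fourier transform of a source in \<open>L^2\<close> to the
  weighted transform of its contribution to the solution.\<close>

definition K1_weighted :: "real \<Rightarrow> real \<Rightarrow> real \<Rightarrow> real \<Rightarrow> real ^ 'n \<Rightarrow> complex" where
  "K1_weighted \<sigma> \<sigma>1 \<sigma>2 t \<xi> = of_real ((1 + (norm \<xi>)\<^sup>2) powr (\<sigma> / 2)) * K1_hat \<sigma> \<sigma>1 \<sigma>2 t \<xi>"

text \<open>The weight is at most \<open>2 powr (\<sigma> / 2)\<close> times 1 + |\<xi>|^\<sigma>.
  The bound of the symbol by \<open>t\<close> absorbs the first summand, which is where
  \<open>t \<le> 1\<close> is used, and its decay absorbs the second.\<close>

lemma K1_weighted_multiplier: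
  assumes t: "0 \<le> t" "t \<le> 1" and \<sigma>: "0 \<le> \<sigma>"
  shows "bounded_multiplier (K1_weighted \<sigma> \<sigma>1 \<sigma>2 t :: real ^ 'n \<Rightarrow> complex) (2 * 2 powr (\<sigma> / 2))"
proof -
  have "continuous_on UNIV (\<lambda>\<xi> :: real ^ 'n. complex_of_real ((1 + (norm \<xi>)\<^sup>2) powr (\<sigma> / 2)))"
    by (intro continuous_intros) (auto simp: add_nonneg_eq_0_iff)
  then have "K1_weighted \<sigma> \<sigma>1 \<sigma>2 t \<in> borel_measurable (lebesgue :: (real ^ 'n) measure)"
    unfolding K1_weighted_def
    by (intro borel_measurable_times K_hat_measurable measurable_lebesgue_continuous)
  moreover have "cmod (K1_weighted \<sigma> \<sigma>1 \<sigma>2 t \<xi>) \<le> 2 * 2 powr (\<sigma> / 2)" for \<xi> :: "real ^ 'n"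
  proof -
    let ?k = "cmod (K1_hat \<sigma> \<sigma>1 \<sigma>2 t \<xi>)"
    have k: "?k \<le> 1" "norm \<xi> powr \<sigma> * ?k \<le> 1"
      using order_trans[OF K_hat_bounds(1)[OF t(1)] t(2)] K_hat_bounds(2)[OF t(1)] by auto
    have "(1 + (norm \<xi>)\<^sup>2) powr (\<sigma> / 2) \<le> 2 powr (\<sigma> / 2) * (1 + norm \<xi> powr \<sigma>)"
    proof (cases "norm \<xi> \<le> 1")
      case True
      then have "(1 + (norm \<xi>)\<^sup>2) powr (\<sigma> / 2) \<le> 2 powr (\<sigma> / 2)"
        using \<sigma> power_mono[of "norm \<xi>" 1 2] by (intro powr_mono2) auto
      also have "\<dots> \<le> 2 powr (\<sigma> / 2) * (1 + norm \<xi> powr \<sigma>)" by simp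
      finally show ?thesis .
    next
      case False
      then have "(1 + (norm \<xi>)\<^sup>2) powr (\<sigma> / 2) \<le> (2 * (norm \<xi>)\<^sup>2) powr (\<sigma> / 2)"
        using \<sigma> power_mono[of 1 "norm \<xi>" 2] by (intro powr_mono2) auto
      also have "\<dots> = 2 powr (\<sigma> / 2) * ((norm \<xi>)\<^sup>2) powr (\<sigma> / 2)"
        by (simp add: powr_mult)
      also have "((norm \<xi>)\<^sup>2) powr (\<sigma> / 2) = norm \<xi> powr \<sigma>"
        using False by (simp add: powr_powr flip: powr_numeral)
      also have "2 powr (\<sigma> / 2) * norm \<xi> powr \<sigma> \<le> 2 powr (\<sigma> / 2) * (1 + norm \<xi> powr \<sigma>)"
        by simp
      finally show ?thesis .
    qed
    then have "(1 + (norm \<xi>)\<^sup>2) powr (\<sigma> / 2) * ?k \<le> 2 powr (\<sigma> / 2) * (1 + norm \<xi> powr \<sigma>) * ?k"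
      by (rule mult_right_mono) simp
    also have "\<dots> = 2 powr (\<sigma> / 2) * (?k + norm \<xi> powr \<sigma> * ?k)" by (simp add: algebra_simps)
    also have "\<dots> \<le> 2 powr (\<sigma> / 2) * 2" using k by (intro mult_left_mono) auto
    finally show ?thesis by (simp add: K1_weighted_def norm_mult mult.commute)
  qed
  ultimately show ?thesis by (simp add: bounded_multiplier_def)
qed

lemma bessel_inv_K1_weighted: "bessel_inv \<sigma> \<xi> * K1_weighted \<sigma> \<sigma>1 \<sigma>2 t \<xi> = K1_hat \<sigma> \<sigma>1 \<sigma>2 t \<xi>"
  using bessel_weight_inv[of \<xi> \<sigma>] by (simp add: K1_weighted_def mult.assoc[symmetric] mult.commute)

section \<open>Volterra equations in Banach spaces\<close>

text \<open>Continuity of \<open>B\<close> in time is assumed for each fixed \<open>y\<close> only,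
  with a uniform bound on norms; this is what dominated convergence yields for multipliers.\<close>

locale volterra =
  fixes B :: "real \<Rightarrow> 'a::banach \<Rightarrow> 'a" and g :: "'a \<Rightarrow> 'a" and C :: real
  assumes C: "0 \<le> C"
    and B_linear: "\<And>t. 0 \<le> t \<Longrightarrow> t \<le> 1 \<Longrightarrow> bounded_linear (B t)"
    and B_norm: "\<And>t y. 0 \<le> t \<Longrightarrow> t \<le> 1 \<Longrightarrow> norm (B t y) \<le> C * norm y"
    and B_cont: "\<And>y. continuous_on {0..1} (\<lambda>t. B t y)"
    and g_lipschitz: "\<And>R. \<exists>L\<ge>0. \<forall>v w. norm v \<le> R \<longrightarrow> norm w \<le> R \<longrightarrow> norm (g v - g w) \<le> L * norm (v - w)"
begin

text \<open>Linearity and the uniform bound handle the change of \<open>y\<close>, continuity at a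
  fixed vector the change of \<open>t\<close>.\<close>

lemma B_joint_cont: "continuous_on ({0..1} \<times> UNIV) (\<lambda>(t, y). B t y)"
proof -
  have *: "((\<lambda>(t, y). B t y) \<longlongrightarrow> B s x) (at (s, x) within {0..1} \<times> UNIV)" if s: "s \<in> {0..1}" for s x
  proof -
    let ?F = "at (s, x) within {0..1} \<times> (UNIV :: 'a set)"
    have f1: "(fst \<longlongrightarrow> s) ?F" and f2: "(snd \<longlongrightarrow> x) ?F"
      using tendsto_fst[OF tendsto_ident_at] tendsto_snd[OF tendsto_ident_at] by (force+)
    have ev: "eventually (\<lambda>z. fst z \<in> {0..1}) ?F"
      unfolding eventually_at_filter by (rule always_eventually) auto
    have "continuous (at s within {0..1}) (\<lambda>t. B t x)"
      using B_cont s by (auto simp: continuous_on_eq_continuous_within)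
    then have "((\<lambda>z. B (fst z) x) \<longlongrightarrow> B s x) ?F"
      by (rule continuous_within_tendsto_compose[OF _ ev f1])
    then have a: "((\<lambda>z. norm (B (fst z) x - B s x)) \<longlongrightarrow> 0) ?F"
      by (intro tendsto_norm_zero) (simp add: LIM_zero_iff)
    have "((\<lambda>z. norm (snd z - x)) \<longlongrightarrow> 0) ?F"
      using f2 by (intro tendsto_norm_zero) (simp add: LIM_zero_iff)
    then have b: "((\<lambda>z. C * norm (snd z - x)) \<longlongrightarrow> 0) ?F"
      by (rule tendsto_mult_right_zero)
    have "((\<lambda>z. (case z of (t, y) \<Rightarrow> B t y) - B s x) \<longlongrightarrow> 0) ?F"
    proof (rule Lim_null_comparison)
      show "((\<lambda>z. C * norm (snd z - x) + norm (B (fst z) x - B s x)) \<longlongrightarrow> 0) ?F"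
        using tendsto_add[OF b a] by simp
      show "\<forall>\<^sub>F z in ?F. norm ((case z of (t, y) \<Rightarrow> B t y) - B s x)
          \<le> C * norm (snd z - x) + norm (B (fst z) x - B s x)"
        using ev
      proof eventually_elim
        case (elim z)
        obtain t y where z: "z = (t, y)" by (cases z)
        have t: "0 \<le> t" "t \<le> 1" using elim by (auto simp: z)
        have "B t y - B s x = B t (y - x) + (B t x - B s x)"
          by (simp add: linear_diff[OF bounded_linear.linear[OF B_linear[OF t]]])
        then have "norm (B t y - B s x) \<le> norm (B t (y - x)) + norm (B t x - B s x)"
          by (simp only: norm_triangle_ineq)
        then show ?case using B_norm[OF t, of "y - x"] by (simp add: z)
      qed
    qed
    then show ?thesis by (simp add: LIM_zero_iff)
  qed
  then show ?thesis unfolding continuous_on_def by auto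
qed

lemma g_cont: "continuous_on UNIV g"
proof -
  have "(g \<longlongrightarrow> g x) (at x)" for x
  proof -
    obtain L where L: "0 \<le> L" "\<And>v w. norm v \<le> norm x + 1 \<Longrightarrow> norm w \<le> norm x + 1 \<Longrightarrow> norm (g v - g w) \<le> L * norm (v - w)"
      using g_lipschitz[of "norm x + 1"] by blast
    have "((\<lambda>y. g y - g x) \<longlongrightarrow> 0) (at x)"
    proof (rule Lim_null_comparison)
      have "((\<lambda>y. norm (y - x)) \<longlongrightarrow> 0) (at x)"
        using tendsto_norm_zero LIM_zero[OF tendsto_ident_at] by blast
      then show "((\<lambda>y. L * norm (y - x)) \<longlongrightarrow> 0) (at x)"
        by (rule tendsto_mult_right_zero)
      have "\<forall>\<^sub>F y in at x. dist y x < 1" unfolding eventually_at by (intro exI[of _ 1]) auto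
      then show "\<forall>\<^sub>F y in at x. norm (g y - g x) \<le> L * norm (y - x)"
      proof eventually_elim
        case (elim y)
        then have "norm y \<le> norm x + 1"
          using norm_triangle_sub[of y x] by (simp add: dist_norm)
        then show ?case by (intro L) auto
      qed
    qed
    then show ?thesis by (simp add: LIM_zero_iff)
  qed
  then show ?thesis by (simp add: continuous_on_def)
qed

definition V :: "(real \<Rightarrow> 'a) \<Rightarrow> real \<Rightarrow> 'a" where
  "V w t = integral {0..t} (\<lambda>s. B (t - s) (g (w s)))"

lemma integrand_cont:
  assumes "continuous_on {0..t} w" "t \<le> 1"
  shows "continuous_on {0..t} (\<lambda>s. B (t - s) (g (w s)))"
proof -
  have "continuous_on {0..t} (\<lambda>s. (t - s, g (w s)))"
    by (intro continuous_intros continuous_on_compose2[OF g_cont assms(1)]) auto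
  moreover have "(\<lambda>s. (t - s, g (w s))) ` {0..t} \<subseteq> {0..1} \<times> UNIV"
    using assms(2) by auto
  ultimately have "continuous_on {0..t} (\<lambda>s. case (t - s, g (w s)) of (r, y) \<Rightarrow> B r y)"
    by (rule continuous_on_compose2[OF B_joint_cont])
  then show ?thesis by simp
qed

lemma integrand_integrable:
  assumes "continuous_on {0..t} w" "t \<le> 1"
  shows "(\<lambda>s. B (t - s) (g (w s))) integrable_on {0..t}"
  by (rule integrable_continuous_real[OF integrand_cont[OF assms]])

text \<open>Both the integrand and the domain depend on \<open>t\<close>. The substitution of
  \<open>t * \<theta>\<close> for the integration variable fixes the domain to the unit interval,
  where continuity of parameter integrals applies.\<close>

lemma V_cont:
  assumes w: "continuous_on {0..T} w" and T: "T \<le> 1"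
  shows "continuous_on {0..T} (V w)"
proof -
  let ?f = "\<lambda>t s. B (t - s) (g (w s))"
  have "continuous_on ({0..T} \<times> cbox 0 1) (\<lambda>(t, \<theta>). ?f t (t * \<theta>))"
  proof -
    have in1: "t * \<theta> \<in> {0..t}" if "t \<in> {0..T}" "\<theta> \<in> cbox 0 1" for t \<theta> :: real
      using that by (auto intro: mult_left_le)
    have "continuous_on ({0..T} \<times> cbox (0::real) 1) (\<lambda>x. w (fst x * snd x))"
    proof (rule continuous_on_compose2[OF w])
      show "continuous_on ({0..T} \<times> cbox (0::real) 1) (\<lambda>x. fst x * snd x)" by (intro continuous_intros)
      show "(\<lambda>x. fst x * snd x) ` ({0..T} \<times> cbox (0::real) 1) \<subseteq> {0..T}"
        using in1 by fastforce
    qed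
    then have "continuous_on ({0..T} \<times> cbox (0::real) 1) (\<lambda>x. (fst x - fst x * snd x, g (w (fst x * snd x))))"
      by (intro continuous_intros continuous_on_compose2[OF g_cont]) auto
    moreover have "(\<lambda>x. (fst x - fst x * snd x, g (w (fst x * snd x)))) ` ({0..T} \<times> cbox (0::real) 1) \<subseteq> {0..1} \<times> UNIV"
    proof (rule image_subsetI)
      fix x assume "x \<in> {0..T} \<times> cbox (0::real) 1"
      then have "fst x * snd x \<in> {0..fst x}" "fst x \<le> 1" using in1[of "fst x" "snd x"] T by auto
      then show "(fst x - fst x * snd x, g (w (fst x * snd x))) \<in> {0..1} \<times> UNIV" by auto
    qed
    ultimately have "continuous_on ({0..T} \<times> cbox (0::real) 1) (\<lambda>x. case (fst x - fst x * snd x, g (w (fst x * snd x))) of (t, y) \<Rightarrow> B t y)"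
      by (rule continuous_on_compose2[OF B_joint_cont])
    then show ?thesis by (simp add: case_prod_unfold)
  qed
  from integral_continuous_on_param[OF this]
  have c: "continuous_on {0..T} (\<lambda>t. t *\<^sub>R integral (cbox 0 1) (\<lambda>\<theta>. ?f t (t * \<theta>)))"
    by (intro continuous_intros)
  have eq: "t *\<^sub>R integral (cbox 0 1) (\<lambda>\<theta>. ?f t (t * \<theta>)) = V w t" if t: "t \<in> {0..T}" for t
  proof (cases "t = 0")
    case True
    then show ?thesis by (simp add: V_def)
  next
    case False
    then have t0: "0 < t" using t by simp
    have im: "(\<lambda>x. x / t) ` {0..t} = {0..1}"
    proof -
      have "(\<lambda>x. (1 / t) * x) ` {0..t} = {(1 / t) * 0..(1 / t) * t}"
        using t0 by (subst image_mult_atLeastAtMost) auto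
      then show ?thesis using t0 by simp
    qed
    show ?thesis
      using integral_stretch_real[of t 0 t "?f t"] t0 unfolding im by (simp add: V_def)
  qed
  show ?thesis by (rule continuous_on_eq[OF c eq])
qed

text \<open>The majorant \<open>e\<close> is a function of time because the two uses differ: a
  constant for the contraction, a monomial for the iteration behind uniqueness.\<close>

lemma V_norm_diff:
  assumes v: "continuous_on {0..t} v" and w: "continuous_on {0..t} w" and t: "0 \<le> t" "t \<le> 1"
    and e: "e integrable_on {0..t}"
    and le: "\<And>s. s \<in> {0..t} \<Longrightarrow> norm (g (v s) - g (w s)) \<le> e s"
  shows "norm (V v t - V w t) \<le> C * integral {0..t} e"
proof -
  note iv = integrand_integrable[OF v t(2)] and iw = integrand_integrable[OF w t(2)]
  have "V v t - V w t = integral {0..t} (\<lambda>s. B (t - s) (g (v s)) - B (t - s) (g (w s)))"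
    unfolding V_def by (rule Henstock_Kurzweil_Integration.integral_diff[OF iv iw, symmetric])
  also have "norm \<dots> \<le> integral {0..t} (\<lambda>s. C * e s)"
  proof (rule integral_norm_bound_integral)
    show "(\<lambda>s. B (t - s) (g (v s)) - B (t - s) (g (w s))) integrable_on {0..t}"
      by (rule integrable_diff[OF iv iw])
    show "(\<lambda>s. C * e s) integrable_on {0..t}" using e by (rule integrable_on_mult_right)
    fix s assume s: "s \<in> {0..t}"
    then have ts: "0 \<le> t - s" "t - s \<le> 1" using t by auto
    have "B (t - s) (g (v s)) - B (t - s) (g (w s)) = B (t - s) (g (v s) - g (w s))"
      by (simp add: linear_diff[OF bounded_linear.linear[OF B_linear[OF ts]]])
    also have "norm \<dots> \<le> C * norm (g (v s) - g (w s))" by (rule B_norm[OF ts])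
    also have "\<dots> \<le> C * e s" by (rule mult_left_mono[OF le[OF s] C])
    finally show "norm (B (t - s) (g (v s)) - B (t - s) (g (w s))) \<le> C * e s" .
  qed
  finally show ?thesis by simp
qed

lemma V_norm:
  assumes w: "continuous_on {0..t} w" and t: "0 \<le> t" "t \<le> 1"
    and le: "\<And>s. s \<in> {0..t} \<Longrightarrow> norm (g (w s)) \<le> M"
  shows "norm (V w t) \<le> C * M * t"
proof -
  have "norm (V w t) \<le> integral {0..t} (\<lambda>s. C * M)"
    unfolding V_def
  proof (rule integral_norm_bound_integral[OF integrand_integrable[OF w t(2)]])
    fix s assume s: "s \<in> {0..t}"
    then have ts: "0 \<le> t - s" "t - s \<le> 1" using t by auto
    have "norm (B (t - s) (g (w s))) \<le> C * norm (g (w s))" by (rule B_norm[OF ts])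
    also have "\<dots> \<le> C * M" by (rule mult_left_mono[OF le[OF s] C])
    finally show "norm (B (t - s) (g (w s))) \<le> C * M" .
  qed (rule integrable_const_ivl)
  then show ?thesis using t by (simp add: mult_ac)
qed

text \<open>\<open>T\<close> is chosen from \<open>A\<close> alone, before the inhomogeneity
  \<open>a\<close>. This is what makes the existence time independent of the size parameter of the
  data.\<close>

theorem local_existence:
  assumes A: "0 \<le> A"
  shows "\<exists>T>0. T \<le> 1 \<and> (\<forall>a. continuous_on {0..T} a \<longrightarrow> (\<forall>t\<in>{0..T}. norm (a t) \<le> A) \<longrightarrow>
    (\<exists>w. continuous_on {0..T} w \<and> (\<forall>t\<in>{0..T}. w t = a t + V w t)))"
proof -
  \<comment> \<open>The inhomogeneity takes up \<open>A\<close> of the radius; the remaining 1 is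
    room for the integral term.\<close>
  define R where "R = A + 1"
  have R: "0 < R" using A by (simp add: R_def)
  obtain L where L: "0 \<le> L" "\<And>v w. norm v \<le> R \<Longrightarrow> norm w \<le> R \<Longrightarrow> norm (g v - g w) \<le> L * norm (v - w)"
    using g_lipschitz[of R] by blast
  define M where "M = norm (g 0) + L * R"
  have M: "0 \<le> M" using L R by (simp add: M_def)
  have gM: "norm (g v) \<le> M" if "norm v \<le> R" for v
  proof -
    have "norm (g v) \<le> norm (g 0) + norm (g v - g 0)" using norm_triangle_sub[of "g v" "g 0"] by simp
    also have "norm (g v - g 0) \<le> L * R"
      using L(2)[of v 0] that R L(1) mult_left_mono[of "norm v" R L] by simp
    finally show ?thesis by (simp add: M_def)
  qed
  \<comment> \<open>The three summands of the denominator ensure in turn \<open>T \<le> 1\<close>, a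
    contraction factor of at most 1/2, and an integral term of norm at most 1.\<close>
  define T where "T = inverse (1 + 2 * C * L + C * M)"
  have den: "1 + 2 * C * L + C * M \<ge> 1" using C L M by simp
  have T: "0 < T" "T \<le> 1" using den by (simp_all add: T_def inverse_le_1_iff)
  have nn: "0 \<le> C * L" "0 \<le> C * M" using C L M by simp_all
  have one: "(1 + 2 * C * L + C * M) * T = 1" using den by (simp add: T_def)
  have TL: "C * L * T \<le> 1/2" and TM: "C * M * T \<le> 1"
    using one T(1) nn mult_nonneg_nonneg[of "C * L" T] mult_nonneg_nonneg[of "C * M" T]
    by (simp_all add: algebra_simps)
  have "\<exists>w. continuous_on {0..T} w \<and> (\<forall>t\<in>{0..T}. w t = a t + V w t)"
    if a: "continuous_on {0..T} a" and aA: "\<forall>t\<in>{0..T}. norm (a t) \<le> A" for a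
  proof -
    \<comment> \<open>Bounded continuous functions are defined on the whole line, so time is clamped
      to the interval. The values of \<open>f\<close> outside it do not affect \<Phi>.\<close>
    define cl where "cl t = max 0 (min T t)" for t
    have cl: "cl t \<in> {0..T}" for t using T by (auto simp: cl_def)
    have cl_id: "cl t = t" if "t \<in> {0..T}" for t using that by (simp add: cl_def)
    have cl_cont: "continuous_on UNIV cl" unfolding cl_def by (intro continuous_intros)
    define S where "S = {f :: real \<Rightarrow>\<^sub>C 'a. \<forall>t. norm (apply_bcontfun f t) \<le> R}"
    define \<Phi> where "\<Phi> f t = a (cl t) + V (apply_bcontfun f) (cl t)" for f :: "real \<Rightarrow>\<^sub>C 'a" and t
    have V_le: "norm (V (apply_bcontfun f) t) \<le> 1" if "f \<in> S" "t \<in> {0..T}" for f t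
    proof -
      have "norm (V (apply_bcontfun f) t) \<le> C * M * t"
        by (rule V_norm) (use that T C gM in \<open>auto simp: S_def\<close>)
      also have "\<dots> \<le> C * M * T" using that nn by (intro mult_left_mono) auto
      finally show ?thesis using TM by simp
    qed
    have \<Phi>_R: "norm (\<Phi> f t) \<le> R" if "f \<in> S" for f t
    proof -
      have "norm (a (cl t)) \<le> A" using aA cl by blast
      then show ?thesis
        using norm_triangle_ineq[of "a (cl t)" "V (apply_bcontfun f) (cl t)"] V_le[OF that cl[of t]]
        by (simp add: \<Phi>_def R_def)
    qed
    have \<Phi>_bc: "\<Phi> f \<in> bcontfun" if "f \<in> S" for f
    proof (rule bcontfun_normI)
      have "continuous_on {0..T} (\<lambda>t. a t + V (apply_bcontfun f) t)"
        by (intro continuous_intros a V_cont T) simp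
      from continuous_on_compose2[OF this cl_cont image_subsetI[OF cl]] show "continuous_on UNIV (\<Phi> f)"
        unfolding \<Phi>_def[abs_def] .
    qed (rule \<Phi>_R[OF that])
    have app: "apply_bcontfun (Bcontfun (\<Phi> f)) = \<Phi> f" if "f \<in> S" for f
      by (rule Bcontfun_inverse[OF \<Phi>_bc[OF that]])
    have "closed S"
    proof -
      have "S = PiC UNIV (\<lambda>_. cball 0 R)" by (auto simp: S_def mem_PiC_iff Pi_def)
      then show ?thesis by (simp add: closed_PiC)
    qed
    then have "complete S" by (simp add: complete_eq_closed)
    moreover have "S \<noteq> {}"
    proof -
      have "0 \<in> S" using R by (simp add: S_def)
      then show ?thesis by blast
    qed
    moreover have "(\<lambda>f. Bcontfun (\<Phi> f)) ` S \<subseteq> S"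
      using \<Phi>_R app by (auto simp: S_def)
    moreover have "dist (Bcontfun (\<Phi> f)) (Bcontfun (\<Phi> h)) \<le> 1/2 * dist f h" if f: "f \<in> S" and h: "h \<in> S" for f h
    proof (rule dist_bound)
      fix t
      let ?t = "cl t"
      have t: "0 \<le> ?t" "?t \<le> T" "?t \<le> 1" using cl[of t] T by auto
      have "norm (V (apply_bcontfun f) ?t - V (apply_bcontfun h) ?t) \<le> C * integral {0..?t} (\<lambda>s. L * dist f h)"
      proof (rule V_norm_diff)
        fix s
        have "norm (g (apply_bcontfun f s) - g (apply_bcontfun h s)) \<le> L * norm (apply_bcontfun f s - apply_bcontfun h s)"
          using f h by (intro L) (auto simp: S_def)
        also have "\<dots> \<le> L * dist f h"
          using dist_bounded[of f s h] L(1) by (intro mult_left_mono) (auto simp: dist_norm)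
        finally show "norm (g (apply_bcontfun f s) - g (apply_bcontfun h s)) \<le> L * dist f h" .
      qed (use t C in auto)
      also have "\<dots> = (C * L * ?t) * dist f h" using t by simp
      also have "\<dots> \<le> (C * L * T) * dist f h" using t nn by (intro mult_right_mono mult_left_mono) auto
      also have "\<dots> \<le> 1/2 * dist f h" by (rule mult_right_mono[OF TL]) simp
      finally show "dist (apply_bcontfun (Bcontfun (\<Phi> f)) t) (apply_bcontfun (Bcontfun (\<Phi> h)) t) \<le> 1/2 * dist f h"
        by (simp add: app f h \<Phi>_def dist_norm)
    qed
    ultimately have "\<exists>!f\<in>S. Bcontfun (\<Phi> f) = f"
      by (intro Banach_fix[where c="1/2"]) auto
    then obtain f where f: "f \<in> S" "Bcontfun (\<Phi> f) = f" by blast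
    have "apply_bcontfun f t = a t + V (apply_bcontfun f) t" if "t \<in> {0..T}" for t
    proof -
      have "apply_bcontfun f t = \<Phi> f t" using app[OF f(1)] f(2) by simp
      then show ?thesis by (simp add: \<Phi>_def cl_id[OF that])
    qed
    then show ?thesis by (intro exI[of _ "apply_bcontfun f"]) auto
  qed
  then show ?thesis using T by blast
qed

text \<open>The solutions are bounded on each compact {0..t}, which fixes a Lipschitz constant
  there. Each iteration gains a factor \<open>K * s\<close> over the next integer, so the factorial
  forces the difference to vanish without any smallness of \<open>t\<close>.\<close>

theorem uniqueness:
  assumes T: "T \<le> 1"
    and v: "continuous_on {0..<T} v" "\<And>t. t \<in> {0..<T} \<Longrightarrow> v t = a t + V v t"
    and w: "continuous_on {0..<T} w" "\<And>t. t \<in> {0..<T} \<Longrightarrow> w t = a t + V w t"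
    and t: "t \<in> {0..<T}"
  shows "v t = w t"
proof -
  have sub: "{0..s} \<subseteq> {0..<T}" if "s \<in> {0..t}" for s using t that by auto
  have cv: "continuous_on {0..t} v" and cw: "continuous_on {0..t} w"
    using v(1) w(1) sub[of t] t by (auto intro: continuous_on_subset)
  obtain R1 where R1: "\<And>s. s \<in> {0..t} \<Longrightarrow> norm (v s) \<le> R1"
    using compact_continuous_image[OF cv] compact_imp_bounded bounded_iff by (metis compact_Icc imageI)
  obtain R2 where R2: "\<And>s. s \<in> {0..t} \<Longrightarrow> norm (w s) \<le> R2"
    using compact_continuous_image[OF cw] compact_imp_bounded bounded_iff by (metis compact_Icc imageI)
  obtain L where L: "0 \<le> L" "\<And>x y. norm x \<le> max R1 R2 \<Longrightarrow> norm y \<le> max R1 R2 \<Longrightarrow> norm (g x - g y) \<le> L * norm (x - y)"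
    using g_lipschitz[of "max R1 R2"] by blast
  \<comment> \<open>An a priori bound for the difference, from which the iteration starts.\<close>
  define D where "D = R1 + R2"
  define K where "K = C * L"
  have bound: "norm (v s - w s) \<le> D * (K ^ k * s ^ k / fact k)" if "s \<in> {0..t}" for s k
    using that
  proof (induction k arbitrary: s)
    case 0
    then show ?case
      using norm_triangle_ineq4[of "v s" "w s"] R1[of s] R2[of s] by (simp add: D_def)
  next
    case (Suc k)
    let ?e = "\<lambda>r. L * (D * (K ^ k * r ^ k / fact k))"
    have s: "0 \<le> s" "s \<le> 1" using Suc.prems t T by auto
    have "((\<lambda>r. D * (K ^ k * r ^ Suc k / fact (Suc k))) has_real_derivative D * (K ^ k * r ^ k / fact k)) (at r within {0..s})" for r
    proof -
      have "((\<lambda>r. D * K ^ k / fact (Suc k) * r ^ Suc k) has_real_derivative D * K ^ k / fact (Suc k) * (real (Suc k) * r ^ k)) (at r within {0..s})"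
        by (intro DERIV_cmult) (use DERIV_pow[of "Suc k" r "{0..s}"] in simp)
      moreover have "D * K ^ k / fact (Suc k) * (real (Suc k) * r ^ k) = D * (K ^ k * r ^ k / fact k)"
        by (simp add: fact_Suc field_simps del: of_nat_Suc)
      moreover have "(\<lambda>r. D * K ^ k / fact (Suc k) * r ^ Suc k) = (\<lambda>r. D * (K ^ k * r ^ Suc k / fact (Suc k)))"
        by (simp add: mult.assoc)
      ultimately show ?thesis by (simp only:)
    qed
    then have ftc: "((\<lambda>r. D * (K ^ k * r ^ k / fact k)) has_integral
        D * (K ^ k * s ^ Suc k / fact (Suc k)) - D * (K ^ k * 0 ^ Suc k / fact (Suc k))) {0..s}"
      using s(1) by (intro fundamental_theorem_of_calculus) (auto simp: has_real_derivative_iff_has_vector_derivative)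
    have "(?e has_integral L * (D * (K ^ k * s ^ Suc k / fact (Suc k)))) {0..s}"
      using has_integral_mult_right[OF ftc, of L] by simp
    then have ei: "?e integrable_on {0..s}" "integral {0..s} ?e = L * (D * (K ^ k * s ^ Suc k / fact (Suc k)))"
      by (auto simp: has_integral_iff)
    have "s \<in> {0..<T}" using sub[of s] Suc.prems by auto
    then have "v s - w s = V v s - V w s" using v(2)[of s] w(2)[of s] by simp
    also have "norm \<dots> \<le> C * integral {0..s} ?e"
    proof (rule V_norm_diff[OF _ _ s ei(1)])
      show "continuous_on {0..s} v" "continuous_on {0..s} w"
        using cv cw Suc.prems by (auto intro: continuous_on_subset)
      fix r assume r: "r \<in> {0..s}"
      then have rt: "r \<in> {0..t}" using Suc.prems by auto
      have "norm (g (v r) - g (w r)) \<le> L * norm (v r - w r)"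
        using R1[OF rt] R2[OF rt] by (intro L) auto
      also have "\<dots> \<le> ?e r" by (intro mult_left_mono Suc.IH[OF rt] L)
      finally show "norm (g (v r) - g (w r)) \<le> ?e r" .
    qed
    also have "\<dots> = D * (K ^ Suc k * s ^ Suc k / fact (Suc k))"
      unfolding ei(2) by (simp add: K_def)
    finally show ?case .
  qed
  have "(\<lambda>k. D * (inverse (fact k) * (K * t) ^ k)) \<longlonglongrightarrow> D * 0"
    by (intro tendsto_mult_left summable_LIMSEQ_zero summable_exp)
  then have lim: "(\<lambda>k. D * (K ^ k * t ^ k / fact k)) \<longlonglongrightarrow> 0"
    by (simp add: power_mult_distrib divide_inverse mult_ac)
  have "norm (v t - w t) \<le> 0"
    by (rule LIMSEQ_le_const[OF lim]) (use bound[of t] t in auto)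
  then show ?thesis by simp
qed

end

section \<open>The Bochner integral in \<open>L\<^sup>2\<close>\<close>

text \<open>Real coefficients suffice, since those in the definition of the Bochner integral are
  indicator values or measures.\<close>

lemma abs_l2_lincomb:
  fixes c :: "nat \<Rightarrow> real" and f :: "nat \<Rightarrow> real ^ 'n \<Rightarrow> complex"
  assumes "\<forall>i<N. f i \<in> Lp 2"
  shows "(\<lambda>x. \<Sum>i<N. of_real (c i) * f i x) \<in> Lp 2"
    "abs_l2 (\<lambda>x. \<Sum>i<N. of_real (c i) * f i x) = (\<Sum>i<N. c i *\<^sub>R abs_l2 (f i))"
proof -
  have f: "(\<lambda>x. of_real (c i) * f i x) \<in> Lp 2" if "i < N" for i
    using assms that by (simp add: Lp_2_mult_const)
  then show "(\<lambda>x. \<Sum>i<N. of_real (c i) * f i x) \<in> Lp 2"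
    by (intro Lp_2_sum) simp
  have "(\<Sum>i<N. c i *\<^sub>R abs_l2 (f i)) = (\<Sum>i<N. abs_l2 (\<lambda>x. of_real (c i) * f i x))"
    using assms by (intro sum.cong refl) (simp add: abs_l2_scaleR scaleR_conv_of_real)
  also have "\<dots> = abs_l2 (\<lambda>x. \<Sum>i<N. of_real (c i) * f i x)"
    using f by (intro abs_l2_sum) simp
  finally show "abs_l2 (\<lambda>x. \<Sum>i<N. of_real (c i) * f i x) = (\<Sum>i<N. c i *\<^sub>R abs_l2 (f i))" ..
qed

lemma of_real_indicator: "complex_of_real (indicator A x) = indicator A x"
  by (simp add: indicator_def)

lemma tendsto_0_le_ennreal:
  fixes f :: "'a \<Rightarrow> ennreal"
  assumes "\<And>e. 0 < e \<Longrightarrow> \<forall>\<^sub>F x in F. f x \<le> ennreal e"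
  shows "(f \<longlongrightarrow> 0) F"
proof (rule order_tendstoI)
  fix a :: ennreal assume "0 < a"
  then obtain e where e: "0 < e" "ennreal e < a"
    by (metis dense ennreal_cases ennreal_less_zero_iff less_top top_greatest not_less)
  show "\<forall>\<^sub>F x in F. f x < a"
    using assms[OF e(1)] by eventually_elim (rule le_less_trans[OF _ e(2)])
qed simp

text \<open>A continuous \<open>L\<^sup>2\<close>-valued function is a uniform limit of functions constant on the intervals
  \<open>{i/m ..< (i+1)/m}\<close>, so its Bochner integral is the Henstock-Kurzweil integral of the library.\<close>

lemma has_L2_bochner_integral_continuous:
  fixes F :: "real \<Rightarrow> real ^ 'n \<Rightarrow> complex" and \<Phi> :: "real \<Rightarrow> 'n::finite l2"
  assumes F: "\<And>s. s \<in> {0..t} \<Longrightarrow> F s \<in> Lp 2" "\<And>s. s \<in> {0..t} \<Longrightarrow> abs_l2 (F s) = \<Phi> s"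
    and \<Phi>: "continuous_on {0..t} \<Phi>" and t: "0 \<le> t"
    and I: "I \<in> Lp 2" "abs_l2 I = integral {0..t} \<Phi>"
  shows "has_L2_bochner_integral F {0..t} I"
proof -
  define m where "m k = real (Suc k)" for k
  have m: "0 < m k" for k by (simp add: m_def)
  \<comment> \<open>\<open>Suc\<close>, because the cell with index floor (t m), which contains the
    endpoint \<open>t\<close>, has to be counted.\<close>
  define N where "N k = Suc (nat \<lfloor>t * m k\<rfloor>)" for k
  define x where "x k i = real i / m k" for k i
  define A where "A k i = {0..t} \<inter> {x k i..<x k (Suc i)}" for k i
  define j where "j k s = nat \<lfloor>s * m k\<rfloor>" for k s
  have x_in: "x k i \<in> {0..t}" if "i < N k" for k i
  proof -
    have "int i \<le> \<lfloor>t * m k\<rfloor>" using that t m[of k] by (simp add: N_def less_Suc_eq_le le_nat_iff)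
    then have "real i \<le> t * m k" by (simp add: le_floor_iff)
    then show ?thesis using m[of k] by (simp add: x_def field_simps)
  qed
  have A_iff: "s \<in> A k i \<longleftrightarrow> i = j k s" if s: "s \<in> {0..t}" for s k i
  proof -
    have "s \<in> A k i \<longleftrightarrow> real i \<le> s * m k \<and> s * m k < real i + 1"
      using s m[of k] by (simp add: A_def x_def field_simps)
    also have "\<dots> \<longleftrightarrow> \<lfloor>s * m k\<rfloor> = int i" by (simp add: floor_eq_iff)
    also have "\<dots> \<longleftrightarrow> i = j k s" using s m[of k] by (auto simp: j_def)
    finally show ?thesis .
  qed
  have j_less: "j k s < N k" if "s \<in> {0..t}" for s k
    using that m[of k] by (auto simp: j_def N_def less_Suc_eq_le intro!: nat_mono floor_mono mult_right_mono)
  have sum_A: "(\<Sum>i<N k. indicator (A k i) s *\<^sub>R h i) = h (j k s)" if s: "s \<in> {0..t}" for s k and h :: "nat \<Rightarrow> 'b::real_vector"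
  proof -
    have "(\<Sum>i<N k. indicator (A k i) s *\<^sub>R h i) = (\<Sum>i<N k. if i = j k s then h i else 0)"
      using A_iff[OF s] by (intro sum.cong refl) (simp add: indicator_def)
    then show ?thesis using j_less[OF s] by simp
  qed
  define f where "f k i = F (x k i)" for k i
  define ds where "ds k \<tau> = Lp_norm 2 (\<lambda>y. F \<tau> y - (\<Sum>i<N k. indicator (A k i) \<tau> * f k i y))" for k \<tau>
  have f: "f k i \<in> Lp 2" "abs_l2 (f k i) = \<Phi> (x k i)" if "i < N k" for k i
    using F x_in[OF that] by (simp_all add: f_def)
  have f1: "\<forall>i<N k. f k i \<in> Lp 2" for k using f(1) by blast
  have ds: "ds k \<tau> = norm (\<Phi> \<tau> - \<Phi> (x k (j k \<tau>)))" if \<tau>: "\<tau> \<in> {0..t}" for k \<tau>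
  proof -
    note s = abs_l2_lincomb[of "N k" "f k" "\<lambda>i. indicator (A k i) \<tau>", OF f1, unfolded of_real_indicator]
    have "ds k \<tau> = norm (abs_l2 (F \<tau>) - abs_l2 (\<lambda>y. \<Sum>i<N k. indicator (A k i) \<tau> * f k i y))"
      unfolding ds_def abs_l2_diff[OF F(1)[OF \<tau>] s(1)]
      by (rule norm_abs_l2[OF Lp_2_diff[OF F(1)[OF \<tau>] s(1)], symmetric])
    also have "abs_l2 (\<lambda>y. \<Sum>i<N k. indicator (A k i) \<tau> * f k i y) = (\<Sum>i<N k. indicator (A k i) \<tau> *\<^sub>R \<Phi> (x k i))"
      unfolding s(2) by (intro sum.cong refl) (simp only: f(2) lessThan_iff)
    also note F(2)[OF \<tau>]
    finally show ?thesis unfolding sum_A[OF \<tau>] .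
  qed
  have A_meas: "A k i \<in> sets lebesgue" "A k i \<subseteq> {0..t}" "emeasure lebesgue (A k i) < \<infinity>" for k i
  proof -
    show "A k i \<in> sets lebesgue" unfolding A_def by (intro sets.Int) auto
    show sub: "A k i \<subseteq> {0..t}" by (auto simp: A_def)
    have "emeasure lebesgue (A k i) \<le> emeasure lebesgue {0..t}" by (rule emeasure_mono[OF sub]) simp
    then show "emeasure lebesgue (A k i) < \<infinity>" using t by (simp add: le_less_trans)
  qed
  have ds_meas: "ds k \<in> borel_measurable (lebesgue_on {0..t})" for k
  proof -
    have "(\<lambda>\<tau>. \<Sum>i<N k. indicator (A k i) \<tau> *\<^sub>R norm (\<Phi> \<tau> - \<Phi> (x k i))) \<in> borel_measurable (lebesgue_on {0..t})"
    proof (intro borel_measurable_sum borel_measurable_scaleR)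
      fix i
      show "(indicator (A k i) :: real \<Rightarrow> real) \<in> borel_measurable (lebesgue_on {0..t})"
        using A_meas by (intro borel_measurable_indicator) (auto simp: sets_restrict_space_iff)
      show "(\<lambda>\<tau>. norm (\<Phi> \<tau> - \<Phi> (x k i))) \<in> borel_measurable (lebesgue_on {0..t})"
        by (intro continuous_imp_measurable_on_sets_lebesgue continuous_intros \<Phi>) simp
    qed
    then show ?thesis
    proof (rule measurable_cong[THEN iffD1, rotated])
      fix \<tau> assume "\<tau> \<in> space (lebesgue_on {0..t})"
      then have \<tau>: "\<tau> \<in> {0..t}" by simp
      show "(\<Sum>i<N k. indicator (A k i) \<tau> *\<^sub>R norm (\<Phi> \<tau> - \<Phi> (x k i))) = ds k \<tau>"
        unfolding ds[OF \<tau>] by (rule sum_A[OF \<tau>])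
    qed
  qed
  have near: "\<exists>K. \<forall>k\<ge>K. \<forall>\<tau>\<in>{0..t}. norm (\<Phi> \<tau> - \<Phi> (x k (j k \<tau>))) < e" if "0 < e" for e
  proof -
    have "uniformly_continuous_on {0..t} \<Phi>" by (rule compact_uniformly_continuous[OF \<Phi> compact_Icc])
    then obtain d where d: "0 < d" "\<And>r s. r \<in> {0..t} \<Longrightarrow> s \<in> {0..t} \<Longrightarrow> dist s r < d \<Longrightarrow> dist (\<Phi> s) (\<Phi> r) < e"
      using \<open>0 < e\<close> unfolding uniformly_continuous_on_def by metis
    obtain K where K: "inverse (real (Suc K)) < d" using reals_Archimedean[OF d(1)] by blast
    have "norm (\<Phi> \<tau> - \<Phi> (x k (j k \<tau>))) < e" if k: "k \<ge> K" and \<tau>: "\<tau> \<in> {0..t}" for k \<tau>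
    proof -
      have "\<tau> \<in> A k (j k \<tau>)" using A_iff[OF \<tau>] by simp
      then have "x k (j k \<tau>) \<le> \<tau>" "\<tau> < x k (j k \<tau>) + inverse (m k)"
        by (simp_all add: A_def x_def add_divide_distrib inverse_eq_divide)
      moreover have "inverse (m k) \<le> inverse (real (Suc K))"
        using k by (simp add: m_def le_imp_inverse_le)
      ultimately have "dist \<tau> (x k (j k \<tau>)) < d" using K by (simp add: dist_real_def)
      then show ?thesis using d(2)[OF x_in[OF j_less[OF \<tau>]] \<tau>] by (simp add: dist_norm)
    qed
    then show ?thesis by blast
  qed
  have lim1: "(\<lambda>k. \<integral>\<^sup>+ \<tau>. ennreal (ds k \<tau>) \<partial>lebesgue_on {0..t}) \<longlonglongrightarrow> 0"
  proof (rule tendsto_0_le_ennreal)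
    fix e :: real assume "0 < e"
    \<comment> \<open>Dividing by \<open>t + 1\<close> instead of \<open>t\<close> covers
      \<open>t = 0\<close> as well.\<close>
    then have "0 < e / (t + 1)" using t by simp
    from near[OF this]
    obtain K where K: "\<And>k \<tau>. k \<ge> K \<Longrightarrow> \<tau> \<in> {0..t} \<Longrightarrow> norm (\<Phi> \<tau> - \<Phi> (x k (j k \<tau>))) < e / (t + 1)"
      by blast
    show "\<forall>\<^sub>F k in sequentially. (\<integral>\<^sup>+ \<tau>. ennreal (ds k \<tau>) \<partial>lebesgue_on {0..t}) \<le> ennreal e"
    proof (rule eventually_sequentiallyI)
      fix k assume k: "K \<le> k"
      have "(\<integral>\<^sup>+ \<tau>. ennreal (ds k \<tau>) \<partial>lebesgue_on {0..t}) \<le> (\<integral>\<^sup>+ \<tau>. ennreal (e / (t + 1)) \<partial>lebesgue_on {0..t})"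
        using K[OF k] by (intro nn_integral_mono ennreal_leI) (auto simp: ds less_imp_le)
      also have "\<dots> = ennreal (e / (t + 1)) * ennreal t"
        using t by (simp add: emeasure_restrict_space)
      also have "\<dots> = ennreal (e / (t + 1) * t)" using \<open>0 < e\<close> t by (intro ennreal_mult[symmetric]) auto
      also have "\<dots> \<le> ennreal e" using \<open>0 < e\<close> t by (intro ennreal_leI) (simp add: field_simps)
      finally show "(\<integral>\<^sup>+ \<tau>. ennreal (ds k \<tau>) \<partial>lebesgue_on {0..t}) \<le> ennreal e" .
    qed
  qed
  have lim2: "(\<lambda>k. Lp_norm 2 (\<lambda>y. (\<Sum>i<N k. of_real (measure lebesgue (A k i)) * f k i y) - I y)) \<longlonglongrightarrow> 0"
  proof (rule LIMSEQ_I)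
    fix e :: real assume "0 < e"
    then have "0 < e / (t + 1)" using t by simp
    from near[OF this]
    obtain K where K: "\<And>k \<tau>. k \<ge> K \<Longrightarrow> \<tau> \<in> {0..t} \<Longrightarrow> norm (\<Phi> \<tau> - \<Phi> (x k (j k \<tau>))) < e / (t + 1)"
      by blast
    have "norm (Lp_norm 2 (\<lambda>y. (\<Sum>i<N k. of_real (measure lebesgue (A k i)) * f k i y) - I y) - 0) < e" if k: "K \<le> k" for k
    proof -
      note s = abs_l2_lincomb[of "N k" "f k" "\<lambda>i. measure lebesgue (A k i)", OF f1]
      have "((\<lambda>\<tau>. indicator (A k i) \<tau> *\<^sub>R \<Phi> (x k i)) has_integral measure lebesgue (A k i) *\<^sub>R \<Phi> (x k i)) {0..t}" for i
      proof -
        have "A k i \<in> lmeasurable" using A_meas[of k i] by (simp add: fmeasurable_def)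
        then have "((\<lambda>\<tau>. if \<tau> \<in> A k i then 1 else 0 :: real) has_integral measure lebesgue (A k i)) UNIV"
          unfolding lmeasurable_iff_has_integral by (simp only: indicator_def[abs_def] of_bool_def)
        then have "((\<lambda>_. 1 :: real) has_integral measure lebesgue (A k i)) (A k i)"
          by (subst (asm) has_integral_restrict) simp_all
        then have "((\<lambda>\<tau>. if \<tau> \<in> A k i then 1 else 0 :: real) has_integral measure lebesgue (A k i)) {0..t}"
          using A_meas(2) by (simp add: has_integral_restrict)
        from has_integral_linear[OF this bounded_linear_scaleR_left[of "\<Phi> (x k i)"]]
        show ?thesis by (simp add: o_def indicator_def of_bool_def)
      qed
      then have "((\<lambda>\<tau>. \<Sum>i<N k. indicator (A k i) \<tau> *\<^sub>R \<Phi> (x k i)) has_integral (\<Sum>i<N k. measure lebesgue (A k i) *\<^sub>R \<Phi> (x k i))) {0..t}"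
        by (intro has_integral_sum) auto
      then have step: "((\<lambda>\<tau>. \<Phi> (x k (j k \<tau>))) has_integral (\<Sum>i<N k. measure lebesgue (A k i) *\<^sub>R \<Phi> (x k i))) {0..t}"
        by (rule has_integral_eq[rotated]) (rule sum_A)
      have int: "\<Phi> integrable_on {0..t}" by (rule integrable_continuous_real[OF \<Phi>])
      have "Lp_norm 2 (\<lambda>y. (\<Sum>i<N k. of_real (measure lebesgue (A k i)) * f k i y) - I y)
          = norm ((\<Sum>i<N k. measure lebesgue (A k i) *\<^sub>R \<Phi> (x k i)) - integral {0..t} \<Phi>)"
        using s I f(2) by (simp add: norm_abs_l2[symmetric] Lp_2_diff abs_l2_diff[symmetric])
      also have "\<dots> = norm (integral {0..t} (\<lambda>\<tau>. \<Phi> (x k (j k \<tau>)) - \<Phi> \<tau>))"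
        using step int by (simp add: Henstock_Kurzweil_Integration.integral_diff has_integral_iff)
      also have "\<dots> \<le> integral {0..t} (\<lambda>\<tau>. e / (t + 1))"
        using step int K[OF k]
        by (intro integral_norm_bound_integral integrable_diff integrable_const_ivl)
           (auto simp: has_integral_iff norm_minus_commute less_imp_le)
      also have "\<dots> = t * (e / (t + 1))" using t by simp
      also have "\<dots> < e" using \<open>0 < e\<close> t by (simp add: field_simps)
      finally show ?thesis by (simp add: Lp_norm_def)
    qed
    then show "\<exists>no. \<forall>k\<ge>no. norm (Lp_norm 2 (\<lambda>y. (\<Sum>i<N k. of_real (measure lebesgue (A k i)) * f k i y) - I y) - 0) < e"
      by blast
  qed
  show ?thesis
    unfolding has_L2_bochner_integral_def Let_def
  proof (intro conjI exI)
    show "\<forall>\<tau>\<in>{0..t}. F \<tau> \<in> Lp 2" using F(1) by blast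
    show "I \<in> Lp 2" by (rule I)
    show "\<forall>k. \<forall>i<N k. A k i \<in> sets lebesgue \<and> A k i \<subseteq> {0..t} \<and> emeasure lebesgue (A k i) < \<infinity> \<and> f k i \<in> Lp 2"
      using A_meas f(1) by blast
    show "\<forall>k. (\<lambda>\<tau>. Lp_norm 2 (\<lambda>y. F \<tau> y - (\<Sum>i<N k. indicator (A k i) \<tau> * f k i y))) \<in> borel_measurable (lebesgue_on {0..t})"
      using ds_meas unfolding ds_def[abs_def] by blast
    show "(\<lambda>k. \<integral>\<^sup>+ \<tau>. ennreal (Lp_norm 2 (\<lambda>y. F \<tau> y - (\<Sum>i<N k. indicator (A k i) \<tau> * f k i y))) \<partial>lebesgue_on {0..t}) \<longlonglongrightarrow> 0"
      using lim1 unfolding ds_def .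
    show "(\<lambda>k. Lp_norm 2 (\<lambda>y. (\<Sum>i<N k. of_real (measure lebesgue (A k i)) * f k i y) - I y)) \<longlonglongrightarrow> 0"
      by (rule lim2)
  qed
qed

text \<open>Conversely the defining approximations determine the integral, as one sees by pairing with
  the elements of \<open>L\<^sup>2\<close>; this avoids vector-valued Lebesgue integrals.\<close>

lemma has_L2_bochner_integral_unique:
  fixes F :: "real \<Rightarrow> real ^ 'n \<Rightarrow> complex"
  assumes bochner: "has_L2_bochner_integral F {0..t} I"
    and \<Phi>: "continuous_on {0..t} (\<lambda>\<tau>. abs_l2 (F \<tau>))"
  shows "abs_l2 I = integral {0..t} (\<lambda>\<tau>. abs_l2 (F \<tau>))"
proof -
  \<comment> \<open>The approximating data are arguments of \<open>ds\<close>, so that the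
    definition can be folded under the existential quantifier before witnesses are obtained.\<close>
  define ds where "ds N A f k \<tau> = Lp_norm 2 (\<lambda>y. F \<tau> y - (\<Sum>i<N k. indicator (A k i) \<tau> * f k i y))"
    for N :: "nat \<Rightarrow> nat" and A :: "nat \<Rightarrow> nat \<Rightarrow> real set" and f :: "nat \<Rightarrow> nat \<Rightarrow> real ^ 'n \<Rightarrow> complex" and k \<tau>
  have F: "F \<tau> \<in> Lp 2" if "\<tau> \<in> {0..t}" for \<tau>
    using bochner that unfolding has_L2_bochner_integral_def by blast
  have I: "I \<in> Lp 2" using bochner unfolding has_L2_bochner_integral_def by blast
  obtain N :: "nat \<Rightarrow> nat" and A :: "nat \<Rightarrow> nat \<Rightarrow> real set" and f :: "nat \<Rightarrow> nat \<Rightarrow> real ^ 'n \<Rightarrow> complex" where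
    Af: "\<And>k i. i < N k \<Longrightarrow> A k i \<in> sets lebesgue" "\<And>k i. i < N k \<Longrightarrow> A k i \<subseteq> {0..t}"
      "\<And>k i. i < N k \<Longrightarrow> emeasure lebesgue (A k i) < \<infinity>" "\<And>k i. i < N k \<Longrightarrow> f k i \<in> Lp 2"
    and ds_meas: "\<And>k. ds N A f k \<in> borel_measurable (lebesgue_on {0..t})"
    and lim1: "(\<lambda>k. \<integral>\<^sup>+ \<tau>. ennreal (ds N A f k \<tau>) \<partial>lebesgue_on {0..t}) \<longlonglongrightarrow> 0"
    and lim2: "(\<lambda>k. Lp_norm 2 (\<lambda>y. (\<Sum>i<N k. of_real (measure lebesgue (A k i)) * f k i y) - I y)) \<longlonglongrightarrow> 0"
    using bochner unfolding has_L2_bochner_integral_def Let_def ds_def[symmetric] by blast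
  define \<Psi> where "\<Psi> \<tau> = abs_l2 (F \<tau>)" for \<tau>
  define s where "s k \<tau> = (\<Sum>i<N k. indicator (A k i) \<tau> *\<^sub>R abs_l2 (f k i))" for k \<tau>
  define J where "J k = (\<Sum>i<N k. measure lebesgue (A k i) *\<^sub>R abs_l2 (f k i))" for k
  have f1: "\<forall>i<N k. f k i \<in> Lp 2" for k using Af(4) by blast
  have ds: "ds N A f k \<tau> = norm (\<Psi> \<tau> - s k \<tau>)" if \<tau>: "\<tau> \<in> {0..t}" for k \<tau>
  proof -
    note * = abs_l2_lincomb[of "N k" "f k" "\<lambda>i. indicator (A k i) \<tau>", OF f1, unfolded of_real_indicator]
    show ?thesis
      unfolding ds_def s_def \<Psi>_def *(2)[symmetric] abs_l2_diff[OF F[OF \<tau>] *(1)]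
      by (rule norm_abs_l2[OF Lp_2_diff[OF F[OF \<tau>] *(1)], symmetric])
  qed
  have J_lim: "J \<longlonglongrightarrow> abs_l2 I"
  proof -
    have "Lp_norm 2 (\<lambda>y. (\<Sum>i<N k. of_real (measure lebesgue (A k i)) * f k i y) - I y) = dist (J k) (abs_l2 I)" for k
    proof -
      note * = abs_l2_lincomb[of "N k" "f k" "\<lambda>i. measure lebesgue (A k i)", OF f1]
      show ?thesis
        unfolding J_def *(2)[symmetric] dist_norm using I *(1)
        by (simp add: norm_abs_l2[symmetric] Lp_2_diff abs_l2_diff)
    qed
    then show ?thesis using lim2 by (simp add: tendsto_dist_iff[symmetric])
  qed
  have int: "\<Psi> integrable_on {0..t}" unfolding \<Psi>_def by (rule integrable_continuous_real[OF \<Phi>])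
  have "z \<bullet> abs_l2 I = z \<bullet> integral {0..t} \<Psi>" for z
  proof -
    have \<Psi>_int: "integrable (lebesgue_on {0..t}) (\<lambda>\<tau>. z \<bullet> \<Psi> \<tau>)"
      unfolding \<Psi>_def by (intro continuous_imp_integrable_real continuous_intros \<Phi>)
    have s_has: "has_bochner_integral (lebesgue_on {0..t}) (\<lambda>\<tau>. z \<bullet> s k \<tau>) (z \<bullet> J k)" for k
    proof -
      have "has_bochner_integral (lebesgue_on {0..t}) (\<lambda>\<tau>. indicator (A k i) \<tau> * (z \<bullet> abs_l2 (f k i)))
          (measure lebesgue (A k i) * (z \<bullet> abs_l2 (f k i)))" if i: "i < N k" for i
      proof (rule has_bochner_integral_mult_left)
        have "has_bochner_integral (lebesgue_on {0..t}) (indicator (A k i) :: real \<Rightarrow> real) (measure (lebesgue_on {0..t}) (A k i))"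
          using Af(1-3)[OF i]
          by (intro has_bochner_integral_real_indicator) (auto simp: sets_restrict_space_iff emeasure_restrict_space)
        then show "has_bochner_integral (lebesgue_on {0..t}) (indicator (A k i)) (measure lebesgue (A k i))"
          using Af(2)[OF i] by (simp add: measure_restrict_space)
      qed
      then have "has_bochner_integral (lebesgue_on {0..t}) (\<lambda>\<tau>. \<Sum>i<N k. indicator (A k i) \<tau> * (z \<bullet> abs_l2 (f k i)))
          (\<Sum>i<N k. measure lebesgue (A k i) * (z \<bullet> abs_l2 (f k i)))"
        by (intro has_bochner_integral_sum) simp
      then show ?thesis by (simp add: s_def J_def inner_sum_right)
    qed
    \<comment> \<open>After pairing with \<open>z\<close> the integrand is a continuous real
      function, for which the Lebesgue and Henstock-Kurzweil integrals agree.\<close>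
    have hk: "integral\<^sup>L (lebesgue_on {0..t}) (\<lambda>\<tau>. z \<bullet> \<Psi> \<tau>) = z \<bullet> integral {0..t} \<Psi>"
    proof -
      have "integral\<^sup>L (lebesgue_on {0..t}) (\<lambda>\<tau>. z \<bullet> \<Psi> \<tau>) = integral {0..t} (\<lambda>\<tau>. z \<bullet> \<Psi> \<tau>)"
        by (rule lebesgue_integral_eq_integral[OF \<Psi>_int]) simp
      then show ?thesis using integral_linear[OF int bounded_linear_inner_right[of z]] by (simp add: o_def)
    qed
    have le: "ennreal (norm (z \<bullet> integral {0..t} \<Psi> - z \<bullet> J k))
        \<le> ennreal (norm z) * (\<integral>\<^sup>+ \<tau>. ennreal (ds N A f k \<tau>) \<partial>lebesgue_on {0..t})" for k
    proof -
      have s_int: "integrable (lebesgue_on {0..t}) (\<lambda>\<tau>. z \<bullet> s k \<tau>)"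
        "integral\<^sup>L (lebesgue_on {0..t}) (\<lambda>\<tau>. z \<bullet> s k \<tau>) = z \<bullet> J k"
        using s_has by (auto simp: has_bochner_integral_iff)
      have "z \<bullet> integral {0..t} \<Psi> - z \<bullet> J k = integral\<^sup>L (lebesgue_on {0..t}) (\<lambda>\<tau>. z \<bullet> \<Psi> \<tau> - z \<bullet> s k \<tau>)"
        using \<Psi>_int s_int by (simp add: hk)
      then have "ennreal (norm (z \<bullet> integral {0..t} \<Psi> - z \<bullet> J k))
          \<le> (\<integral>\<^sup>+ \<tau>. ennreal (norm (z \<bullet> \<Psi> \<tau> - z \<bullet> s k \<tau>)) \<partial>lebesgue_on {0..t})"
        using integral_norm_bound_ennreal[OF Bochner_Integration.integrable_diff[OF \<Psi>_int s_int(1)]] by simp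
      also have "\<dots> \<le> (\<integral>\<^sup>+ \<tau>. ennreal (norm z) * ennreal (ds N A f k \<tau>) \<partial>lebesgue_on {0..t})"
      proof (rule nn_integral_mono)
        fix \<tau> assume "\<tau> \<in> space (lebesgue_on {0..t})"
        then have \<tau>: "\<tau> \<in> {0..t}" by simp
        have "norm (z \<bullet> \<Psi> \<tau> - z \<bullet> s k \<tau>) \<le> norm z * ds N A f k \<tau>"
          unfolding ds[OF \<tau>] inner_diff_right[symmetric] real_norm_def by (rule Cauchy_Schwarz_ineq2)
        then show "ennreal (norm (z \<bullet> \<Psi> \<tau> - z \<bullet> s k \<tau>)) \<le> ennreal (norm z) * ennreal (ds N A f k \<tau>)"
          by (simp add: ds[OF \<tau>] ennreal_mult[symmetric] ennreal_leI)
      qed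
      also have "\<dots> = ennreal (norm z) * (\<integral>\<^sup>+ \<tau>. ennreal (ds N A f k \<tau>) \<partial>lebesgue_on {0..t})"
        using ds_meas[of k] by (intro nn_integral_cmult) measurable
      finally show ?thesis .
    qed
    have "(\<lambda>k. ennreal (norm z) * (\<integral>\<^sup>+ \<tau>. ennreal (ds N A f k \<tau>) \<partial>lebesgue_on {0..t})) \<longlonglongrightarrow> ennreal (norm z) * 0"
      by (intro ennreal_tendsto_cmult lim1) simp
    then have up: "(\<lambda>k. ennreal (norm z) * (\<integral>\<^sup>+ \<tau>. ennreal (ds N A f k \<tau>) \<partial>lebesgue_on {0..t})) \<longlonglongrightarrow> 0"
      by simp
    have "(\<lambda>k. ennreal (norm (z \<bullet> integral {0..t} \<Psi> - z \<bullet> J k))) \<longlonglongrightarrow> 0"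
      by (rule tendsto_sandwich[OF _ _ tendsto_const up]) (rule always_eventually, rule allI, rule zero_le le)+
    then have "(\<lambda>k. norm (z \<bullet> integral {0..t} \<Psi> - z \<bullet> J k)) \<longlonglongrightarrow> 0"
      using tendsto_ennreal_iff[of "\<lambda>k. norm (z \<bullet> integral {0..t} \<Psi> - z \<bullet> J k)" sequentially 0] by simp
    moreover have "(\<lambda>k. norm (z \<bullet> integral {0..t} \<Psi> - z \<bullet> J k)) \<longlonglongrightarrow> norm (z \<bullet> integral {0..t} \<Psi> - z \<bullet> abs_l2 I)"
      by (intro tendsto_intros J_lim)
    ultimately have "norm (z \<bullet> integral {0..t} \<Psi> - z \<bullet> abs_l2 I) = 0"
      using LIMSEQ_unique by blast
    then show ?thesis by simp
  qed
  then show ?thesis unfolding \<Psi>_def by (metis vector_eq_ldot)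
qed

section \<open>The nonlinearity\<close>

text \<open>The mean value theorem. The smaller argument 0 is treated apart, because
  \<open>powr\<close> is differentiated at positive points only.\<close>

lemma powr_diff_le:
  fixes a b p :: real
  assumes p: "1 < p" and "0 \<le> a" "0 \<le> b"
  shows "\<bar>a powr p - b powr p\<bar> \<le> p * \<bar>a - b\<bar> * (a powr (p - 1) + b powr (p - 1))"
proof -
  have *: "x powr p - y powr p \<le> p * (x - y) * x powr (p - 1)" if "0 \<le> y" "y < x" for x y :: real
  proof (cases "y = 0")
    case True
    have "x powr p = x * x powr (p - 1)"
      using that powr_add[of x 1 "p - 1"] by simp
    moreover have "1 * (x * x powr (p - 1)) \<le> p * (x * x powr (p - 1))"
      using that p by (intro mult_right_mono) auto
    ultimately show ?thesis using True by simp
  next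
    case False
    then have y: "0 < y" using that by simp
    have "\<exists>z. y < z \<and> z < x \<and> x powr p - y powr p = (x - y) * (p * z powr (p - 1))"
      by (rule MVT2[OF that(2)]) (use y in \<open>auto intro!: derivative_eq_intros\<close>)
    then obtain z where z: "y < z" "z < x" "x powr p - y powr p = (x - y) * (p * z powr (p - 1))" by blast
    have "z powr (p - 1) \<le> x powr (p - 1)" using z y p by (intro powr_mono2) auto
    then have "(x - y) * (p * z powr (p - 1)) \<le> (x - y) * (p * x powr (p - 1))"
      using that p by (intro mult_left_mono) auto
    then show ?thesis unfolding z(3) by (simp add: mult_ac)
  qed
  have pos: "x powr p - y powr p \<le> p * \<bar>x - y\<bar> * (x powr (p - 1) + y powr (p - 1))" if "0 \<le> y" "y < x" for x y
  proof -
    have "p * (x - y) * x powr (p - 1) \<le> p * (x - y) * (x powr (p - 1) + y powr (p - 1))"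
      using that p by (intro mult_left_mono) auto
    then show ?thesis using *[OF that] that by simp
  qed
  have mono: "y powr p \<le> x powr p" if "0 \<le> y" "y < x" for x y
    using that p by (intro powr_mono2) auto
  consider "a = b" | "b < a" | "a < b" by linarith
  then show ?thesis
  proof cases
    case 2
    then show ?thesis using pos[of b a] mono[of b a] assms by simp
  next
    case 3
    then show ?thesis using pos[of a b] mono[of a b] assms by (simp add: abs_minus_commute add.commute)
  qed simp
qed

text \<open>A crude form of Young's inequality: replace the smaller of \<open>x\<close> and
  \<open>y\<close> by the larger one.\<close>

lemma power2_mult_powr_le:
  fixes x y p :: real
  assumes "1 < p" "0 \<le> x" "0 \<le> y"
  shows "x\<^sup>2 * y powr (2 * p - 2) \<le> x powr (2 * p) + y powr (2 * p)"
proof -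
  have split: "z powr (2 * p) = z\<^sup>2 * z powr (2 * p - 2)" if "0 \<le> z" for z :: real
  proof (cases "z = 0")
    case False
    then have "z\<^sup>2 = z powr 2" using that by simp
    then show ?thesis by (simp add: powr_add[symmetric])
  qed (use assms in simp)
  show ?thesis
  proof (cases "y \<le> x")
    case True
    then have "x\<^sup>2 * y powr (2 * p - 2) \<le> x\<^sup>2 * x powr (2 * p - 2)"
      using assms by (intro mult_left_mono powr_mono2) auto
    then show ?thesis using split[of x] assms by (simp add: add_increasing2)
  next
    case False
    then have "x\<^sup>2 * y powr (2 * p - 2) \<le> y\<^sup>2 * y powr (2 * p - 2)"
      using assms by (intro mult_right_mono power_mono) auto
    then show ?thesis using split[of y] assms by (simp add: add_increasing)
  qed
qed

text \<open>A substitute for Hoelder's inequality. The free scale \<open>d\<close> balances the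
  difference against the two functions; with \<open>d\<close> equal to the norm of the difference,
  integration yields a bound linear in that norm.\<close>

lemma power_nonlinearity_le:
  fixes u v :: complex and p d :: real
  assumes p: "1 < p" and d: "0 < d"
  shows "(cmod u powr p - cmod v powr p)\<^sup>2
    \<le> 2 * p\<^sup>2 * d\<^sup>2 * (2 * d powr (- 2 * p) * cmod (u - v) powr (2 * p) + cmod u powr (2 * p) + cmod v powr (2 * p))"
proof -
  let ?a = "cmod u" and ?b = "cmod v" and ?c = "cmod (u - v)"
  have "\<bar>?a powr p - ?b powr p\<bar> \<le> p * \<bar>?a - ?b\<bar> * (?a powr (p - 1) + ?b powr (p - 1))"
    by (rule powr_diff_le[OF p]) auto
  also have "\<dots> \<le> p * ?c * (?a powr (p - 1) + ?b powr (p - 1))"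
    using p norm_triangle_ineq3[of u v] by (intro mult_right_mono mult_left_mono) auto
  finally have "(?a powr p - ?b powr p)\<^sup>2 \<le> (p * ?c * (?a powr (p - 1) + ?b powr (p - 1)))\<^sup>2"
    by (rule power2_le_iff_abs_le[THEN iffD2, rotated]) (use p in simp)
  also have "\<dots> = p\<^sup>2 * ?c\<^sup>2 * (?a powr (p - 1) + ?b powr (p - 1))\<^sup>2"
    by (simp add: power_mult_distrib)
  also have "\<dots> \<le> p\<^sup>2 * ?c\<^sup>2 * (2 * (?a powr (2 * p - 2) + ?b powr (2 * p - 2)))"
  proof (intro mult_left_mono)
    have sq: "(z powr (p - 1))\<^sup>2 = z powr (2 * p - 2)" for z :: real
      by (simp add: power2_eq_square powr_add[symmetric])
    show "(?a powr (p - 1) + ?b powr (p - 1))\<^sup>2 \<le> 2 * (?a powr (2 * p - 2) + ?b powr (2 * p - 2))"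
      using sum_squares_bound[of "?a powr (p - 1)" "?b powr (p - 1)"] unfolding power2_sum sq by simp
  qed simp
  also have "\<dots> = 2 * p\<^sup>2 * d\<^sup>2 * ((?c / d)\<^sup>2 * ?a powr (2 * p - 2) + (?c / d)\<^sup>2 * ?b powr (2 * p - 2))"
    using d by (simp add: power_divide field_simps)
  also have "\<dots> \<le> 2 * p\<^sup>2 * d\<^sup>2 * (((?c / d) powr (2 * p) + ?a powr (2 * p)) + ((?c / d) powr (2 * p) + ?b powr (2 * p)))"
    using d by (intro mult_left_mono add_mono power2_mult_powr_le[OF p]) auto
  also have "(?c / d) powr (2 * p) = d powr (- 2 * p) * ?c powr (2 * p)"
    using d by (subst powr_divide) (simp_all add: powr_minus field_simps)
  finally show ?thesis by (simp add: algebra_simps)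
qed

definition nonlin :: "real \<Rightarrow> real \<Rightarrow> 'n::finite l2 \<Rightarrow> 'n l2" where
  "nonlin a p w = abs_l2 (\<lambda>x. of_real (cmod (rep_l2 (bessel_pot a w) x) powr p))"

lemma power_nonlinearity_measurable:
  "f \<in> borel_measurable M \<Longrightarrow> (\<lambda>x. complex_of_real (cmod (f x) powr p)) \<in> borel_measurable M"
  by measurable

lemma power_nonlinearity_Lp_2:
  fixes f :: "real ^ 'n \<Rightarrow> complex"
  assumes p: "1 < p" and a: "0 \<le> a" "real CARD('n) * (1 - 1 / p) \<le> 2 * a"
    and f: "f \<in> Lp 2" "abs_l2 f = bessel_pot a w"
  shows "(\<lambda>x. of_real (cmod (f x) powr p)) \<in> Lp 2"
    and "abs_l2 (\<lambda>x. of_real (cmod (f x) powr p)) = nonlin a p w"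
proof -
  let ?u = "rep_l2 (bessel_pot a w)"
  have u: "(\<lambda>x. complex_of_real (cmod (?u x) powr p)) \<in> Lp 2"
  proof (rule Lp_2_I_nn)
    obtain C where C: "(\<integral>\<^sup>+x. ennreal (cmod (?u x) powr (2 * p)) \<partial>lebesgue) \<le> ennreal (C * norm w powr (2 * p))"
      using sobolev_embedding[OF p a] by blast
    have "(cmod (complex_of_real (cmod (?u x) powr p)))\<^sup>2 = cmod (?u x) powr (2 * p)" for x
      by (simp add: power2_eq_square powr_add[symmetric])
    then show "(\<integral>\<^sup>+x. ennreal ((cmod (complex_of_real (cmod (?u x) powr p)))\<^sup>2) \<partial>lebesgue) < \<infinity>"
      using C by (simp only:) (rule le_less_trans, assumption, simp)
  qed (intro power_nonlinearity_measurable Lp_2_D(1) rep_l2_Lp)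
  have "AE x in lebesgue. ?u x = f x"
    using rep_abs_l2[OF f(1)] f(2) by simp
  then have ae: "AE x in lebesgue. complex_of_real (cmod (?u x) powr p) = of_real (cmod (f x) powr p)"
    by eventually_elim simp
  show "(\<lambda>x. of_real (cmod (f x) powr p)) \<in> Lp 2" by (rule Lp_2_cong_AE[OF u ae])
  show "abs_l2 (\<lambda>x. of_real (cmod (f x) powr p)) = nonlin a p w"
    unfolding nonlin_def by (rule abs_l2_eqI[OF u ae, symmetric])
qed

text \<open>Integrate \<open>power_nonlinearity_le\<close> with \<open>d\<close> the distance of the
  arguments, and apply the Sobolev embedding to each of the three terms.\<close>

lemma nonlin_lipschitz:
  fixes a p :: real
  assumes p: "1 < p" and a: "0 \<le> a" "real CARD('n) * (1 - 1 / p) \<le> 2 * a"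
  shows "\<exists>L\<ge>0. \<forall>v w :: 'n::finite l2. norm v \<le> R \<longrightarrow> norm w \<le> R \<longrightarrow>
    norm (nonlin a p v - nonlin a p w) \<le> L * norm (v - w)"
proof -
  obtain C where C: "0 \<le> C"
    "\<And>w :: 'n l2. (\<integral>\<^sup>+x. ennreal (cmod (rep_l2 (bessel_pot a w) x) powr (2 * p)) \<partial>lebesgue)
      \<le> ennreal (C * norm w powr (2 * p))"
    using sobolev_embedding[OF p a] by blast
  define L where "L = 2 * p * sqrt (C * (1 + R powr (2 * p)))"
  have L: "0 \<le> L" using p C(1) by (simp add: L_def)
  have "norm (nonlin a p v - nonlin a p w) \<le> L * norm (v - w)"
    if vw: "norm v \<le> R" "norm w \<le> R" for v w :: "'n l2"
  proof (cases "v = w")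
    case False
    define d where "d = norm (v - w)"
    have d: "0 < d" using False by (simp add: d_def)
    let ?u = "\<lambda>w. rep_l2 (bessel_pot a w)"
    have [measurable]: "?u y \<in> borel_measurable lebesgue" for y :: "'n l2" by (rule Lp_2_D) simp
    note pw = power_nonlinearity_Lp_2[OF p a rep_l2_Lp abs_rep_l2]
    have u_diff: "AE x in lebesgue. ?u (v - w) x = ?u v x - ?u w x"
    proof -
      have "bessel_pot a (v - w) = abs_l2 (\<lambda>x. ?u v x - ?u w x)"
        by (simp add: abs_l2_diff[symmetric] linear_diff[OF bounded_linear.linear[OF bounded_linear_bessel_pot[OF a(1)]]])
      then show ?thesis
        using rep_abs_l2[OF Lp_2_diff[OF rep_l2_Lp[of "bessel_pot a v"] rep_l2_Lp[of "bessel_pot a w"]]] by simp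
    qed
    \<comment> \<open>The scale cancels in the term with the difference, leaving the factor squared
      \<open>d\<close> outside as the only dependence on the distance.\<close>
    have Cd: "2 * d powr (- 2 * p) * (C * d powr (2 * p)) = 2 * C"
      using d by (simp add: powr_minus)
    have CR: "(\<integral>\<^sup>+x. ennreal (cmod (?u y x) powr (2 * p)) \<partial>lebesgue) \<le> ennreal (C * R powr (2 * p))"
      if "norm y \<le> R" for y :: "'n l2"
    proof -
      have "C * norm y powr (2 * p) \<le> C * R powr (2 * p)"
        using that p C(1) by (intro mult_left_mono powr_mono2) auto
      then show ?thesis using C(2)[of y] by (meson ennreal_leI order_trans)
    qed
    have "ennreal ((norm (nonlin a p v - nonlin a p w))\<^sup>2)
        = (\<integral>\<^sup>+x. ennreal ((cmod (of_real (cmod (?u v x) powr p) - of_real (cmod (?u w x) powr p)))\<^sup>2) \<partial>lebesgue)"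
      unfolding nonlin_def using nn_integral_dist_l2[OF pw(1) pw(1), of v w] by (simp add: dist_norm)
    also have "\<dots> \<le> (\<integral>\<^sup>+x. ennreal (2 * p\<^sup>2 * d\<^sup>2) * (ennreal (2 * d powr (- 2 * p)) * ennreal (cmod (?u (v - w) x) powr (2 * p))
        + ennreal (cmod (?u v x) powr (2 * p)) + ennreal (cmod (?u w x) powr (2 * p))) \<partial>lebesgue)"
    proof (rule nn_integral_mono_AE)
      show "AE x in lebesgue. ennreal ((cmod (of_real (cmod (?u v x) powr p) - of_real (cmod (?u w x) powr p)))\<^sup>2)
          \<le> ennreal (2 * p\<^sup>2 * d\<^sup>2) * (ennreal (2 * d powr (- 2 * p)) * ennreal (cmod (?u (v - w) x) powr (2 * p))
            + ennreal (cmod (?u v x) powr (2 * p)) + ennreal (cmod (?u w x) powr (2 * p)))"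
        using u_diff
      proof eventually_elim
        case (elim x)
        have "(cmod (of_real (cmod (?u v x) powr p) - of_real (cmod (?u w x) powr p)))\<^sup>2
            = (cmod (?u v x) powr p - cmod (?u w x) powr p)\<^sup>2"
          by (simp flip: of_real_diff)
        also have "ennreal \<dots> \<le> ennreal (2 * p\<^sup>2 * d\<^sup>2 * (2 * d powr (- 2 * p) * cmod (?u v x - ?u w x) powr (2 * p)
            + cmod (?u v x) powr (2 * p) + cmod (?u w x) powr (2 * p)))"
          by (intro ennreal_leI power_nonlinearity_le p d)
        also have "\<dots> = ennreal (2 * p\<^sup>2 * d\<^sup>2) * (ennreal (2 * d powr (- 2 * p)) * ennreal (cmod (?u (v - w) x) powr (2 * p))
            + ennreal (cmod (?u v x) powr (2 * p)) + ennreal (cmod (?u w x) powr (2 * p)))"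
          unfolding elim by (simp add: ennreal_mult ennreal_plus)
        finally show ?case .
      qed
    qed
    also have "\<dots> = ennreal (2 * p\<^sup>2 * d\<^sup>2) * (ennreal (2 * d powr (- 2 * p)) * (\<integral>\<^sup>+x. ennreal (cmod (?u (v - w) x) powr (2 * p)) \<partial>lebesgue)
        + (\<integral>\<^sup>+x. ennreal (cmod (?u v x) powr (2 * p)) \<partial>lebesgue) + (\<integral>\<^sup>+x. ennreal (cmod (?u w x) powr (2 * p)) \<partial>lebesgue))"
      by (simp add: nn_integral_cmult nn_integral_add)
    also have "\<dots> \<le> ennreal (2 * p\<^sup>2 * d\<^sup>2) * (ennreal (2 * d powr (- 2 * p)) * ennreal (C * d powr (2 * p))
        + ennreal (C * R powr (2 * p)) + ennreal (C * R powr (2 * p)))"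
      using C(2)[of "v - w"] vw by (intro mult_left_mono add_mono CR) (auto simp: d_def)
    also have "\<dots> = ennreal (2 * p\<^sup>2 * d\<^sup>2 * (2 * d powr (- 2 * p) * (C * d powr (2 * p)) + C * R powr (2 * p) + C * R powr (2 * p)))"
    proof -
      have "ennreal x * (ennreal y * ennreal z + ennreal r + ennreal r) = ennreal (x * (y * z + r + r))"
        if "0 \<le> x" "0 \<le> y" "0 \<le> z" "0 \<le> r" for x y z r :: real
        using that by (simp only: ennreal_mult' ennreal_plus add_nonneg_nonneg mult_nonneg_nonneg)
      then show ?thesis using C(1) by simp
    qed
    also have "2 * p\<^sup>2 * d\<^sup>2 * (2 * d powr (- 2 * p) * (C * d powr (2 * p)) + C * R powr (2 * p) + C * R powr (2 * p)) = (L * d)\<^sup>2"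
      unfolding Cd using C(1) by (simp add: L_def power_mult_distrib algebra_simps)
    finally have "(norm (nonlin a p v - nonlin a p w))\<^sup>2 \<le> (L * d)\<^sup>2"
      by (subst (asm) ennreal_le_iff) auto
    then show ?thesis unfolding d_def[symmetric] by (rule power2_le_imp_le) (use L d in simp)
  qed simp
  then show ?thesis using L by blast
qed

section \<open>Continuity in time\<close>

lemma continuous_into_Hs_iff:
  assumes "0 \<le> a"
  shows "continuous_into_Hs a S u \<longleftrightarrow> (\<forall>t\<in>S. u t \<in> Hs a) \<and> continuous_on S (\<lambda>t. abs_l2 (bessel_weight a (u t)))"
proof (cases "\<forall>t\<in>S. u t \<in> Hs a")
  case True
  let ?w = "\<lambda>t. abs_l2 (bessel_weight a (u t))"
  let ?c = "(2 * pi) powr (- real CARD('a) / 2)"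
  have c: "?c \<noteq> 0" by simp
  have "((\<lambda>s. Hs_norm a (\<lambda>x. u s x - u t x)) \<longlongrightarrow> 0) (at t within S) \<longleftrightarrow> (?w \<longlongrightarrow> ?w t) (at t within S)"
    if t: "t \<in> S" for t
  proof -
    have eq: "Hs_norm a (\<lambda>x. u s x - u t x) = ?c * dist (?w s) (?w t)" if s: "s \<in> S" for s
    proof -
      note h = Hs_diff[OF assms True[rule_format, OF s] True[rule_format, OF t]]
      have "bessel_weight a (\<lambda>x. u s x - u t x) \<in> Lp 2" using h(1) by (simp add: Hs_def)
      then show ?thesis by (simp add: Hs_norm_def norm_abs_l2[symmetric] h(2) dist_norm)
    qed
    have "((\<lambda>s. Hs_norm a (\<lambda>x. u s x - u t x)) \<longlongrightarrow> 0) (at t within S)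
        \<longleftrightarrow> ((\<lambda>s. ?c * dist (?w s) (?w t)) \<longlongrightarrow> 0) (at t within S)"
      by (rule tendsto_cong) (use eq in \<open>auto simp: eventually_at_filter\<close>)
    also have "\<dots> \<longleftrightarrow> ((\<lambda>s. dist (?w s) (?w t)) \<longlongrightarrow> 0) (at t within S)"
      using tendsto_mult_left_iff[OF c, of "\<lambda>s. dist (?w s) (?w t)" 0] by simp
    finally show ?thesis by (simp only: tendsto_dist_iff[symmetric])
  qed
  then show ?thesis using True by (simp add: continuous_into_Hs_def continuous_on_def)
qed (auto simp: continuous_into_Hs_def)

lemma mul_continuous_on:
  assumes k: "\<And>t. t \<in> S \<Longrightarrow> bounded_multiplier (k t) C"
    and cont: "\<And>\<xi>. continuous_on S (\<lambda>t. k t \<xi>)"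
  shows "continuous_on (S :: real set) (\<lambda>t. mul (k t) y)"
  unfolding continuous_on_sequentially o_def
proof (intro allI ballI impI)
  fix x :: "nat \<Rightarrow> real" and t
  assume t: "t \<in> S" and x: "(\<forall>n. x n \<in> S) \<and> x \<longlonglongrightarrow> t"
  show "(\<lambda>n. mul (k (x n)) y) \<longlonglongrightarrow> mul (k t) y"
  proof (rule mul_tendsto)
    show "(\<lambda>i. k (x i) \<xi>) \<longlonglongrightarrow> k t \<xi>" for \<xi>
      using cont[of \<xi>] t x unfolding continuous_on_sequentially o_def by blast
  qed (use k t x in auto)
qed

section \<open>Local well-posedness\<close>

text \<open>\<open>subcritical\<close> is the condition under which \<open>H^\<sigma>\<close> embeds
  in \<open>L^(2p)\<close>; equality is the critical exponent.\<close>

locale semilinear_problem =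
  fixes \<sigma> \<sigma>1 \<sigma>2 p :: real and u0 u1 :: "real ^ 'n \<Rightarrow> complex"
  assumes \<sigma>: "0 \<le> \<sigma>" and p: "1 < p" and subcritical: "real CARD('n) * (1 - 1 / p) \<le> 2 * \<sigma>"
    and u0: "u0 \<in> Hs \<sigma>" and u1: "u1 \<in> Lp 2"
begin

lemma K1_weighted_continuous_on:
  "continuous_on {0..1} (\<lambda>t. mul (K1_weighted \<sigma> \<sigma>1 \<sigma>2 t :: real ^ 'n \<Rightarrow> complex) y)"
proof (rule mul_continuous_on)
  show "bounded_multiplier (K1_weighted \<sigma> \<sigma>1 \<sigma>2 t :: real ^ 'n \<Rightarrow> complex) (2 * 2 powr (\<sigma> / 2))" if "t \<in> {0..1}" for t
    using that \<sigma> by (intro K1_weighted_multiplier) auto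
  show "continuous_on {0..1} (\<lambda>t. K1_weighted \<sigma> \<sigma>1 \<sigma>2 t \<xi>)" for \<xi> :: "real ^ 'n"
    unfolding K1_weighted_def
    by (intro continuous_on_mult_left continuous_on_subset[OF K_hat_continuous(2)]) simp
qed

text \<open>\<open>nonlin\<close> yields a class in physical space while the unknown is on the
  Fourier side. Each operator therefore includes an \<open>FT\<close>, whose norm is the last factor
  of the constant.\<close>

sublocale volterra "\<lambda>t y. mul (K1_weighted \<sigma> \<sigma>1 \<sigma>2 t) (FT y)" "nonlin \<sigma> p :: 'n l2 \<Rightarrow> 'n l2"
  "2 * 2 powr (\<sigma> / 2) * sqrt (2 * pi) ^ CARD('n)"
proof (rule volterra.intro)
  show "bounded_linear (\<lambda>y :: 'n l2. mul (K1_weighted \<sigma> \<sigma>1 \<sigma>2 t) (FT y))" if t: "0 \<le> t" "t \<le> 1" for t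
    by (rule bounded_linear_compose[OF bounded_linear_mul[OF K1_weighted_multiplier[OF t \<sigma>]] bounded_linear_FT])
  show "norm (mul (K1_weighted \<sigma> \<sigma>1 \<sigma>2 t) (FT y)) \<le> 2 * 2 powr (\<sigma> / 2) * sqrt (2 * pi) ^ CARD('n) * norm y"
    if t: "0 \<le> t" "t \<le> 1" for t and y :: "'n l2"
    using norm_mul_le[OF K1_weighted_multiplier[OF t \<sigma>], of \<sigma>1 \<sigma>2 "FT y"] by (simp only: norm_FT mult.assoc)
  show "continuous_on {0..1} (\<lambda>t. mul (K1_weighted \<sigma> \<sigma>1 \<sigma>2 t) (FT y))" for y :: "'n l2"
    by (rule K1_weighted_continuous_on)
  show "\<exists>L\<ge>0. \<forall>v w :: 'n l2. norm v \<le> R \<longrightarrow> norm w \<le> R \<longrightarrow> norm (nonlin \<sigma> p v - nonlin \<sigma> p w) \<le> L * norm (v - w)" for R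
    by (rule nonlin_lipschitz[OF p \<sigma> subcritical])
qed simp

text \<open>The weighted transform of the solution of the linear equation.
  \<open>bessel_weight\<close> already contains the transform of \<open>u0\<close>, while
  \<open>u1\<close> still needs \<open>FT\<close>.\<close>

definition linear_part :: "real \<Rightarrow> real \<Rightarrow> 'n l2" where
  "linear_part \<epsilon> t = \<epsilon> *\<^sub>R mul (K0_hat \<sigma> \<sigma>1 \<sigma>2 t) (abs_l2 (bessel_weight \<sigma> u0))
     + \<epsilon> *\<^sub>R mul (K1_weighted \<sigma> \<sigma>1 \<sigma>2 t) (FT (abs_l2 u1))"

lemma linear_part_continuous_on: "continuous_on {0..1} (linear_part \<epsilon>)"
proof -
  have "continuous_on {0..1} (\<lambda>t. mul (K0_hat \<sigma> \<sigma>1 \<sigma>2 t :: real ^ 'n \<Rightarrow> complex) y)" for y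
    by (rule mul_continuous_on[where C=1])
       (auto intro: K0_hat_multiplier continuous_on_subset[OF K_hat_continuous(1)])
  then show ?thesis
    unfolding linear_part_def[abs_def] by (intro continuous_intros K1_weighted_continuous_on)
qed

lemma norm_linear_part:
  assumes t: "0 \<le> t" "t \<le> 1" and \<epsilon>: "0 \<le> \<epsilon>" "\<epsilon> \<le> 1"
  shows "norm (linear_part \<epsilon> t) \<le> norm (abs_l2 (bessel_weight \<sigma> u0)) + 2 * 2 powr (\<sigma> / 2) * norm (FT (abs_l2 u1))"
proof -
  let ?a = "mul (K0_hat \<sigma> \<sigma>1 \<sigma>2 t) (abs_l2 (bessel_weight \<sigma> u0))"
  let ?b = "mul (K1_weighted \<sigma> \<sigma>1 \<sigma>2 t) (FT (abs_l2 u1))"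
  have "norm (linear_part \<epsilon> t) \<le> \<epsilon> * norm ?a + \<epsilon> * norm ?b"
    unfolding linear_part_def using norm_triangle_ineq[of "\<epsilon> *\<^sub>R ?a" "\<epsilon> *\<^sub>R ?b"] \<epsilon> by simp
  also have "\<dots> \<le> 1 * norm ?a + 1 * norm ?b"
    using \<epsilon> by (intro add_mono mult_right_mono) auto
  also have "\<dots> \<le> norm (abs_l2 (bessel_weight \<sigma> u0)) + 2 * 2 powr (\<sigma> / 2) * norm (FT (abs_l2 u1))"
    using norm_mul_le[OF K0_hat_multiplier[OF t(1)]] norm_mul_le[OF K1_weighted_multiplier[OF t \<sigma>]]
    by (intro add_mono) auto
  finally show ?thesis .
qed

text \<open>The symbol of \<open>K0\<close> is only bounded, so the weight stays on
  \<open>u0\<close>, which lies in \<open>H^\<sigma>\<close>; the multipliers commute.\<close>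

lemma bessel_pot_K0:
  assumes "0 \<le> t"
  shows "kernel_conv (K0_hat \<sigma> \<sigma>1 \<sigma>2 t) u0 \<in> Lp 2"
    and "abs_l2 (kernel_conv (K0_hat \<sigma> \<sigma>1 \<sigma>2 t) u0)
      = bessel_pot \<sigma> (mul (K0_hat \<sigma> \<sigma>1 \<sigma>2 t) (abs_l2 (bessel_weight \<sigma> u0)))"
proof -
  have L: "u0 \<in> Lp 2" using u0 by (simp add: Hs_def)
  note k = K0_hat_multiplier[OF assms, where 'a='n] and b = bessel_inv_multiplier[OF \<sigma>, where 'a='n]
  note c = kernel_conv_l2[OF k L]
  show "kernel_conv (K0_hat \<sigma> \<sigma>1 \<sigma>2 t) u0 \<in> Lp 2" by (rule c)
  have "FT (abs_l2 u0) = mul (bessel_inv \<sigma>) (abs_l2 (bessel_weight \<sigma> u0))"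
    unfolding Hs_bessel_pot[OF \<sigma> u0, symmetric] bessel_pot_def FT_IFT ..
  then show "abs_l2 (kernel_conv (K0_hat \<sigma> \<sigma>1 \<sigma>2 t) u0)
      = bessel_pot \<sigma> (mul (K0_hat \<sigma> \<sigma>1 \<sigma>2 t) (abs_l2 (bessel_weight \<sigma> u0)))"
    unfolding c(2) bessel_pot_def by (simp only: mul_mul[OF k b] mul_mul[OF b k] mult.commute)
qed

text \<open>Here the weight is carried by the kernel. A source merely in \<open>L^2\<close> thus
  contributes an element of \<open>H^\<sigma>\<close>.\<close>

lemma bessel_pot_K1:
  assumes "0 \<le> t" "t \<le> 1" and f: "f \<in> Lp 2"
  shows "kernel_conv (K1_hat \<sigma> \<sigma>1 \<sigma>2 t) f \<in> Lp 2"
    and "abs_l2 (kernel_conv (K1_hat \<sigma> \<sigma>1 \<sigma>2 t) f)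
      = bessel_pot \<sigma> (mul (K1_weighted \<sigma> \<sigma>1 \<sigma>2 t) (FT (abs_l2 (f :: real ^ 'n \<Rightarrow> complex))))"
proof -
  note k = K1_hat_multiplier[OF assms(1)] and b = bessel_inv_multiplier[OF \<sigma>]
    and w = K1_weighted_multiplier[OF assms(1,2) \<sigma>]
  note c = kernel_conv_l2[OF k f]
  show "kernel_conv (K1_hat \<sigma> \<sigma>1 \<sigma>2 t) f \<in> Lp 2" by (rule c)
  show "abs_l2 (kernel_conv (K1_hat \<sigma> \<sigma>1 \<sigma>2 t) f)
      = bessel_pot \<sigma> (mul (K1_weighted \<sigma> \<sigma>1 \<sigma>2 t) (FT (abs_l2 f)))"
    unfolding c(2) bessel_pot_def by (simp only: mul_mul[OF b w] bessel_inv_K1_weighted)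
qed

lemma linear_part_bessel_pot:
  fixes \<epsilon> :: real
  assumes t: "0 \<le> t" "t \<le> 1"
  defines "g \<equiv> \<lambda>x. of_real \<epsilon> * kernel_conv (K0_hat \<sigma> \<sigma>1 \<sigma>2 t) u0 x + of_real \<epsilon> * kernel_conv (K1_hat \<sigma> \<sigma>1 \<sigma>2 t) u1 x"
  shows "g \<in> Lp 2" "abs_l2 g = bessel_pot \<sigma> (linear_part \<epsilon> t)"
proof -
  note c0 = bessel_pot_K0[OF t(1)] and c1 = bessel_pot_K1[OF t u1]
  note L = Lp_2_mult_const[OF c0(1), of "of_real \<epsilon>"] Lp_2_mult_const[OF c1(1), of "of_real \<epsilon>"]
  show "g \<in> Lp 2" unfolding g_def by (rule Lp_2_add[OF L])
  note lin = bounded_linear.linear[OF bounded_linear_bessel_pot[OF \<sigma>, where 'a='n]]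
  have "abs_l2 g = \<epsilon> *\<^sub>R abs_l2 (kernel_conv (K0_hat \<sigma> \<sigma>1 \<sigma>2 t) u0) + \<epsilon> *\<^sub>R abs_l2 (kernel_conv (K1_hat \<sigma> \<sigma>1 \<sigma>2 t) u1)"
    unfolding g_def abs_l2_add[OF L, symmetric] by (simp add: abs_l2_scaleR c0(1) c1(1) scaleR_conv_of_real)
  then show "abs_l2 g = bessel_pot \<sigma> (linear_part \<epsilon> t)"
    unfolding c0(2) c1(2) linear_part_def by (simp add: linear_add[OF lin] linear_scale[OF lin])
qed

text \<open>In terms of \<open>w = (1 - \<Delta>)\<^bsup>\<sigma>/2\<^esup> u\<close> (on the Fourier side), Duhamel's formula is a Volterra
  equation in \<open>L\<^sup>2\<close>.\<close>

context
  fixes u :: "real \<Rightarrow> real ^ 'n \<Rightarrow> complex" and w :: "real \<Rightarrow> 'n l2" and T :: real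
  assumes T: "T \<le> 1"
    and u: "\<And>t. t \<in> {0..<T} \<Longrightarrow> u t \<in> Lp 2" "\<And>t. t \<in> {0..<T} \<Longrightarrow> abs_l2 (u t) = bessel_pot \<sigma> (w t)"
    and w: "continuous_on {0..<T} w"
begin

abbreviation (input) source :: "real \<Rightarrow> real \<Rightarrow> real ^ 'n \<Rightarrow> complex" where
  "source t \<tau> \<equiv> kernel_conv (K1_hat \<sigma> \<sigma>1 \<sigma>2 (t - \<tau>)) (\<lambda>x. of_real (cmod (u \<tau> x) powr p))"

lemma power_Lp_2: "t \<in> {0..<T} \<Longrightarrow> (\<lambda>x. of_real (cmod (u t x) powr p)) \<in> Lp 2"
  by (rule power_nonlinearity_Lp_2(1)[OF p \<sigma> subcritical u])

lemma source_l2: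
  assumes t: "t \<in> {0..<T}" and \<tau>: "\<tau> \<in> {0..t}"
  shows "source t \<tau> \<in> Lp 2"
    and "abs_l2 (source t \<tau>) = bessel_pot \<sigma> (mul (K1_weighted \<sigma> \<sigma>1 \<sigma>2 (t - \<tau>)) (FT (nonlin \<sigma> p (w \<tau>))))"
proof -
  have \<tau>T: "\<tau> \<in> {0..<T}" and ts: "0 \<le> t - \<tau>" "t - \<tau> \<le> 1" using t \<tau> T by auto
  note c = bessel_pot_K1[OF ts power_Lp_2[OF \<tau>T]]
  show "source t \<tau> \<in> Lp 2" by (rule c)
  show "abs_l2 (source t \<tau>) = bessel_pot \<sigma> (mul (K1_weighted \<sigma> \<sigma>1 \<sigma>2 (t - \<tau>)) (FT (nonlin \<sigma> p (w \<tau>))))"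
    unfolding c(2) power_nonlinearity_Lp_2(2)[OF p \<sigma> subcritical u(1)[OF \<tau>T] u(2)[OF \<tau>T]] ..
qed

lemma source_integral:
  assumes t: "t \<in> {0..<T}"
  defines "\<Phi> \<equiv> \<lambda>\<tau>. bessel_pot \<sigma> (mul (K1_weighted \<sigma> \<sigma>1 \<sigma>2 (t - \<tau>)) (FT (nonlin \<sigma> p (w \<tau>))))"
  shows "continuous_on {0..t} \<Phi>" "integral {0..t} \<Phi> = bessel_pot \<sigma> (V w t)"
proof -
  have t1: "t \<le> 1" using t T by auto
  have wt: "continuous_on {0..t} w" using w t by (auto intro: continuous_on_subset)
  note bl = bounded_linear_bessel_pot[OF \<sigma>, where 'a='n]
  show "continuous_on {0..t} \<Phi>"
    unfolding \<Phi>_def by (rule bounded_linear.continuous_on[OF bl integrand_cont[OF wt t1]])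
  show "integral {0..t} \<Phi> = bessel_pot \<sigma> (V w t)"
    using integral_linear[OF integrand_integrable[OF wt t1] bl] by (simp add: V_def \<Phi>_def o_def)
qed

text \<open>The Bochner integral is characterized by its class in both directions, so the
  almost-everywhere identity is an equation in \<open>l2\<close>, from which the injective linear
  map \<open>bessel_pot \<sigma>\<close> can be removed.\<close>

lemma duhamel_iff_volterra:
  assumes t: "t \<in> {0..<T}"
  shows "(\<exists>I. has_L2_bochner_integral (source t) {0..t} I \<and>
      (AE x in lebesgue. u t x = of_real \<epsilon> * kernel_conv (K0_hat \<sigma> \<sigma>1 \<sigma>2 t) u0 x
         + of_real \<epsilon> * kernel_conv (K1_hat \<sigma> \<sigma>1 \<sigma>2 t) u1 x + I x))
    \<longleftrightarrow> w t = linear_part \<epsilon> t + V w t"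
proof -
  have t1: "0 \<le> t" "t \<le> 1" using t T by auto
  note g = linear_part_bessel_pot[OF t1, of \<epsilon>]
  note bl = bounded_linear_bessel_pot[OF \<sigma>, where 'a='n]
  have cont: "continuous_on {0..t} (\<lambda>\<tau>. abs_l2 (source t \<tau>))"
    by (rule continuous_on_eq[OF source_integral(1)[OF t]]) (rule source_l2(2)[OF t, symmetric])
  have int: "integral {0..t} (\<lambda>\<tau>. abs_l2 (source t \<tau>)) = bessel_pot \<sigma> (V w t)"
    unfolding source_integral(2)[OF t, symmetric]
    by (rule Henstock_Kurzweil_Integration.integral_cong) (rule source_l2(2)[OF t])
  have bochner: "has_L2_bochner_integral (source t) {0..t} I \<longleftrightarrow> I \<in> Lp 2 \<and> abs_l2 I = bessel_pot \<sigma> (V w t)" for I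
  proof
    assume I: "has_L2_bochner_integral (source t) {0..t} I"
    have "I \<in> Lp 2" using I unfolding has_L2_bochner_integral_def by blast
    then show "I \<in> Lp 2 \<and> abs_l2 I = bessel_pot \<sigma> (V w t)"
      using has_L2_bochner_integral_unique[OF I cont] int by simp
  next
    assume "I \<in> Lp 2 \<and> abs_l2 I = bessel_pot \<sigma> (V w t)"
    then show "has_L2_bochner_integral (source t) {0..t} I"
      by (intro has_L2_bochner_integral_continuous[OF source_l2(1)[OF t] refl cont t1(1)]) (simp_all add: int)
  qed
  have ae: "(AE x in lebesgue. u t x = of_real \<epsilon> * kernel_conv (K0_hat \<sigma> \<sigma>1 \<sigma>2 t) u0 x
         + of_real \<epsilon> * kernel_conv (K1_hat \<sigma> \<sigma>1 \<sigma>2 t) u1 x + I x) \<longleftrightarrow> w t = linear_part \<epsilon> t + V w t"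
    if I: "I \<in> Lp 2" "abs_l2 I = bessel_pot \<sigma> (V w t)" for I
  proof -
    have "(AE x in lebesgue. u t x = of_real \<epsilon> * kernel_conv (K0_hat \<sigma> \<sigma>1 \<sigma>2 t) u0 x
         + of_real \<epsilon> * kernel_conv (K1_hat \<sigma> \<sigma>1 \<sigma>2 t) u1 x + I x)
        \<longleftrightarrow> abs_l2 (u t) = bessel_pot \<sigma> (linear_part \<epsilon> t) + bessel_pot \<sigma> (V w t)"
      unfolding g(2)[symmetric] I(2)[symmetric] abs_l2_add[OF g(1) I(1)]
      by (rule abs_l2_eq_iff[OF u(1)[OF t] Lp_2_add[OF g(1) I(1)], symmetric])
    also have "\<dots> \<longleftrightarrow> bessel_pot \<sigma> (w t) = bessel_pot \<sigma> (linear_part \<epsilon> t + V w t)"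
      unfolding u(2)[OF t] linear_add[OF bounded_linear.linear[OF bl]] ..
    also have "\<dots> \<longleftrightarrow> w t = linear_part \<epsilon> t + V w t"
      by (rule iffI) (erule bessel_pot_inj[OF \<sigma>], erule arg_cong)
    finally show ?thesis .
  qed
  show ?thesis
  proof
    assume "\<exists>I. has_L2_bochner_integral (source t) {0..t} I \<and>
      (AE x in lebesgue. u t x = of_real \<epsilon> * kernel_conv (K0_hat \<sigma> \<sigma>1 \<sigma>2 t) u0 x
         + of_real \<epsilon> * kernel_conv (K1_hat \<sigma> \<sigma>1 \<sigma>2 t) u1 x + I x)"
    then show "w t = linear_part \<epsilon> t + V w t" using bochner ae by auto
  next
    assume eq: "w t = linear_part \<epsilon> t + V w t"
    show "\<exists>I. has_L2_bochner_integral (source t) {0..t} I \<and>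
      (AE x in lebesgue. u t x = of_real \<epsilon> * kernel_conv (K0_hat \<sigma> \<sigma>1 \<sigma>2 t) u0 x
         + of_real \<epsilon> * kernel_conv (K1_hat \<sigma> \<sigma>1 \<sigma>2 t) u1 x + I x)"
    proof (intro exI conjI)
      show "has_L2_bochner_integral (source t) {0..t} (rep_l2 (bessel_pot \<sigma> (V w t)))"
        unfolding bochner by simp
      show "AE x in lebesgue. u t x = of_real \<epsilon> * kernel_conv (K0_hat \<sigma> \<sigma>1 \<sigma>2 t) u0 x
         + of_real \<epsilon> * kernel_conv (K1_hat \<sigma> \<sigma>1 \<sigma>2 t) u1 x + rep_l2 (bessel_pot \<sigma> (V w t)) x"
        unfolding ae[OF rep_l2_Lp abs_rep_l2] by (rule eq)
    qed
  qed
qed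

end

lemma duhamel_solution_imp_volterra:
  assumes T: "T \<le> 1" and sol: "duhamel_solution \<sigma> \<sigma>1 \<sigma>2 p T \<epsilon> u0 u1 u"
  defines "w \<equiv> \<lambda>t. abs_l2 (bessel_weight \<sigma> (u t))"
  shows "continuous_on {0..<T} w" "\<And>t. t \<in> {0..<T} \<Longrightarrow> w t = linear_part \<epsilon> t + V w t"
    "\<And>t. t \<in> {0..<T} \<Longrightarrow> u t \<in> Lp 2" "\<And>t. t \<in> {0..<T} \<Longrightarrow> abs_l2 (u t) = bessel_pot \<sigma> (w t)"
proof -
  have Hs: "u t \<in> Hs \<sigma>" if "t \<in> {0..<T}" for t
    using sol that unfolding duhamel_solution_def continuous_into_Hs_iff[OF \<sigma>] by blast
  show w: "continuous_on {0..<T} w"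
    using sol unfolding duhamel_solution_def continuous_into_Hs_iff[OF \<sigma>] w_def by blast
  show uL: "u t \<in> Lp 2" if "t \<in> {0..<T}" for t
    using Hs[OF that] by (simp add: Hs_def)
  show uw: "abs_l2 (u t) = bessel_pot \<sigma> (w t)" if "t \<in> {0..<T}" for t
    unfolding w_def by (rule Hs_bessel_pot[OF \<sigma> Hs[OF that], symmetric])
  show "w t = linear_part \<epsilon> t + V w t" if t: "t \<in> {0..<T}" for t
    using duhamel_iff_volterra[OF T uL uw w t, of \<epsilon>] sol t unfolding duhamel_solution_def by blast
qed

lemma volterra_imp_duhamel_solution:
  assumes T: "T \<le> 1" and w: "continuous_on {0..<T} w" "\<And>t. t \<in> {0..<T} \<Longrightarrow> w t = linear_part \<epsilon> t + V w t"
  shows "duhamel_solution \<sigma> \<sigma>1 \<sigma>2 p T \<epsilon> u0 u1 (\<lambda>t. rep_l2 (bessel_pot \<sigma> (w t)))"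
proof -
  let ?u = "\<lambda>t. rep_l2 (bessel_pot \<sigma> (w t))"
  note H = bessel_pot_Hs[OF \<sigma> rep_l2_Lp abs_rep_l2]
  have "continuous_into_Hs \<sigma> {0..<T} ?u"
    unfolding continuous_into_Hs_iff[OF \<sigma>] H(2) using H(1) w(1) by blast
  moreover have "(\<lambda>x. of_real (cmod (?u t x) powr p)) \<in> Lp 2" for t
    by (rule power_nonlinearity_Lp_2(1)[OF p \<sigma> subcritical rep_l2_Lp abs_rep_l2])
  ultimately show ?thesis
    unfolding duhamel_solution_def
    using duhamel_iff_volterra[OF T rep_l2_Lp abs_rep_l2 w(1), of _ \<epsilon>] w(2) by blast
qed

text \<open>\<open>A\<close> bounds the linear part for all \<epsilon> up to 1 at once, so
  \<open>local_existence\<close> provides a single \<open>T\<close> for the whole range.\<close>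

theorem local_well_posedness:
  "\<exists>T>0. \<forall>\<epsilon>\<in>{0<..1}.
    (\<exists>u. duhamel_solution \<sigma> \<sigma>1 \<sigma>2 p T \<epsilon> u0 u1 u) \<and>
    (\<forall>u v. duhamel_solution \<sigma> \<sigma>1 \<sigma>2 p T \<epsilon> u0 u1 u \<and> duhamel_solution \<sigma> \<sigma>1 \<sigma>2 p T \<epsilon> u0 u1 v \<longrightarrow>
      (\<forall>t\<in>{0..<T}. AE x in lebesgue. u t x = v t x))"
proof -
  define A where "A = norm (abs_l2 (bessel_weight \<sigma> u0)) + 2 * 2 powr (\<sigma> / 2) * norm (FT (abs_l2 u1))"
  have "0 \<le> A" by (simp add: A_def)
  from local_existence[OF this] obtain T where T: "0 < T" "T \<le> 1"
    and ex: "\<And>a. continuous_on {0..T} a \<Longrightarrow> \<forall>t\<in>{0..T}. norm (a t) \<le> A \<Longrightarrow>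
      \<exists>w. continuous_on {0..T} w \<and> (\<forall>t\<in>{0..T}. w t = a t + V w t)" by blast
  have "\<exists>u. duhamel_solution \<sigma> \<sigma>1 \<sigma>2 p T \<epsilon> u0 u1 u" if \<epsilon>: "\<epsilon> \<in> {0<..1}" for \<epsilon>
  proof -
    have "continuous_on {0..T} (linear_part \<epsilon>)"
      by (rule continuous_on_subset[OF linear_part_continuous_on]) (use T in auto)
    moreover have "\<forall>t\<in>{0..T}. norm (linear_part \<epsilon> t) \<le> A"
      unfolding A_def using T \<epsilon> by (intro ballI norm_linear_part) auto
    ultimately obtain w where w: "continuous_on {0..T} w" "\<forall>t\<in>{0..T}. w t = linear_part \<epsilon> t + V w t"
      using ex by blast
    have "continuous_on {0..<T} w" by (rule continuous_on_subset[OF w(1)]) auto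
    moreover have "w t = linear_part \<epsilon> t + V w t" if "t \<in> {0..<T}" for t using w(2) that by auto
    ultimately show ?thesis using volterra_imp_duhamel_solution[OF T(2)] by blast
  qed
  moreover have "AE x in lebesgue. u t x = v t x"
    if u: "duhamel_solution \<sigma> \<sigma>1 \<sigma>2 p T \<epsilon> u0 u1 u" and v: "duhamel_solution \<sigma> \<sigma>1 \<sigma>2 p T \<epsilon> u0 u1 v"
      and t: "t \<in> {0..<T}" for \<epsilon> u v t
  proof -
    note U = duhamel_solution_imp_volterra[OF T(2) u] and V = duhamel_solution_imp_volterra[OF T(2) v]
    have "abs_l2 (bessel_weight \<sigma> (u t)) = abs_l2 (bessel_weight \<sigma> (v t))"
      by (rule uniqueness[OF T(2) U(1,2) V(1,2) t])
    then have "abs_l2 (u t) = abs_l2 (v t)" using U(4)[OF t] V(4)[OF t] by simp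
    then show ?thesis using abs_l2_eq_iff[OF U(3)[OF t] V(3)[OF t]] by blast
  qed
  ultimately show ?thesis using T(1) by blast
qed

end

theorem theorem1p1:
  fixes \<sigma> \<sigma>1 \<sigma>2 m p :: real
    and u0 u1 :: "real ^ 'n \<Rightarrow> complex"
  assumes "\<sigma> \<ge> 1"
    and "0 \<le> \<sigma>1" and "\<sigma>1 < \<sigma> / 2" and "\<sigma> / 2 < \<sigma>2" and "\<sigma>2 \<le> \<sigma>"
    and "\<sigma>1 = 0 \<Longrightarrow> 1 < m \<and> m \<le> 2"
    and "\<sigma>1 > 0 \<Longrightarrow> 1 < m \<and> m < 2 * real CARD('n) / (real CARD('n) + 4 * \<sigma>1)"
    and "p > 1"
    and "(real CARD('n) \<le> 2 * \<sigma> \<and> 2 / m < p) \<or>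
         (2 * \<sigma> < real CARD('n) \<and> (m = 2 \<or> real CARD('n) < 4 * \<sigma> / (2 - m)) \<and>
          2 / m < p \<and> p \<le> real CARD('n) / (real CARD('n) - 2 * \<sigma>))"
    and "(u0, u1) \<in> data_space \<sigma> m"
  shows "\<exists>T > 0. \<exists>\<epsilon>0 > 0. \<forall>\<epsilon> \<in> {0<..\<epsilon>0}.
           (\<exists>u. duhamel_solution \<sigma> \<sigma>1 \<sigma>2 p T \<epsilon> u0 u1 u) \<and>
           (\<forall>u v. duhamel_solution \<sigma> \<sigma>1 \<sigma>2 p T \<epsilon> u0 u1 u \<and>
                  duhamel_solution \<sigma> \<sigma>1 \<sigma>2 p T \<epsilon> u0 u1 v \<longrightarrow>
                  (\<forall>t\<in>{0..<T}. AE x in lebesgue. u t x = v t x))"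
proof -
  \<comment> \<open>When n \<le> 2 \<sigma> this holds because 1 - 1/p is below 1. In the other case
    it is the upper bound on \<open>p\<close>, cleared of its positive denominator.\<close>
  have subcritical: "real CARD('n) * (1 - 1 / p) \<le> 2 * \<sigma>"
    using assms(9)
  proof
    assume "real CARD('n) \<le> 2 * \<sigma> \<and> 2 / m < p"
    moreover have "real CARD('n) * (1 - 1 / p) \<le> real CARD('n) * 1"
      using assms(8) by (intro mult_left_mono) auto
    ultimately show ?thesis by linarith
  next
    assume a: "2 * \<sigma> < real CARD('n) \<and> (m = 2 \<or> real CARD('n) < 4 * \<sigma> / (2 - m)) \<and>
      2 / m < p \<and> p \<le> real CARD('n) / (real CARD('n) - 2 * \<sigma>)"
    then have "0 < real CARD('n) - 2 * \<sigma>" "p \<le> real CARD('n) / (real CARD('n) - 2 * \<sigma>)"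
      by linarith+
    then have "p * (real CARD('n) - 2 * \<sigma>) \<le> real CARD('n)"
      by (rule pos_le_divide_eq[THEN iffD1])
    then show ?thesis using assms(8) by (simp add: field_simps)
  qed
  interpret semilinear_problem \<sigma> \<sigma>1 \<sigma>2 p u0 u1
    by standard (use assms subcritical in \<open>auto simp: data_space_def\<close>)
  show ?thesis
    using local_well_posedness zero_less_one by blast
qed

end
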